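(* There are universal constants $c_0,C_0>0$ such that the following holds. Assume $\rho_{\min}:=\min_s\rho(s)>0$, $T\ge4(1-\gamma)^{-2}$ and $MB\ge(1-\gamma)^{-1}$. Let $\underline{\mu}\in(0,1)$, let $$\epsilon\ge C_0\left(\frac{\varepsilon_{\mathsf P}}{(1-\gamma)^3\underline{\mu}^{1/2}}+\frac{\varepsilon_{\mathsf r}}{(1-\gamma)^2\underline{\mu}^{1/2}}+\frac{\gamma^TT}{(1-\gamma)\underline{\mu}^{1/2}}\right),\qquad\epsilon>0,$$ and let $$0<\eta\le c_0\min\Big((1-\gamma)^3,\ (1-\gamma)^7\underline{\mu}BM\epsilon^2,\ \underline{\mu}^{1/2}\epsilon(1-\gamma)^5B\Big).$$ Write $\delta_0=J^\star-J(\theta^0)>0$. Then there is a number of local steps $H\ge1$ such that, if the iterates of S-FedPG (with $\mathcal T$ the identity) run with step size $\eta$ and $H$ local steps satisfy $\inf_{r\ge0}\mu_{\mathrm s}(\theta^r)\ge\underline{\mu}$ almost surely, then S-FedPG achieves $\mathbb{E}[J^\star-J(\theta^R)]\le\epsilon$ for every number of communication rounds $$R\ge C_0\,\frac{\delta_0-\epsilon/6}{\delta_0\,\underline{\mu}\,\epsilon}\cdot\frac1{(1-\gamma)^3}$$ with total number of sampled trajectories per agent $$RHB\ge C_0\,\frac{\delta_0-\epsilon/6}{\delta_0\,\underline{\mu}\,\epsilon}\max\Big(\frac{B}{(1-\gamma)^3},\ \frac{1}{(1-\gamma)^7\underline{\mu}M\epsilon^2},\ \frac{1}{(1-\gamm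a)^5\underline{\mu}^{1/2}\epsilon}\Big).$$
   Context: Setting. $M$ agents; agent $c\in[M]$ has a finite MDP $(\mathcal S,\mathcal A,\gamma,\mathsf P_c,\mathsf r_c,\rho)$ with common finite state space $\mathcal S$, finite action space $\mathcal A$, discount $\gamma\in(0,1)$ and initial distribution $\rho$, its own transition kernel $\mathsf P_c$, and its own reward $\mathsf r_c:\mathcal S\times\mathcal A\to[0,1]$. Heterogeneity: $\varepsilon_{\mathsf P}=\max_{s,a}\max_{c,c'}\|\mathsf P_c(\cdot|s,a)-\mathsf P_{c'}(\cdot|s,a)\|_1$ and $\varepsilon_{\mathsf r}=\max_{c,c'}\|\mathsf r_c-\mathsf r_{c'}\|_\infty$. Softmax policies: for $\theta\in\mathbb{R}^{\mathcal S\times\mathcal A}$, $\pi_\theta(a|s)=e^{\theta(s,a)}/\sum_{a'}e^{\theta(s,a')}$. Objective: $J_c(\theta)=\mathbb{E}[\sum_{t\ge0}\gamma^t\mathsf r_c(S^t,A^t)]$ with $S^0\sim\rho$, $A^t\sim\pi_\theta(\cdot|S^t)$, $S^{t+1}\sim\mathsf P_c(\cdot|S^t,A^t)$; $J=\frac1M\sum_cJ_c$; $J_c^\star=\sup_\theta J_c(\theta)$; $J^\star=\frac1M\sum_cJ_c^\star$. Occupancy: for a stationary policy $\pi$, $d_c^{\rho,\pi}(s)=(1-\gamma)\sum_{t\ge0}\gamma^t\,\mathbb{P}_c^\pi(S^t=s)$ where $S^0\sim\rho$ and the trajectory follows $\pi$ in agent $c$'s MDP. For each $c$ fix a deterministic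 optimal policy $\pi_c^\star$ of agent $c$'s MDP, choosing action $a_c^\star(s)$ in state $s$. Set $$\mu_{c,\mathrm s}(\theta)=\frac1{2|\mathcal S|}\min_s\pi_\theta(a_c^\star(s)|s)^2\Big(\max_s\frac{d_c^{\rho,\pi_c^\star}(s)}{d_c^{\rho,\pi_\theta}(s)}\Big)^{-2},\qquad \mu_{\mathrm s}(\theta)=\min_c\mu_{c,\mathrm s}(\theta).$$ Algorithm S-FedPG. Given a deterministic $\theta^0$, for rounds $r=0,\dots,R-1$: each agent sets $\theta_c^{r,0}=\theta^r$; for $h=0,\dots,H-1$ it samples, with fresh randomness independent across agents, $B$ i.i.d. trajectories $z=(s_b^t,a_b^t)_{0\le t\le T-1,\,1\le b\le B}$ of length $T$ from its own MDP (initial distribution $\rho$) with policy $\pi_{\theta_c^{r,h}}$, and sets $\theta_c^{r,h+1}=\theta_c^{r,h}+\eta\,g_c^z(\theta_c^{r,h})$ where $$g_c^z(\theta)=\frac1B\sum_{b=1}^B\sum_{t=0}^{T-1}\gamma^t\Big(\sum_{\ell=0}^t\nabla_\theta\log\pi_\theta(a_b^\ell|s_b^\ell)\Big)\mathsf r_c(s_b^t,a_b^t).$$ Then $\theta^{r+1}=\frac1M\sum_{c=1}^M\theta_c^{r,H}$. *)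

theory Defs
  imports "HOL-Analysis.Analysis" "HOL-Probability.Probability"
begin

section \<open>Time-homogeneous Markov chains driven by pmf kernels\<close>

text \<open>
  Law, on infinite sequences, of the Markov chain with initial law \<open>p\<close> and transition kernel
  \<open>K\<close>, given by the Ionescu-Tulcea construction. The coordinates carry the discrete
  sigma-algebra; \<open>Ionescu_Tulcea_chain\<close> below shows that the construction applies for every
  \<open>p\<close> and \<open>K\<close>.
\<close>

definition chain_kernel :: "'x pmf \<Rightarrow> ('x \<Rightarrow> 'x pmf) \<Rightarrow> nat \<Rightarrow> (nat \<Rightarrow> 'x) \<Rightarrow> 'x measure" where
  "chain_kernel p K i \<omega> = measure_pmf (case i of 0 \<Rightarrow> p | Suc j \<Rightarrow> K (\<omega> j))"

definition chain_measure :: "'x pmf \<Rightarrow> ('x \<Rightarrow> 'x pmf) \<Rightarrow> (nat \<Rightarrow> 'x) measure" where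
  "chain_measure p K =
     projective_family.lim UNIV
       (Ionescu_Tulcea.CI (chain_kernel p K) (\<lambda>_. count_space UNIV)) (\<lambda>_. count_space UNIV)"

lemma Ionescu_Tulcea_chain: "Ionescu_Tulcea (chain_kernel p K) (\<lambda>_. count_space UNIV)"
proof (rule Ionescu_Tulcea.intro)
  fix i
  show "chain_kernel p K i \<in>
      PiM {0..<i} (\<lambda>_. count_space UNIV) \<rightarrow>\<^sub>M subprob_algebra (count_space UNIV)"
  proof (cases i)
    case 0
    then show ?thesis
      by (auto simp: chain_kernel_def[abs_def] space_subprob_algebra
          intro!: measurable_const prob_space_imp_subprob_space prob_space_measure_pmf)
  next
    case (Suc j)
    have "(\<lambda>x. measure_pmf (K x)) \<in> count_space UNIV \<rightarrow>\<^sub>M subprob_algebra (count_space UNIV)"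
      by (auto simp: space_subprob_algebra
          intro!: prob_space_imp_subprob_space prob_space_measure_pmf)
    moreover have "(\<lambda>\<omega>. \<omega> j) \<in> PiM {0..<i} (\<lambda>_. count_space UNIV) \<rightarrow>\<^sub>M count_space UNIV"
      using Suc by (intro measurable_component_singleton) auto
    ultimately have "(\<lambda>\<omega>. measure_pmf (K (\<omega> j))) \<in>
        PiM {0..<i} (\<lambda>_. count_space UNIV) \<rightarrow>\<^sub>M subprob_algebra (count_space UNIV)"
      using measurable_compose by blast
    then show ?thesis
      using Suc by (simp add: chain_kernel_def[abs_def])
  qed
next
  fix i :: nat and x :: "nat \<Rightarrow> 'a"
  show "prob_space (chain_kernel p K i x)"
    by (simp add: chain_kernel_def prob_space_measure_pmf)
qed

text \<open>\<open>chain_run K n x\<close> is the law of the \<open>n\<close> states following \<open>x\<close>.\<close>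

primrec chain_run :: "('x \<Rightarrow> 'x pmf) \<Rightarrow> nat \<Rightarrow> 'x \<Rightarrow> 'x list pmf" where
  "chain_run K 0 x = return_pmf []"
| "chain_run K (Suc n) x = bind_pmf (K x) (\<lambda>y. map_pmf ((#) y) (chain_run K n y))"

fun chain_prefix :: "'x pmf \<Rightarrow> ('x \<Rightarrow> 'x pmf) \<Rightarrow> nat \<Rightarrow> 'x list pmf" where
  "chain_prefix p K 0 = return_pmf []"
| "chain_prefix p K (Suc n) = bind_pmf p (\<lambda>x. map_pmf ((#) x) (chain_run K n x))"


section \<open>Federated Markov decision processes\<close>

text \<open>
  States and actions are finite sets of natural numbers and the agents are \<open>0, \<dots>, M - 1\<close>.
  Keeping the cardinalities out of the types matters: a constant that is bound in a statement
  cannot depend on the state or action space, as it could if these were type variables.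
  Kernels and rewards are only constrained, and only used, on the carriers.
\<close>

record fed_env =
  agents :: nat
  states :: "nat set"
  actions :: "nat set"
  discount :: real
  init :: "nat pmf"
  kernel :: "nat \<Rightarrow> nat \<Rightarrow> nat \<Rightarrow> nat pmf"
  reward :: "nat \<Rightarrow> nat \<Rightarrow> nat \<Rightarrow> real"

definition fed_mdp :: "fed_env \<Rightarrow> bool" where
  "fed_mdp E \<longleftrightarrow>
     agents E \<ge> 1 \<and>
     finite (states E) \<and> states E \<noteq> {} \<and> finite (actions E) \<and> actions E \<noteq> {} \<and>
     0 < discount E \<and> discount E < 1 \<and>
     set_pmf (init E) \<subseteq> states E \<and>
     (\<forall>c<agents E. \<forall>s\<in>states E. \<forall>a\<in>actions E.
        set_pmf (kernel E c s a) \<subseteq> states E \<and> 0 \<le> reward E c s a \<and> reward E c s a \<le> 1)"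

definition eps_P :: "fed_env \<Rightarrow> real" where
  "eps_P E = Max {\<Sum>s'\<in>states E. \<bar>pmf (kernel E c s a) s' - pmf (kernel E c' s a) s'\<bar> | s a c c'.
     s \<in> states E \<and> a \<in> actions E \<and> c < agents E \<and> c' < agents E}"

definition eps_r :: "fed_env \<Rightarrow> real" where
  "eps_r E = Max {\<bar>reward E c s a - reward E c' s a\<bar> | s a c c'.
     s \<in> states E \<and> a \<in> actions E \<and> c < agents E \<and> c' < agents E}"


subsection \<open>Policies, return and occupancy\<close>

type_synonym policy = "nat \<Rightarrow> nat pmf"

definition sa_init :: "fed_env \<Rightarrow> policy \<Rightarrow> (nat \<times> nat) pmf" where
  "sa_init E \<pi> = bind_pmf (init E) (\<lambda>s. map_pmf (Pair s) (\<pi> s))"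

definition sa_step :: "fed_env \<Rightarrow> nat \<Rightarrow> policy \<Rightarrow> nat \<times> nat \<Rightarrow> (nat \<times> nat) pmf" where
  "sa_step E c \<pi> = (\<lambda>(s, a). bind_pmf (kernel E c s a) (\<lambda>s'. map_pmf (Pair s') (\<pi> s')))"

definition path_measure :: "fed_env \<Rightarrow> nat \<Rightarrow> policy \<Rightarrow> (nat \<Rightarrow> nat \<times> nat) measure" where
  "path_measure E c \<pi> = chain_measure (sa_init E \<pi>) (sa_step E c \<pi>)"

definition policy_return :: "fed_env \<Rightarrow> nat \<Rightarrow> policy \<Rightarrow> real" where
  "policy_return E c \<pi> =
     (\<integral>\<omega>. (\<Sum>t. discount E ^ t * reward E c (fst (\<omega> t)) (snd (\<omega> t))) \<partial>path_measure E c \<pi>)"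

definition occupancy :: "fed_env \<Rightarrow> nat \<Rightarrow> policy \<Rightarrow> nat \<Rightarrow> real" where
  "occupancy E c \<pi> s = (1 - discount E) *
     (\<Sum>t. discount E ^ t *
        measure (path_measure E c \<pi>) {\<omega> \<in> space (path_measure E c \<pi>). fst (\<omega> t) = s})"

definition det_policy :: "(nat \<Rightarrow> nat) \<Rightarrow> policy" where
  "det_policy d = (\<lambda>s. return_pmf (d s))"

text \<open>
  Optimality refers to the return from the initial distribution, among all stationary randomized
  policies. When the initial distribution charges every state, this is the same as optimality
  from every starting state.
\<close>

definition optimal_det :: "fed_env \<Rightarrow> nat \<Rightarrow> (nat \<Rightarrow> nat) \<Rightarrow> bool" where
  "optimal_det E c d \<longleftrightarrow>
     (\<forall>s\<in>states E. d s \<in> actions E) \<and>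
     (\<forall>\<pi>. (\<forall>s\<in>states E. set_pmf (\<pi> s) \<subseteq> actions E) \<longrightarrow>
        policy_return E c \<pi> \<le> policy_return E c (det_policy d))"


subsection \<open>Softmax policies and the objective\<close>

text \<open>
  Elements of \<open>\<real>\<^bsup>S \<times> A\<^esup>\<close>; coordinates outside the carriers are ignored by everything below.
\<close>

type_synonym param = "nat \<times> nat \<Rightarrow> real"

definition softmax :: "fed_env \<Rightarrow> param \<Rightarrow> policy" where
  "softmax E \<theta> s = embed_pmf (\<lambda>a. if a \<in> actions E
     then exp (\<theta> (s, a)) / (\<Sum>a'\<in>actions E. exp (\<theta> (s, a'))) else 0)"

lemma pmf_softmax:
  assumes "finite (actions E)" "actions E \<noteq> {}"
  shows "pmf (softmax E \<theta> s) a =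
    (if a \<in> actions E then exp (\<theta> (s, a)) / (\<Sum>a'\<in>actions E. exp (\<theta> (s, a'))) else 0)"
proof -
  let ?Z = "\<Sum>a'\<in>actions E. exp (\<theta> (s, a'))"
  let ?f = "\<lambda>a. if a \<in> actions E then exp (\<theta> (s, a)) / ?Z else 0"
  have Z: "0 < ?Z"
    using assms by (intro sum_pos) auto
  have nonneg: "0 \<le> ?f x" for x
    using Z by simp
  have "(\<integral>\<^sup>+x. ennreal (?f x) \<partial>count_space UNIV) = (\<Sum>x\<in>actions E. ennreal (?f x))"
    using assms by (intro nn_integral_count_space') (auto split: if_splits)
  also have "\<dots> = ennreal (\<Sum>x\<in>actions E. ?f x)"
    by (rule sum_ennreal) (rule nonneg)
  also have "(\<Sum>x\<in>actions E. ?f x) = 1"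
    using Z by (simp flip: sum_divide_distrib)
  finally show ?thesis
    unfolding softmax_def by (subst pmf_embed_pmf) (simp_all only: ennreal_1 nonneg)
qed

definition Jc :: "fed_env \<Rightarrow> nat \<Rightarrow> param \<Rightarrow> real" where
  "Jc E c \<theta> = policy_return E c (softmax E \<theta>)"

definition J :: "fed_env \<Rightarrow> param \<Rightarrow> real" where
  "J E \<theta> = 1 / real (agents E) * (\<Sum>c<agents E. Jc E c \<theta>)"

definition Jc_star :: "fed_env \<Rightarrow> nat \<Rightarrow> real" where
  "Jc_star E c = (SUP \<theta>. Jc E c \<theta>)"

definition J_star :: "fed_env \<Rightarrow> real" where
  "J_star E = 1 / real (agents E) * (\<Sum>c<agents E. Jc_star E c)"

text \<open>
  The argument \<open>d\<close> of \<open>mu_agent\<close> (\<open>d c\<close> in \<open>mu_soft\<close>) is the chosen deterministic optimal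
  policy of the agent.
\<close>

definition mu_agent :: "fed_env \<Rightarrow> nat \<Rightarrow> (nat \<Rightarrow> nat) \<Rightarrow> param \<Rightarrow> real" where
  "mu_agent E c d \<theta> =
     1 / (2 * real (card (states E))) *
     Min ((\<lambda>s. (pmf (softmax E \<theta> s) (d s))\<^sup>2) ` states E) *
     (Max ((\<lambda>s. occupancy E c (det_policy d) s / occupancy E c (softmax E \<theta>) s) ` states E))
       powi (- 2)"

definition mu_soft :: "fed_env \<Rightarrow> (nat \<Rightarrow> nat \<Rightarrow> nat) \<Rightarrow> param \<Rightarrow> real" where
  "mu_soft E d \<theta> = Min ((\<lambda>c. mu_agent E c (d c) \<theta>) ` {..<agents E})"


section \<open>S-FedPG\<close>

text \<open>The gradient in \<open>\<theta>\<close>, as the family of its partial derivatives.\<close>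

definition grad_log_policy :: "fed_env \<Rightarrow> param \<Rightarrow> nat \<times> nat \<Rightarrow> param" where
  "grad_log_policy E \<theta> = (\<lambda>(s, a) x.
     deriv (\<lambda>u. ln (pmf (softmax E (\<theta>(x := u)) s) a)) (\<theta> x))"

lemma grad_log_policy_eq:
  assumes "finite (actions E)" "a \<in> actions E"
  shows "grad_log_policy E \<theta> (s, a) (s', a') =
    (if s' = s \<and> a' \<in> actions E then of_bool (a' = a) - pmf (softmax E \<theta> s) a' else 0)"
proof -
  have ne: "actions E \<noteq> {}"
    using assms by auto
  have pos: "0 < (\<Sum>b\<in>actions E. exp (\<psi> (s, b)))" for \<psi> :: param
    using assms(1) ne by (intro sum_pos) auto
  have ln_eq: "ln (pmf (softmax E \<psi> s) a) = \<psi> (s, a) - ln (\<Sum>b\<in>actions E. exp (\<psi> (s, b)))" for \<psi>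
    using pos[of \<psi>] assms by (simp add: pmf_softmax ne ln_div)
  let ?th = "\<lambda>u. \<theta>((s', a') := u)"
  let ?D = "\<lambda>b. of_bool (s' = s \<and> a' = b) :: real"
  have coord: "((\<lambda>u. ?th u (s, b)) has_real_derivative ?D b) (at (\<theta> (s', a')))" for b
    by (cases "s' = s \<and> a' = b") auto
  have "((\<lambda>u. ?th u (s, a) - ln (\<Sum>b\<in>actions E. exp (?th u (s, b)))) has_real_derivative
      (?D a - (\<Sum>b\<in>actions E. exp (\<theta> (s, b)) * ?D b) / (\<Sum>b\<in>actions E. exp (\<theta> (s, b)))))
      (at (\<theta> (s', a')))"
    by (rule derivative_eq_intros coord refl pos)+ (simp_all add: fun_upd_idem divide_inverse mult.commute)
  then have "grad_log_policy E \<theta> (s, a) (s', a') =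
      ?D a - (\<Sum>b\<in>actions E. exp (\<theta> (s, b)) * ?D b) / (\<Sum>b\<in>actions E. exp (\<theta> (s, b)))"
    unfolding grad_log_policy_def by (simp add: ln_eq DERIV_imp_deriv)
  moreover have "(\<Sum>b\<in>actions E. exp (\<theta> (s, b)) * ?D b) =
      (if s' = s \<and> a' \<in> actions E then exp (\<theta> (s, a')) else 0)"
    using assms(1) by (cases "s' = s") (simp_all add: of_bool_def if_distrib sum.delta cong: if_cong)
  ultimately show ?thesis
    using assms ne by (auto simp: pmf_softmax)
qed

text \<open>A batch assigns to each index \<open>b < B\<close> a trajectory, i.e. a list of state-action pairs.\<close>

definition batch_pmf :: "fed_env \<Rightarrow> nat \<Rightarrow> nat \<Rightarrow> nat \<Rightarrow> param \<Rightarrow> (nat \<Rightarrow> (nat \<times> nat) list) pmf" where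
  "batch_pmf E T B c \<theta> = Pi_pmf {..<B} []
     (\<lambda>_. chain_prefix (sa_init E (softmax E \<theta>)) (sa_step E c (softmax E \<theta>)) T)"

definition grad_est ::
  "fed_env \<Rightarrow> nat \<Rightarrow> nat \<Rightarrow> nat \<Rightarrow> (nat \<Rightarrow> (nat \<times> nat) list) \<Rightarrow> param \<Rightarrow> param" where
  "grad_est E T B c z \<theta> = (\<lambda>x. 1 / real B * (\<Sum>b<B. \<Sum>t<T.
     discount E ^ t * (\<Sum>l\<le>t. grad_log_policy E \<theta> (z b ! l) x) *
     reward E c (fst (z b ! t)) (snd (z b ! t))))"

definition local_step :: "fed_env \<Rightarrow> nat \<Rightarrow> nat \<Rightarrow> real \<Rightarrow> nat \<Rightarrow> param \<Rightarrow> param pmf" where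
  "local_step E T B \<eta> c \<theta> =
     map_pmf (\<lambda>z x. \<theta> x + \<eta> * grad_est E T B c z \<theta> x) (batch_pmf E T B c \<theta>)"

primrec local_iter ::
  "fed_env \<Rightarrow> nat \<Rightarrow> nat \<Rightarrow> real \<Rightarrow> nat \<Rightarrow> nat \<Rightarrow> param \<Rightarrow> param pmf" where
  "local_iter E T B \<eta> c 0 \<theta> = return_pmf \<theta>"
| "local_iter E T B \<eta> c (Suc h) \<theta> = bind_pmf (local_iter E T B \<eta> c h \<theta>) (local_step E T B \<eta> c)"

text \<open>
  One communication round, as a transition kernel on the server parameter. The product law
  encodes that, given the current server parameter, the agents run independently.
\<close>

definition fedpg_round :: "fed_env \<Rightarrow> nat \<Rightarrow> nat \<Rightarrow> real \<Rightarrow> nat \<Rightarrow> param \<Rightarrow> param pmf" where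
  "fedpg_round E T B \<eta> H \<theta> =
     map_pmf (\<lambda>v x. 1 / real (agents E) * (\<Sum>c<agents E. v c x))
       (Pi_pmf {..<agents E} (\<lambda>_. 0) (\<lambda>c. local_iter E T B \<eta> c H \<theta>))"

text \<open>The joint law of the server iterates over all rounds.\<close>

definition fedpg :: "fed_env \<Rightarrow> nat \<Rightarrow> nat \<Rightarrow> real \<Rightarrow> nat \<Rightarrow> param \<Rightarrow> (nat \<Rightarrow> param) measure" where
  "fedpg E T B \<eta> H \<theta>0 = chain_measure (return_pmf \<theta>0) (fedpg_round E T B \<eta> H)"

end

theory Submission
  imports Defs
begin

text \<open>
  Writing expectations over trajectories as finite sums of kernel weights times softmax weights,
  the first three derivatives of the return along a line are explicit, and their bounds give a
  Lipschitz gradient with constant of order \<open>(1 - \<gamma>) ^ -3\<close> and a second-order expansion of the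
  gradient with remainder of order \<open>(1 - \<gamma>) ^ -4\<close>. Take \<open>H\<close> with \<open>\<eta> * H\<close> about
  \<open>(1 - \<gamma>) ^ 3 / 256\<close>. In one round an agent's mean iterate follows its truncated gradient at the
  server point up to the drift over \<open>H\<close> steps and a bias proportional to the variance of the local
  iterate; averaging over agents divides the variance itself by \<open>M\<close>. Together with gradient domination
  by the squared optimality gap, the expected gap \<open>x\<close> satisfies
  \<open>x' \<le> x - \<eta> * H * \<mu> / 2 * (x ^ 2 - (\<epsilon> / 6) ^ 2)\<close>, which stays below \<open>\<epsilon>\<close> once it is there and
  gets there after order \<open>1 / (\<mu> * \<epsilon> * (1 - \<gamma>) ^ 3)\<close> rounds.
\<close>

section \<open>Marginals of Markov chains\<close>

text \<open>The lower bound on \<open>mu_soft\<close> is assumed at server iterates only; nothing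
  comparable is known at the local iterates between two averages. A round is therefore treated as
  one inexact ascent step of length \<open>\<eta> * H\<close> from the server point: gradient
  domination is applied there, and local iterates enter only through the mean and variance of their
  law. The choice of \<open>H\<close> keeps this length below 1/16 of the inverse smoothness
  constant whatever \<open>\<eta>\<close> is, so the number of rounds does not depend on
  \<open>\<eta>\<close>. The caps on \<open>\<eta>\<close> have separate sources:
  \<open>(1 - \<gamma>) ^ 3\<close> leaves room for \<open>H \<ge> 1\<close>, the second cap
  controls the variance of the averaged iterate, and the third the bias, which averaging does not
  reduce. All laws up to a fixed round have finite support. Integrability is then automatic, and the
  almost sure assumption becomes a pointwise one on the support. Parameters are plain functions, so
  gradients are reached through directional derivatives along lines.\<close>

abbreviation expect :: "'a pmf \<Rightarrow> ('a \<Rightarrow> real) \<Rightarrow> real" where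
  "expect p f \<equiv> measure_pmf.expectation p f"

primrec chain_law :: "'x pmf \<Rightarrow> ('x \<Rightarrow> 'x pmf) \<Rightarrow> nat \<Rightarrow> 'x pmf" where
  "chain_law p K 0 = p"
| "chain_law p K (Suc n) = bind_pmf (chain_law p K n) K"

text \<open>After the initial law, each extension kernel of the Ionescu-Tulcea construction depends
  only on the preceding coordinate. Integrals of the newest coordinate therefore obey the recursion
  of \<open>chain_law\<close>, and the projective limit gives a cylinder over coordinate
  \<open>n\<close> the mass computed after finitely many extensions.\<close>

lemma distr_chain_measure:
  "distr (chain_measure p K) (count_space UNIV) (\<lambda>\<omega>. \<omega> n) = measure_pmf (chain_law p K n)"
proof -
  interpret IT: Ionescu_Tulcea "chain_kernel p K" "\<lambda>_. count_space UNIV"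
    by (rule Ionescu_Tulcea_chain)
  let ?N = "\<lambda>_::nat. count_space (UNIV :: 'a set)"
  let ?u = "\<lambda>_::nat. undefined :: 'a"
  have u: "?u \<in> space (PiM {0..<0} ?N)"
    by (simp add: space_PiM PiE_iff extensional_def)
  have comp[measurable]: "(\<lambda>\<omega>. f (\<omega> n)) \<in> PiM {0..<Suc n} ?N \<rightarrow>\<^sub>M borel"
    for f :: "'a \<Rightarrow> ennreal" and n
    by (rule measurable_compose[OF measurable_component_singleton]) auto
  have step: "(\<integral>\<^sup>+\<omega>. f (\<omega> n) \<partial>IT.C 0 (Suc n) ?u)
      = (\<integral>\<^sup>+\<omega>. (\<integral>\<^sup>+x. f x \<partial>chain_kernel p K n \<omega>) \<partial>IT.C 0 n ?u)" for f n
  proof -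
    have "(\<integral>\<^sup>+\<omega>. f (\<omega> n) \<partial>IT.C 0 (Suc n) ?u)
        = (\<integral>\<^sup>+\<omega>. (\<integral>\<^sup>+\<omega>'. f (\<omega>' n) \<partial>IT.eP n \<omega>) \<partial>IT.C 0 n ?u)"
      unfolding IT.C.simps
      apply (subst nn_integral_bind[where B="PiM {0..<Suc n} ?N"])
      using IT.measurable_eP[of n] IT.sets_C[OF u, of n]
      by (simp_all add: measurable_cong_sets[OF IT.sets_C[OF u] refl])
    also have "\<dots> = (\<integral>\<^sup>+\<omega>. (\<integral>\<^sup>+x. f x \<partial>chain_kernel p K n \<omega>) \<partial>IT.C 0 n ?u)"
      by (intro nn_integral_cong) (simp add: IT.space_C[OF u] IT.nn_integral_eP)
    finally show ?thesis .
  qed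
  \<comment> \<open>Extension number \<open>Suc n\<close> adds coordinate \<open>n\<close>, which is
    why \<open>C 0 (Suc n)\<close> is paired with \<open>chain_law p K n\<close>.\<close>
  have law: "(\<integral>\<^sup>+\<omega>. f (\<omega> n) \<partial>IT.C 0 (Suc n) ?u) = (\<integral>\<^sup>+x. f x \<partial>chain_law p K n)" for f n
  proof (induction n arbitrary: f)
    case 0
    show ?case
      unfolding step by (simp add: chain_kernel_def nn_integral_return[OF u])
  next
    case (Suc n)
    have "(\<integral>\<^sup>+\<omega>. (\<integral>\<^sup>+x. f x \<partial>measure_pmf (K (\<omega> n))) \<partial>IT.C 0 (Suc n) ?u)
        = (\<integral>\<^sup>+x. f x \<partial>chain_law p K (Suc n))"
      unfolding Suc[where f="\<lambda>y. \<integral>\<^sup>+x. f x \<partial>measure_pmf (K y)"] by simp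
    then show ?case
      unfolding step[where f=f and n="Suc n"] by (simp only: chain_kernel_def nat.case)
  qed
  have lim: "chain_measure p K = IT.PF.lim"
    by (simp add: chain_measure_def)
  show ?thesis
  proof (rule measure_eqI)
    fix A assume "A \<in> sets (distr (chain_measure p K) (count_space UNIV) (\<lambda>\<omega>. \<omega> n))"
    let ?X = "{\<omega> \<in> space (PiM {n} ?N). \<omega> n \<in> A}"
    have X: "?X \<in> sets (PiM {n} ?N)"
      using measurable_sets[OF measurable_component_singleton[of n "{n}" ?N], of A]
      by (simp add: vimage_def Int_def conj_commute)
    have "emeasure (distr (chain_measure p K) (count_space UNIV) (\<lambda>\<omega>. \<omega> n)) A
        = emeasure IT.PF.lim (IT.PF.emb UNIV {n} ?X)"
      unfolding lim
      by (subst emeasure_distr)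
        (auto simp: measurable_cong_sets[OF IT.PF.sets_lim refl] prod_emb_def space_PiM PiE_iff
          intro!: measurable_component_singleton arg_cong2[where f=emeasure])
    also have "\<dots> = IT.CI {n} ?X"
      by (rule IT.lim[OF _ X]) simp
    also have "\<dots> = IT.C 0 (Suc n) ?u (IT.PF.emb {0..<Suc n} {n} ?X)"
      by (rule IT.emeasure_CI[OF _ X]) auto
    also have "IT.PF.emb {0..<Suc n} {n} ?X = {\<omega> \<in> space (PiM {0..<Suc n} ?N). \<omega> n \<in> A}"
      by (auto simp: prod_emb_def space_PiM PiE_iff extensional_def)
    also have "IT.C 0 (Suc n) ?u \<dots> = (\<integral>\<^sup>+\<omega>. indicator A (\<omega> n) \<partial>IT.C 0 (Suc n) ?u)"
    proof (subst nn_integral_indicator[symmetric])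
      show "{\<omega> \<in> space (PiM {0..<Suc n} ?N). \<omega> n \<in> A} \<in> sets (IT.C 0 (Suc n) ?u)"
        using measurable_sets[OF measurable_component_singleton[of n "{0..<Suc n}" ?N], of A]
        unfolding IT.sets_C[OF u] by (simp add: vimage_def Int_def conj_commute)
    qed (auto intro!: nn_integral_cong split: split_indicator
        simp: IT.space_C[OF u] simp del: IT.C.simps)
    also have "\<dots> = emeasure (measure_pmf (chain_law p K n)) A"
      unfolding law by simp
    finally show "emeasure (distr (chain_measure p K) (count_space UNIV) (\<lambda>\<omega>. \<omega> n)) A
        = emeasure (measure_pmf (chain_law p K n)) A" .
  qed simp
qed

lemma measurable_chain_coordinate: "(\<lambda>\<omega>. \<omega> n) \<in> chain_measure p K \<rightarrow>\<^sub>M count_space UNIV"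
proof -
  interpret IT: Ionescu_Tulcea "chain_kernel p K" "\<lambda>_. count_space UNIV"
    by (rule Ionescu_Tulcea_chain)
  have "chain_measure p K = IT.PF.lim"
    by (simp add: chain_measure_def)
  then show ?thesis
    by (auto simp: measurable_cong_sets[OF IT.PF.sets_lim refl] intro!: measurable_component_singleton)
qed

lemma integral_chain_coordinate:
  fixes f :: "'x \<Rightarrow> real"
  shows "(\<integral>\<omega>. f (\<omega> n) \<partial>chain_measure p K) = expect (chain_law p K n) f"
  unfolding distr_chain_measure[symmetric]
  by (subst integral_distr) (auto intro: measurable_chain_coordinate)

lemma integrable_chain_coordinate:
  fixes f :: "'x \<Rightarrow> real"
  shows "integrable (chain_measure p K) (\<lambda>\<omega>. f (\<omega> n)) \<longleftrightarrow> integrable (chain_law p K n) f"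
  unfolding distr_chain_measure[symmetric]
  by (subst integrable_distr_eq) (auto intro: measurable_chain_coordinate)

lemma AE_chain_coordinate:
  "(AE \<omega> in chain_measure p K. P (\<omega> n)) \<longleftrightarrow> (\<forall>x\<in>set_pmf (chain_law p K n). P x)"
proof -
  have "(AE \<omega> in chain_measure p K. P (\<omega> n)) \<longleftrightarrow> (AE x in chain_law p K n. P x)"
    unfolding distr_chain_measure[symmetric]
    by (subst AE_distr_iff) (auto intro: measurable_chain_coordinate)
  then show ?thesis by (simp add: AE_measure_pmf_iff)
qed

lemma measure_chain_coordinate:
  "measure (chain_measure p K) {\<omega> \<in> space (chain_measure p K). P (\<omega> n)}
    = measure_pmf.prob (chain_law p K n) {x. P x}"
  unfolding distr_chain_measure[symmetric]
  by (subst measure_distr) (auto intro!: measurable_chain_coordinate arg_cong2[where f=measure])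

section \<open>Finite prefixes of a chain: truncation, marginals, supports, point masses\<close>

lemma map_take_chain_run:
  "k \<le> n \<Longrightarrow> map_pmf (take k) (chain_run K n x) = chain_run K k x"
proof (induction n arbitrary: k x)
  case (Suc n)
  show ?case
  proof (cases k)
    case (Suc k')
    with Suc.prems Suc.IH[of k'] show ?thesis
      by (simp add: map_bind_pmf pmf.map_comp o_def flip: Suc.IH[of k'])
  qed (simp add: map_bind_pmf pmf.map_comp o_def)
qed auto

lemma map_take_chain_prefix:
  assumes "k \<le> n"
  shows "map_pmf (take k) (chain_prefix p K n) = chain_prefix p K k"
proof (cases k)
  case 0
  have "take 0 = (\<lambda>_::'a list. [])" by auto
  with 0 show ?thesis by simp
next
  case (Suc k')
  with assms obtain n' where n': "n = Suc n'" "k' \<le> n'" by (cases n) auto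
  show ?thesis
    unfolding n' Suc
    by (simp add: map_bind_pmf pmf.map_comp o_def flip: map_take_chain_run[OF n'(2)])
qed

text \<open>\<open>chain_run\<close> is built from the front and \<open>chain_law\<close> from the
  back, so the induction has to move the last transition past all earlier ones. The start
  \<open>x\<close> is not in the list, hence entry \<open>n\<close> is reached after
  \<open>n + 1\<close> transitions.\<close>

lemma map_nth_chain_run:
  "map_pmf (\<lambda>xs. xs ! Suc n) (chain_run K (Suc (Suc n)) x)
    = bind_pmf (map_pmf (\<lambda>xs. xs ! n) (chain_run K (Suc n) x)) K"
proof (induction n arbitrary: x)
  case 0
  show ?case by (simp add: map_bind_pmf pmf.map_comp o_def bind_return_pmf' bind_map_pmf bind_assoc_pmf)
next
  case (Suc n)
  have unfold: "map_pmf (\<lambda>xs. xs ! Suc m) (chain_run K (Suc k) x)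
      = bind_pmf (K x) (\<lambda>y. map_pmf (\<lambda>xs. xs ! m) (chain_run K k y))" for m k
    by (subst chain_run.simps) (simp add: map_bind_pmf pmf.map_comp o_def del: chain_run.simps)
  show ?case
    unfolding unfold[of "Suc n"] Suc.IH unfold[of n] bind_assoc_pmf ..
qed

lemma map_nth_chain_prefix:
  "map_pmf (\<lambda>xs. xs ! n) (chain_prefix p K (Suc n)) = chain_law p K n"
proof (induction n)
  case (Suc n)
  have unfold: "map_pmf (\<lambda>xs. xs ! Suc m) (chain_prefix p K (Suc k))
      = bind_pmf p (\<lambda>y. map_pmf (\<lambda>xs. xs ! m) (chain_run K k y))" for m k
    by (subst chain_prefix.simps) (simp add: map_bind_pmf pmf.map_comp o_def del: chain_run.simps)
  have "map_pmf (\<lambda>xs. xs ! Suc n) (chain_prefix p K (Suc (Suc n)))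
      = bind_pmf (map_pmf (\<lambda>xs. xs ! n) (chain_prefix p K (Suc n))) K"
  proof (cases n)
    case 0
    then show ?thesis
      by (simp add: map_bind_pmf pmf.map_comp o_def bind_return_pmf' bind_map_pmf)
  next
    case (Suc m)
    show ?thesis
      unfolding Suc unfold[of "Suc m"] map_nth_chain_run unfold[of m] bind_assoc_pmf ..
  qed
  then show ?case using Suc by simp
qed (simp add: map_bind_pmf pmf.map_comp o_def bind_return_pmf')

lemma length_chain_run: "xs \<in> set_pmf (chain_run K n x) \<Longrightarrow> length xs = n"
  by (induction n arbitrary: x xs) auto

lemma length_chain_prefix: "xs \<in> set_pmf (chain_prefix p K n) \<Longrightarrow> length xs = n"
  by (cases n) (auto dest: length_chain_run)

lemma set_chain_run:
  assumes "\<And>y. y \<in> Y \<Longrightarrow> set_pmf (K y) \<subseteq> Y"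
  shows "x \<in> Y \<Longrightarrow> xs \<in> set_pmf (chain_run K n x) \<Longrightarrow> set xs \<subseteq> Y"
proof (induction n arbitrary: x xs)
  case (Suc n)
  then obtain y ys where "y \<in> set_pmf (K x)" "ys \<in> set_pmf (chain_run K n y)" "xs = y # ys"
    by auto
  with Suc.IH[of y ys] Suc.prems(1) assms[of x] show ?case by auto
qed auto

lemma set_chain_prefix:
  assumes "\<And>y. y \<in> Y \<Longrightarrow> set_pmf (K y) \<subseteq> Y" "set_pmf p \<subseteq> Y" "xs \<in> set_pmf (chain_prefix p K n)"
  shows "set xs \<subseteq> Y"
proof (cases n)
  case (Suc m)
  with assms(3) obtain x ys where "x \<in> set_pmf p" "ys \<in> set_pmf (chain_run K m x)" "xs = x # ys"
    by auto
  with assms(1,2) set_chain_run[of Y K x ys m] show ?thesis by auto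
qed (use assms in auto)

lemma set_chain_law:
  assumes "\<And>y. y \<in> Y \<Longrightarrow> set_pmf (K y) \<subseteq> Y" "set_pmf p \<subseteq> Y"
  shows "set_pmf (chain_law p K n) \<subseteq> Y"
  using assms by (induction n) auto

lemma pmf_chain_run_Cons:
  "pmf (chain_run K (Suc n) x) (y # ys) = pmf (K x) y * pmf (chain_run K n y) ys"
proof -
  have "pmf (map_pmf ((#) z) (chain_run K n z)) (y # ys)
      = indicator {y} z * pmf (chain_run K n y) ys" for z
    by (auto simp: pmf_map_inj' pmf_eq_0_set_pmf split: split_indicator)
  then show ?thesis
    by (simp add: pmf_bind measure_pmf_single)
qed

lemma pmf_chain_prefix_Cons:
  "pmf (chain_prefix p K (Suc n)) (y # ys) = pmf p y * pmf (chain_run K n y) ys"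
proof -
  have "pmf (map_pmf ((#) z) (chain_run K n z)) (y # ys)
      = indicator {y} z * pmf (chain_run K n y) ys" for z
    by (auto simp: pmf_map_inj' pmf_eq_0_set_pmf split: split_indicator)
  then show ?thesis
    by (simp add: pmf_bind measure_pmf_single)
qed

section \<open>Vectors indexed by a finite set and random vectors of finite support\<close>

text \<open>Parameters are functions on all of \<open>nat \<times> nat\<close>, of which only the
  finite carrier matters. An inner product relative to \<open>X\<close>, together with
  \<open>L2_set\<close>, plays the role of the Euclidean structure and ignores the other
  coordinates.\<close>

definition dot :: "'x set \<Rightarrow> ('x \<Rightarrow> real) \<Rightarrow> ('x \<Rightarrow> real) \<Rightarrow> real" where
  "dot X u v = (\<Sum>x\<in>X. u x * v x)"

lemma dot_diff_left: "dot X (\<lambda>x. u x - v x) w = dot X u w - dot X v w"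
  and dot_add_right: "dot X w (\<lambda>x. u x + v x) = dot X w u + dot X w v"
  and dot_diff_right: "dot X w (\<lambda>x. u x - v x) = dot X w u - dot X w v"
  and dot_scale_left: "dot X (\<lambda>x. c * u x) w = c * dot X u w"
  and dot_scale_right: "dot X w (\<lambda>x. c * u x) = c * dot X w u"
  by (simp_all add: dot_def algebra_simps sum.distrib sum_subtractf sum_distrib_left)

lemma dot_commute: "dot X u v = dot X v u"
  by (simp add: dot_def mult.commute)

lemma dot_sum_left: "dot X (\<lambda>x. \<Sum>i\<in>I. u i x) w = (\<Sum>i\<in>I. dot X (u i) w)"
  unfolding dot_def sum_distrib_right by (rule sum.swap)

lemma L2_set_power2: "(L2_set u X)\<^sup>2 = (\<Sum>x\<in>X. (u x)\<^sup>2)"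
  by (simp add: L2_set_def sum_nonneg)

lemma dot_self: "dot X u u = (L2_set u X)\<^sup>2"
  unfolding L2_set_power2 by (simp add: dot_def power2_eq_square)

lemma abs_dot_le: "\<bar>dot X u v\<bar> \<le> L2_set u X * L2_set v X"
proof -
  have "\<bar>dot X u v\<bar> \<le> (\<Sum>x\<in>X. \<bar>u x\<bar> * \<bar>v x\<bar>)"
    unfolding dot_def by (rule order_trans[OF sum_abs]) (simp add: abs_mult)
  also have "\<dots> \<le> L2_set u X * L2_set v X"
    by (rule L2_set_mult_ineq)
  finally show ?thesis .
qed

text \<open>Duality of the Euclidean norm, by testing with \<open>v = u\<close>. It converts bounds
  on directional derivatives into bounds on gradients.\<close>

lemma L2_set_le_if_dot_le:
  assumes "\<And>v. dot X u v \<le> K * L2_set v X" "0 \<le> K"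
  shows "L2_set u X \<le> K"
proof (cases "L2_set u X = 0")
  case False
  then have "0 < L2_set u X" using L2_set_nonneg[of u X] by linarith
  moreover have "L2_set u X * L2_set u X \<le> K * L2_set u X"
    using assms(1)[of u] by (simp add: dot_self power2_eq_square)
  ultimately show ?thesis by simp
qed (use assms in simp)

lemma L2_set_scale: "L2_set (\<lambda>x. c * u x) X = \<bar>c\<bar> * L2_set u X"
  by (simp add: L2_set_def power_mult_distrib sum_distrib_left[symmetric] real_sqrt_mult)

lemma L2_set_minus_commute: "L2_set (\<lambda>x. u x - v x) X = L2_set (\<lambda>x. v x - u x) X"
  by (simp add: L2_set_def power2_commute)

lemma L2_set_diff_triangle:
  "L2_set (\<lambda>x. u x - w x) X \<le> L2_set (\<lambda>x. u x - v x) X + L2_set (\<lambda>x. v x - w x) X"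
  using L2_set_triangle_ineq[of "\<lambda>x. u x - v x" "\<lambda>x. v x - w x" X] by simp

lemma L2_set_le_diff: "L2_set u X \<le> L2_set v X + L2_set (\<lambda>x. u x - v x) X"
  using L2_set_triangle_ineq[of v "\<lambda>x. u x - v x" X] by simp

lemma L2_set_sum: "L2_set (\<lambda>x. \<Sum>i\<in>I. u i x) X \<le> (\<Sum>i\<in>I. L2_set (u i) X)"
proof (induction I rule: infinite_finite_induct)
  case (insert i I)
  then show ?case
    using L2_set_triangle_ineq[of "u i" "\<lambda>x. \<Sum>i\<in>I. u i x" X] by simp
qed (simp_all add: L2_set_def)

lemma abs_le_L2_set: "finite X \<Longrightarrow> x \<in> X \<Longrightarrow> \<bar>u x\<bar> \<le> L2_set u X"
  using member_le_L2_set[of X x "\<lambda>x. \<bar>u x\<bar>"] by (simp add: L2_set_def)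

lemma dot_indicator: "finite X \<Longrightarrow> x \<in> X \<Longrightarrow> dot X u (\<lambda>y. of_bool (y = x)) = u x"
  by (simp add: dot_def of_bool_def if_distrib cong: if_cong)

lemma L2_set_indicator: "finite X \<Longrightarrow> x \<in> X \<Longrightarrow> L2_set (\<lambda>y. of_bool (y = x)) X = 1"
  by (simp add: L2_set_def of_bool_def if_distrib[where f="\<lambda>c. c\<^sup>2"] cong: if_cong)

section \<open>Means and variances under finitely supported laws\<close>

lemma expectation_bind_pmf_finite:
  fixes h :: "'b \<Rightarrow> real"
  assumes "finite (set_pmf p)" "\<And>x. x \<in> set_pmf p \<Longrightarrow> finite (set_pmf (f x))"
  shows "expect (bind_pmf p f) h
    = expect p (\<lambda>x. expect (f x) h)"
  using assms by (subst pmf_expectation_bind[of "set_pmf p"]) (auto simp: integral_measure_pmf_real[of "set_pmf p"] mult.commute)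

lemma expectation_mono_pmf_finite:
  fixes f g :: "'a \<Rightarrow> real"
  assumes "finite (set_pmf p)" "\<And>x. x \<in> set_pmf p \<Longrightarrow> f x \<le> g x"
  shows "expect p f \<le> expect p g"
  using assms by (intro integral_mono_AE integrable_measure_pmf_finite) (auto simp: AE_measure_pmf_iff)

lemma expectation_cong_pmf:
  fixes f g :: "'a \<Rightarrow> real"
  assumes "\<And>x. x \<in> set_pmf p \<Longrightarrow> f x = g x"
  shows "expect p f = expect p g"
  using assms by (intro integral_cong_AE) (auto simp: AE_measure_pmf_iff)

lemma abs_expectation_le_pmf:
  fixes f :: "'a \<Rightarrow> real"
  shows "\<bar>expect p f\<bar> \<le> expect p (\<lambda>x. \<bar>f x\<bar>)"
  using integral_norm_bound[of p f] by simp

definition pmean :: "'z pmf \<Rightarrow> ('z \<Rightarrow> 'x \<Rightarrow> real) \<Rightarrow> 'x \<Rightarrow> real" where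
  "pmean p f x = expect p (\<lambda>z. f z x)"

text \<open>The trace of the covariance matrix, restricted to the coordinates in
  \<open>X\<close>.\<close>

definition pvar :: "'x set \<Rightarrow> 'z pmf \<Rightarrow> ('z \<Rightarrow> 'x \<Rightarrow> real) \<Rightarrow> real" where
  "pvar X p f = expect p (\<lambda>z. (L2_set (\<lambda>x. f z x - pmean p f x) X)\<^sup>2)"

lemma dot_pmean:
  assumes "finite (set_pmf p)"
  shows "dot X (pmean p f) v = expect p (\<lambda>z. dot X (f z) v)"
  unfolding dot_def pmean_def
  by (subst Bochner_Integration.integral_sum) (auto intro!: integrable_measure_pmf_finite assms)

lemma pvar_nonneg: "0 \<le> pvar X p f"
  by (simp add: pvar_def)

text \<open>The bias-variance decomposition around an arbitrary point \<open>a\<close>; the cross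
  term vanishes coordinate by coordinate because \<open>f - pmean p f\<close> is centred.\<close>

lemma expectation_L2_set_diff:
  assumes fin: "finite (set_pmf p)"
  shows "expect p (\<lambda>z. (L2_set (\<lambda>x. f z x - a x) X)\<^sup>2)
    = pvar X p f + (L2_set (\<lambda>x. pmean p f x - a x) X)\<^sup>2"
proof -
  note [simp] = integrable_measure_pmf_finite[OF fin]
  have "expect p (\<lambda>z. (f z x - a x)\<^sup>2)
      = expect p (\<lambda>z. (f z x - pmean p f x)\<^sup>2) + (pmean p f x - a x)\<^sup>2" for x
  proof -
    have "(f z x - a x)\<^sup>2 = (f z x - pmean p f x)\<^sup>2 + 2 * (pmean p f x - a x) * (f z x - pmean p f x)
        + (pmean p f x - a x)\<^sup>2" for z
      by (simp add: power2_eq_square algebra_simps)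
    moreover have "expect p (\<lambda>z. f z x - pmean p f x) = 0"
      by (simp add: pmean_def)
    ultimately show ?thesis
      by simp
  qed
  then show ?thesis
    by (simp add: pvar_def L2_set_power2 Bochner_Integration.integral_sum sum.distrib)
qed

lemma pvar_le:
  assumes "finite (set_pmf p)"
  shows "pvar X p f \<le> expect p (\<lambda>z. (L2_set (\<lambda>x. f z x - a x) X)\<^sup>2)"
  by (simp add: expectation_L2_set_diff[OF assms])

lemma pvar_scale: "pvar X p (\<lambda>z x. c * f z x) = c\<^sup>2 * pvar X p f"
proof -
  have "L2_set (\<lambda>x. c * f z x - pmean p (\<lambda>z x. c * f z x) x) X
      = \<bar>c\<bar> * L2_set (\<lambda>x. f z x - pmean p f x) X" for z
    by (subst L2_set_scale[symmetric]) (simp add: pmean_def right_diff_distrib)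
  then show ?thesis
    by (simp add: pvar_def power_mult_distrib)
qed

lemma pvar_add_const:
  assumes "finite (set_pmf p)"
  shows "pvar X p (\<lambda>z x. a x + f z x) = pvar X p f"
  by (simp add: pvar_def pmean_def integrable_measure_pmf_finite[OF assms])

lemma pmean_map: "pmean (map_pmf g p) f = pmean p (\<lambda>z. f (g z))"
  by (rule ext) (simp add: pmean_def)

lemma pvar_map: "pvar X (map_pmf g p) f = pvar X p (\<lambda>z. f (g z))"
  by (simp add: pvar_def pmean_map)

section \<open>Products of independent components\<close>

lemma finite_set_Pi_pmf:
  assumes "finite I" "\<And>i. i \<in> I \<Longrightarrow> finite (set_pmf (p i))"
  shows "finite (set_pmf (Pi_pmf I d p))"
  using assms by (intro finite_subset[OF set_Pi_pmf_subset'] finite_PiE_dflt) auto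

lemma expectation_Pi_pmf_component:
  fixes h :: "'b \<Rightarrow> real"
  assumes "finite I" "i \<in> I"
  shows "expect (Pi_pmf I d p) (\<lambda>z. h (z i)) = expect (p i) h"
  using Pi_pmf_component[OF assms(1), of i d p] assms(2)
    integral_map_pmf[of "\<lambda>z. z i" "Pi_pmf I d p" h] by simp

text \<open>Splitting off one component leaves the square of \<open>g i y + S\<close>, whose cross
  term is \<open>g i y\<close> times the expectation of \<open>S\<close>, and that is zero.\<close>

lemma expectation_Pi_pmf_sum_power2:
  fixes g :: "'i \<Rightarrow> 'b \<Rightarrow> real"
  assumes "finite I" "\<And>i. i \<in> I \<Longrightarrow> finite (set_pmf (p i))"
    and "\<And>i. i \<in> I \<Longrightarrow> expect (p i) (g i) = 0"
  shows "expect (Pi_pmf I d p) (\<lambda>z. (\<Sum>i\<in>I. g i (z i))\<^sup>2)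
    = (\<Sum>i\<in>I. expect (p i) (\<lambda>y. (g i y)\<^sup>2))"
  using assms
proof (induction I rule: finite_induct)
  case (insert i I)
  let ?P = "Pi_pmf I d p" and ?S = "\<lambda>z. \<Sum>j\<in>I. g j (z j)"
  have fin: "finite (set_pmf ?P)" "finite (set_pmf (p i))"
    using insert by (auto intro!: finite_set_Pi_pmf)
  note int = integrable_measure_pmf_finite[OF fin(1)] integrable_measure_pmf_finite[OF fin(2)]
  have upd: "(\<Sum>j\<in>I. g j (if j = i then y else z j)) = ?S z" for z y
    using insert(2) by (intro sum.cong) auto
  have S0: "expect ?P ?S = 0"
    using insert by (simp add: Bochner_Integration.integral_sum int expectation_Pi_pmf_component)
  have "expect (Pi_pmf (insert i I) d p) (\<lambda>z. (\<Sum>j\<in>insert i I. g j (z j))\<^sup>2)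
      = expect (p i) (\<lambda>y. expect ?P (\<lambda>z. (g i y + ?S z)\<^sup>2))"
    using insert(1,2) fin
    by (simp add: Pi_pmf_insert pair_pmf_def map_bind_pmf expectation_bind_pmf_finite upd case_prod_beta)
  also have "(\<lambda>y. expect ?P (\<lambda>z. (g i y + ?S z)\<^sup>2))
      = (\<lambda>y. (g i y)\<^sup>2 + expect ?P (\<lambda>z. (?S z)\<^sup>2))"
  proof
    fix y
    have "(g i y + ?S z)\<^sup>2 = (g i y)\<^sup>2 + 2 * g i y * ?S z + (?S z)\<^sup>2" for z
      by (rule power2_sum[THEN trans]) simp
    then have "expect ?P (\<lambda>z. (g i y + ?S z)\<^sup>2)
        = expect ?P (\<lambda>z. (g i y)\<^sup>2 + 2 * g i y * ?S z + (?S z)\<^sup>2)"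
      by simp
    also have "\<dots> = (g i y)\<^sup>2 + 2 * g i y * expect ?P ?S + expect ?P (\<lambda>z. (?S z)\<^sup>2)"
      by (simp add: int)
    finally show "expect ?P (\<lambda>z. (g i y + ?S z)\<^sup>2)
        = (g i y)\<^sup>2 + expect ?P (\<lambda>z. (?S z)\<^sup>2)"
      by (simp add: S0)
  qed
  finally show ?case
    using insert by (simp add: int)
qed simp

lemma pmean_Pi_pmf_sum:
  assumes "finite I" "\<And>i. i \<in> I \<Longrightarrow> finite (set_pmf (p i))"
  shows "pmean (Pi_pmf I d p) (\<lambda>z x. \<Sum>i\<in>I. f i (z i) x) x = (\<Sum>i\<in>I. pmean (p i) (f i) x)"
  using assms unfolding pmean_def
  by (subst Bochner_Integration.integral_sum)
    (auto intro!: integrable_measure_pmf_finite finite_set_Pi_pmf sum.cong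
      simp: expectation_Pi_pmf_component[where h="\<lambda>y. f _ y x"])

text \<open>Additivity of the variance under independence. Combined with \<open>pvar_scale\<close>
  it gives the factor \<open>1 / B\<close> for a batch and the factor \<open>1 / M\<close> for the
  server average.\<close>

lemma pvar_Pi_pmf_sum:
  assumes "finite I" "\<And>i. i \<in> I \<Longrightarrow> finite (set_pmf (p i))"
  shows "pvar X (Pi_pmf I d p) (\<lambda>z x. \<Sum>i\<in>I. f i (z i) x) = (\<Sum>i\<in>I. pvar X (p i) (f i))"
proof -
  note int = integrable_measure_pmf_finite[OF finite_set_Pi_pmf[OF assms]]
    integrable_measure_pmf_finite[OF assms(2)]
  have "expect (Pi_pmf I d p) (\<lambda>z. ((\<Sum>i\<in>I. f i (z i) x) - (\<Sum>i\<in>I. pmean (p i) (f i) x))\<^sup>2)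
      = (\<Sum>i\<in>I. expect (p i) (\<lambda>y. (f i y x - pmean (p i) (f i) x)\<^sup>2))" for x
    unfolding sum_subtractf[symmetric]
    by (rule expectation_Pi_pmf_sum_power2[OF assms, where g="\<lambda>i y. f i y x - pmean (p i) (f i) x"])
      (simp_all add: int pmean_def)
  then show ?thesis
    by (simp add: pvar_def L2_set_power2 pmean_Pi_pmf_sum[OF assms, where f=f] Bochner_Integration.integral_sum int)
      (rule sum.swap)
qed


section \<open>Real analysis\<close>

lemma second_order_remainder_le:
  fixes f f' f'' :: "real \<Rightarrow> real"
  assumes "\<And>t. DERIV f t :> f' t" "\<And>t. DERIV f' t :> f'' t" "\<And>t. \<bar>f'' t\<bar> \<le> K"
  shows "\<bar>f 1 - f 0 - f' 0\<bar> \<le> K / 2"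
proof -
  define D where "D m = (if m = 0 then f else if m = 1 then f' else f'')" for m :: nat
  have "\<exists>t>0. t \<le> 1 \<and> f 1 = (\<Sum>m<2. D m 0 / fact m * 1 ^ m) + D 2 t / fact 2 * 1 ^ 2"
    by (rule Maclaurin2) (auto simp: D_def less_2_cases_iff assms)
  then obtain t where "f 1 = f 0 + f' 0 + f'' t / 2"
    by (auto simp: D_def numeral_2_eq_2)
  then show ?thesis using assms(3)[of t] by simp
qed

lemma first_order_remainder_le:
  fixes f f' :: "real \<Rightarrow> real"
  assumes "\<And>t. DERIV f t :> f' t" "\<And>t. \<bar>f' t\<bar> \<le> K"
  shows "\<bar>f 1 - f 0\<bar> \<le> K"
proof -
  obtain z where "f 1 - f 0 = (1 - 0) * f' z"
    using MVT2[of 0 1 f f'] assms(1) by auto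
  then show ?thesis using assms(2)[of z] by simp
qed

text \<open>A Cauchy product with the geometric series replaces the coefficients by their partial
  sums and multiplies the value by \<open>1 / (1 - g)\<close>. Starting from constant coefficients,
  this runs through the binomial coefficients.\<close>

lemma sums_power_weights:
  fixes g :: real
  assumes "0 < g" "g < 1"
  shows "(\<lambda>t. (real t + 1) * g ^ t) sums (1 / (1 - g)\<^sup>2)"
    and "(\<lambda>t. (real t + 1) * (real t + 2) / 2 * g ^ t) sums (1 / (1 - g) ^ 3)"
    and "(\<lambda>t. (real t + 1) * (real t + 2) * (real t + 3) / 6 * g ^ t) sums (1 / (1 - g) ^ 4)"
proof -
  have n: "norm g < 1" using assms by simp
  have geo: "(\<lambda>t. g ^ t) sums (1 / (1 - g))" by (rule geometric_sums[OF n])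
  have sg: "summable (\<lambda>t. norm (g ^ t))" using n by (simp add: power_abs summable_geometric)
  have prod: "(\<lambda>t. b t * g ^ t) sums (z * (1 / (1 - g)))"
    if a: "(\<lambda>t. a t * g ^ t) sums z" and pos: "\<And>t. 0 \<le> a t" and b: "\<And>t. b t = (\<Sum>i\<le>t. a i)" for a b z
  proof -
    have "summable (\<lambda>t. norm (a t * g ^ t))"
      using a assms pos by (simp add: abs_mult sums_iff)
    from Cauchy_product_sums[OF this sg]
    have "(\<lambda>t. \<Sum>i\<le>t. a i * g ^ i * g ^ (t - i)) sums (z * (1 / (1 - g)))"
      using a geo by (simp add: sums_iff)
    moreover have "(\<Sum>i\<le>t. a i * g ^ i * g ^ (t - i)) = b t * g ^ t" for t
      unfolding b sum_distrib_right by (intro sum.cong) (simp_all flip: power_add)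
    ultimately show ?thesis by simp
  qed
  have 1: "real t + 1 = (\<Sum>i\<le>t. 1)" for t by simp
  have 2: "(real t + 1) * (real t + 2) / 2 = (\<Sum>i\<le>t. real i + 1)" for t
    by (induction t) (simp_all add: field_simps)
  have 3: "(real t + 1) * (real t + 2) * (real t + 3) / 6 = (\<Sum>i\<le>t. (real i + 1) * (real i + 2) / 2)" for t
    by (induction t) (simp_all add: field_simps)
  show A: "(\<lambda>t. (real t + 1) * g ^ t) sums (1 / (1 - g)\<^sup>2)"
    using prod[where a="\<lambda>_. 1" and z="1 / (1 - g)", OF _ _ 1] geo by (simp add: power2_eq_square)
  show B: "(\<lambda>t. (real t + 1) * (real t + 2) / 2 * g ^ t) sums (1 / (1 - g) ^ 3)"
    using prod[OF A _ 2] by (simp add: power2_eq_square power3_eq_cube)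
  show "(\<lambda>t. (real t + 1) * (real t + 2) * (real t + 3) / 6 * g ^ t) sums (1 / (1 - g) ^ 4)"
    using prod[OF B _ 3] by (simp add: power4_eq_xxxx power3_eq_cube)
qed

text \<open>Powers of \<open>t + 1\<close> are dominated by the rising products
  \<open>(t + 1) * (t + 2) * ...\<close>, whose generating functions are exact; this is the origin
  of the constants 2 and 6.\<close>

lemma summable_power_weights:
  fixes g :: real
  assumes "0 < g" "g < 1"
  shows "summable (\<lambda>t. g ^ t * (real t + 1))"
    and "summable (\<lambda>t. g ^ t * (real t + 1) ^ 2)"
    and "summable (\<lambda>t. g ^ t * (real t + 1) ^ 3)"
    and suminf_power_weight1: "(\<Sum>t. g ^ t * (real t + 1)) = 1 / (1 - g)\<^sup>2"
    and suminf_power_weight2: "(\<Sum>t. g ^ t * (real t + 1) ^ 2) \<le> 2 / (1 - g) ^ 3"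
    and suminf_power_weight3: "(\<Sum>t. g ^ t * (real t + 1) ^ 3) \<le> 6 / (1 - g) ^ 4"
proof -
  note s = sums_power_weights[OF assms]
  show "summable (\<lambda>t. g ^ t * (real t + 1))" "(\<Sum>t. g ^ t * (real t + 1)) = 1 / (1 - g)\<^sup>2"
    using s(1) by (simp_all add: sums_iff mult.commute)
  have s2: "(\<lambda>t. (real t + 1) * (real t + 2) * g ^ t) sums (2 / (1 - g) ^ 3)"
    using sums_mult[OF s(2), of 2] by simp
  have s3: "(\<lambda>t. (real t + 1) * (real t + 2) * (real t + 3) * g ^ t) sums (6 / (1 - g) ^ 4)"
    using sums_mult[OF s(3), of 6] by simp
  have le2: "g ^ t * (real t + 1) ^ 2 \<le> (real t + 1) * (real t + 2) * g ^ t" for t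
    using mult_right_mono[of "(real t + 1)^2" "(real t + 1) * (real t + 2)" "g ^ t"] assms
    by (simp add: power2_eq_square mult.commute mult_left_mono)
  have "(real t + 1) ^ 3 \<le> (real t + 1) * (real t + 2) * (real t + 3)" for t
    unfolding power3_eq_cube by (intro mult_mono) auto
  then have le3: "g ^ t * (real t + 1) ^ 3 \<le> (real t + 1) * (real t + 2) * (real t + 3) * g ^ t" for t
    using mult_right_mono[of "(real t + 1)^3" "(real t + 1) * (real t + 2) * (real t + 3)" "g ^ t"] assms
    by (simp add: mult.commute)
  show S2: "summable (\<lambda>t. g ^ t * (real t + 1) ^ 2)"
    using le2 assms by (intro summable_comparison_test_ev[OF _ sums_summable[OF s2]] always_eventually) simp
  show S3: "summable (\<lambda>t. g ^ t * (real t + 1) ^ 3)"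
    using le3 assms by (intro summable_comparison_test_ev[OF _ sums_summable[OF s3]] always_eventually) simp
  show "(\<Sum>t. g ^ t * (real t + 1) ^ 2) \<le> 2 / (1 - g) ^ 3"
    using suminf_le[OF le2 S2 sums_summable[OF s2]] s2 by (simp add: sums_iff)
  show "(\<Sum>t. g ^ t * (real t + 1) ^ 3) \<le> 6 / (1 - g) ^ 4"
    using suminf_le[OF le3 S3 sums_summable[OF s3]] s3 by (simp add: sums_iff)
qed

lemma abs_suminf_le:
  fixes f :: "nat \<Rightarrow> real"
  assumes "\<And>n. \<bar>f n\<bar> \<le> g n" "summable g"
  shows "summable f" "\<bar>suminf f\<bar> \<le> suminf g"
proof -
  show "summable f"
    using assms by (intro summable_comparison_test_ev[OF _ assms(2)] always_eventually) simp
  have "summable (\<lambda>n. \<bar>f n\<bar>)"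
    using assms by (intro summable_comparison_test_ev[OF _ assms(2)] always_eventually) simp
  then show "\<bar>suminf f\<bar> \<le> suminf g"
    using summable_rabs[of f] suminf_le[of "\<lambda>n. \<bar>f n\<bar>" g] assms by auto
qed

section \<open>Derivatives of the softmax return\<close>

abbreviation sa_pairs :: "fed_env \<Rightarrow> (nat \<times> nat) set" where
  "sa_pairs E \<equiv> states E \<times> actions E"

definition line :: "param \<Rightarrow> param \<Rightarrow> real \<Rightarrow> param" where
  "line \<theta> u t = (\<lambda>x. \<theta> x + t * u x)"

lemma line_0 [simp]: "line \<theta> u 0 = \<theta>"
  and line_1 [simp]: "line \<theta> u 1 = (\<lambda>x. \<theta> x + u x)"
  by (simp_all add: line_def)

text \<open>The derivative of the log-probability of the pair \<open>y\<close> in direction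
  \<open>v\<close>. On the carriers it equals \<open>v y\<close> minus the softmax mean of
  \<open>v\<close> in that state.\<close>

definition score :: "fed_env \<Rightarrow> param \<Rightarrow> param \<Rightarrow> nat \<times> nat \<Rightarrow> real" where
  "score E \<theta> v y = dot (sa_pairs E) v (grad_log_policy E \<theta> y)"

text \<open>The softmax covariance of \<open>u\<close> and \<open>v\<close> in state
  \<open>s\<close>, that is, the Fisher information form. It is also minus the second derivative of
  the log-policy, which is the same for all actions; hence the argument is a state and not a pair.
  \<open>score3\<close> is the corresponding third central moment.\<close>

definition score2 :: "fed_env \<Rightarrow> param \<Rightarrow> param \<Rightarrow> param \<Rightarrow> nat \<Rightarrow> real" where
  "score2 E \<theta> u v s =
    (\<Sum>a\<in>actions E. pmf (softmax E \<theta> s) a * (score E \<theta> u (s, a) * score E \<theta> v (s, a)))"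

definition score3 :: "fed_env \<Rightarrow> param \<Rightarrow> param \<Rightarrow> param \<Rightarrow> param \<Rightarrow> nat \<Rightarrow> real" where
  "score3 E \<theta> u v w s =
    (\<Sum>a\<in>actions E. pmf (softmax E \<theta> s) a *
      (score E \<theta> u (s, a) * score E \<theta> v (s, a) * score E \<theta> w (s, a)))"

definition paths :: "fed_env \<Rightarrow> nat \<Rightarrow> (nat \<times> nat) list set" where
  "paths E n = {\<tau>. set \<tau> \<subseteq> sa_pairs E \<and> length \<tau> = n}"

definition path_prob :: "fed_env \<Rightarrow> param \<Rightarrow> (nat \<times> nat) list \<Rightarrow> real" where
  "path_prob E \<theta> \<tau> = (\<Prod>y\<leftarrow>\<tau>. pmf (softmax E \<theta> (fst y)) (snd y))"

definition path_score :: "fed_env \<Rightarrow> param \<Rightarrow> param \<Rightarrow> (nat \<times> nat) list \<Rightarrow> real" where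
  "path_score E \<theta> v \<tau> = (\<Sum>y\<leftarrow>\<tau>. score E \<theta> v y)"

definition path_score2 :: "fed_env \<Rightarrow> param \<Rightarrow> param \<Rightarrow> param \<Rightarrow> (nat \<times> nat) list \<Rightarrow> real" where
  "path_score2 E \<theta> u v \<tau> = (\<Sum>y\<leftarrow>\<tau>. score2 E \<theta> u v (fst y))"

definition path_score3 :: "fed_env \<Rightarrow> param \<Rightarrow> param \<Rightarrow> param \<Rightarrow> param \<Rightarrow> (nat \<times> nat) list \<Rightarrow> real" where
  "path_score3 E \<theta> u v w \<tau> = (\<Sum>y\<leftarrow>\<tau>. score3 E \<theta> u v w (fst y))"

text \<open>The kernel part of a path weight. It does not involve the parameter, so differentiation
  acts on \<open>path_prob\<close> alone, and it is the only part of the weight that differs between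
  agents.\<close>

primrec base_run :: "fed_env \<Rightarrow> nat \<Rightarrow> nat \<times> nat \<Rightarrow> (nat \<times> nat) list \<Rightarrow> real" where
  "base_run E c y [] = 1"
| "base_run E c y (z # zs) = pmf (kernel E c (fst y) (snd y)) (fst z) * base_run E c z zs"

fun base :: "fed_env \<Rightarrow> nat \<Rightarrow> (nat \<times> nat) list \<Rightarrow> real" where
  "base E c [] = 1"
| "base E c (z # zs) = pmf (init E) (fst z) * base_run E c z zs"

definition traj :: "fed_env \<Rightarrow> nat \<Rightarrow> policy \<Rightarrow> nat \<Rightarrow> (nat \<times> nat) list pmf" where
  "traj E c \<pi> n = chain_prefix (sa_init E \<pi>) (sa_step E c \<pi>) n"

text \<open>The expectation over trajectories of length \<open>n\<close> as a finite sum, which can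
  be differentiated, and compared between two agents, term by term. \<open>path_avg_eq\<close>
  identifies it with the expectation under \<open>traj\<close>.\<close>

definition path_avg :: "fed_env \<Rightarrow> nat \<Rightarrow> nat \<Rightarrow> param \<Rightarrow> ((nat \<times> nat) list \<Rightarrow> real) \<Rightarrow> real" where
  "path_avg E c n \<theta> f = (\<Sum>\<tau>\<in>paths E n. base E c \<tau> * path_prob E \<theta> \<tau> * f \<tau>)"

definition path_reward :: "fed_env \<Rightarrow> nat \<Rightarrow> nat \<Rightarrow> (nat \<times> nat) list \<Rightarrow> real" where
  "path_reward E c t \<tau> = reward E c (fst (\<tau> ! t)) (snd (\<tau> ! t))"

section \<open>Trajectory weights factor into kernel and softmax parts\<close>

lemma pmf_sa_init: "pmf (sa_init E \<pi>) (s, a) = pmf (init E) s * pmf (\<pi> s) a"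
proof -
  have "pmf (map_pmf (Pair s') (\<pi> s')) (s, a) = indicator {s} s' * pmf (\<pi> s) a" for s'
    by (cases "s' = s") (auto simp: pmf_map_inj' inj_on_def pmf_eq_0_set_pmf)
  then show ?thesis by (simp add: sa_init_def pmf_bind measure_pmf_single)
qed

lemma pmf_sa_step: "pmf (sa_step E c \<pi> y) (s, a) = pmf (kernel E c (fst y) (snd y)) s * pmf (\<pi> s) a"
proof -
  have "pmf (map_pmf (Pair s') (\<pi> s')) (s, a) = indicator {s} s' * pmf (\<pi> s) a" for s'
    by (cases "s' = s") (auto simp: pmf_map_inj' inj_on_def pmf_eq_0_set_pmf)
  then show ?thesis by (simp add: sa_step_def pmf_bind measure_pmf_single case_prod_beta)
qed

lemma pmf_traj_run:
  "pmf (chain_run (sa_step E c (softmax E \<theta>)) (length zs) y) zs = base_run E c y zs * path_prob E \<theta> zs"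
proof (induction zs arbitrary: y)
  case (Cons z zs)
  then show ?case
    unfolding list.size add_0_right add_Suc_right pmf_chain_run_Cons
    by (cases z) (simp add: pmf_sa_step path_prob_def)
qed (simp add: path_prob_def)

lemma pmf_traj:
  "pmf (traj E c (softmax E \<theta>) (length \<tau>)) \<tau> = base E c \<tau> * path_prob E \<theta> \<tau>"
proof (cases \<tau>)
  case (Cons z zs)
  show ?thesis
    unfolding traj_def Cons list.size add_0_right add_Suc_right pmf_chain_prefix_Cons pmf_traj_run
    by (cases z) (simp add: pmf_sa_init path_prob_def)
qed (simp add: path_prob_def traj_def)

lemma take_traj: "k \<le> n \<Longrightarrow> map_pmf (take k) (traj E c \<pi> n) = traj E c \<pi> k"
  by (simp add: traj_def map_take_chain_prefix)

locale fed =
  fixes E :: fed_env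
  assumes fed_mdp: "fed_mdp E"
begin

abbreviation "S \<equiv> states E"
abbreviation "A \<equiv> actions E"
abbreviation "\<gamma> \<equiv> discount E"
abbreviation "X \<equiv> sa_pairs E"
abbreviation "P \<theta> s a \<equiv> pmf (softmax E \<theta> s) a"
abbreviation "N v \<equiv> L2_set v X"

lemma finite_S [simp, intro]: "finite S" and finite_A [simp, intro]: "finite A"
  and S_ne [simp]: "S \<noteq> {}" and A_ne [simp]: "A \<noteq> {}"
  and \<gamma>_pos: "0 < \<gamma>" and \<gamma>_less: "\<gamma> < 1" and init_S: "set_pmf (init E) \<subseteq> S"
  and agents_pos: "1 \<le> agents E"
  and kernel_S: "c < agents E \<Longrightarrow> s \<in> S \<Longrightarrow> a \<in> A \<Longrightarrow> set_pmf (kernel E c s a) \<subseteq> S"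
  and reward_nonneg: "c < agents E \<Longrightarrow> s \<in> S \<Longrightarrow> a \<in> A \<Longrightarrow> 0 \<le> reward E c s a"
  and reward_le: "c < agents E \<Longrightarrow> s \<in> S \<Longrightarrow> a \<in> A \<Longrightarrow> reward E c s a \<le> 1"
  using fed_mdp by (auto simp: fed_mdp_def)

lemma finite_X [simp, intro]: "finite X"
  by simp

lemma sum_X: "(\<Sum>x\<in>X. f x) = (\<Sum>s\<in>S. \<Sum>a\<in>A. f (s, a))"
  by (simp add: sum.cartesian_product case_prod_beta)

lemma set_softmax: "set_pmf (softmax E \<theta> s) = A"
proof -
  have "0 < (\<Sum>a'\<in>A. exp (\<theta> (s, a')))"
    by (intro sum_pos) auto
  then show ?thesis by (auto simp: set_pmf_iff pmf_softmax split: if_splits)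
qed

lemma P_pos: "a \<in> A \<Longrightarrow> 0 < P \<theta> s a"
  using set_softmax[of \<theta> s] pmf_positive by metis

lemma sum_P: "(\<Sum>a\<in>A. P \<theta> s a) = 1"
  using set_softmax[of \<theta> s] by (intro sum_pmf_eq_1) auto

lemma grad_log_eq:
  "a \<in> A \<Longrightarrow> a' \<in> A \<Longrightarrow>
    grad_log_policy E \<theta> (s, a) (s', a') = (if s' = s then of_bool (a' = a) - P \<theta> s a' else 0)"
  by (simp add: grad_log_policy_eq)

lemma score_eq:
  assumes "s \<in> S" "a \<in> A"
  shows "score E \<theta> v (s, a) = v (s, a) - (\<Sum>b\<in>A. P \<theta> s b * v (s, b))"
proof -
  have "score E \<theta> v (s, a) = (\<Sum>s'\<in>S. if s' = s then (\<Sum>b\<in>A. v (s, b) * (of_bool (b = a) - P \<theta> s b)) else 0)"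
    unfolding score_def dot_def sum_X using assms
    by (intro sum.cong) (auto simp: grad_log_eq intro!: sum.cong)
  also have "\<dots> = (\<Sum>b\<in>A. v (s, b) * of_bool (b = a)) - (\<Sum>b\<in>A. v (s, b) * P \<theta> s b)"
    using assms by (simp add: right_diff_distrib sum_subtractf)
  also have "(\<Sum>b\<in>A. v (s, b) * of_bool (b = a)) = v (s, a)"
    using assms by (simp add: of_bool_def if_distrib cong: if_cong)
  finally show ?thesis by (simp add: mult.commute)
qed

lemma sum_P_score: "s \<in> S \<Longrightarrow> (\<Sum>a\<in>A. P \<theta> s a * score E \<theta> v (s, a)) = 0"
  by (simp add: score_eq right_diff_distrib sum_subtractf sum_P flip: sum_distrib_right)

lemma abs_P_avg_le:
  assumes "\<And>a. a \<in> A \<Longrightarrow> \<bar>f a\<bar> \<le> K"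
  shows "\<bar>\<Sum>a\<in>A. P \<theta> s a * f a\<bar> \<le> K"
proof -
  have "\<bar>\<Sum>a\<in>A. P \<theta> s a * f a\<bar> \<le> (\<Sum>a\<in>A. P \<theta> s a * K)"
    using assms by (intro order_trans[OF sum_abs] sum_mono) (simp add: abs_mult mult_left_mono)
  also have "\<dots> = K" by (simp add: sum_P flip: sum_distrib_right)
  finally show ?thesis .
qed

lemma abs_score_le:
  assumes "y \<in> X"
  shows "\<bar>score E \<theta> v y\<bar> \<le> 2 * N v"
proof -
  obtain s a where y: "y = (s, a)" "s \<in> S" "a \<in> A" using assms by auto
  have "\<bar>v (s, b)\<bar> \<le> N v" if "b \<in> A" for b
    using that y by (intro abs_le_L2_set) auto
  with abs_P_avg_le[of "\<lambda>b. v (s, b)" "N v" \<theta> s] y show ?thesis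
    by (simp add: score_eq) (smt (verit))
qed

lemma abs_score2_le: "s \<in> S \<Longrightarrow> \<bar>score2 E \<theta> u v s\<bar> \<le> 4 * N u * N v"
  unfolding score2_def
proof (rule abs_P_avg_le)
  fix a assume "s \<in> S" "a \<in> A"
  then have "\<bar>score E \<theta> u (s, a)\<bar> * \<bar>score E \<theta> v (s, a)\<bar> \<le> (2 * N u) * (2 * N v)"
    by (intro mult_mono abs_score_le) (auto simp: L2_set_nonneg)
  then show "\<bar>score E \<theta> u (s, a) * score E \<theta> v (s, a)\<bar> \<le> 4 * N u * N v"
    by (simp add: abs_mult)
qed

lemma abs_score3_le: "s \<in> S \<Longrightarrow> \<bar>score3 E \<theta> u v w s\<bar> \<le> 8 * N u * N v * N w"
  unfolding score3_def
proof (rule abs_P_avg_le)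
  fix a assume "s \<in> S" "a \<in> A"
  then have "\<bar>score E \<theta> u (s, a)\<bar> * \<bar>score E \<theta> v (s, a)\<bar> * \<bar>score E \<theta> w (s, a)\<bar>
      \<le> (2 * N u) * (2 * N v) * (2 * N w)"
    by (intro mult_mono abs_score_le) (auto simp: L2_set_nonneg)
  then show "\<bar>score E \<theta> u (s, a) * score E \<theta> v (s, a) * score E \<theta> w (s, a)\<bar> \<le> 8 * N u * N v * N w"
    by (simp add: abs_mult)
qed

section \<open>Derivatives of policies, scores and path weights along a line\<close>

lemma DERIV_P:
  assumes "s \<in> S" "a \<in> A"
  shows "((\<lambda>t. P (line \<theta> u t) s a) has_real_derivative
    P (line \<theta> u t) s a * score E (line \<theta> u t) u (s, a)) (at t)"
proof -
  have pos: "0 < (\<Sum>b\<in>A. exp (\<theta> (s, b) + t * u (s, b)))" for t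
    by (intro sum_pos) auto
  let ?Z = "\<Sum>b\<in>A. exp (\<theta> (s, b) + t * u (s, b))"
  let ?e = "\<lambda>b. exp (\<theta> (s, b) + t * u (s, b))"
  have P: "P (line \<theta> u t) s b = (if b \<in> A then exp (\<theta> (s, b) + t * u (s, b)) / (\<Sum>b\<in>A. exp (\<theta> (s, b) + t * u (s, b))) else 0)"
    for t b
    by (simp add: pmf_softmax line_def)
  have "((\<lambda>t. exp (\<theta> (s, a) + t * u (s, a)) / (\<Sum>b\<in>A. exp (\<theta> (s, b) + t * u (s, b)))) has_real_derivative
     (?e a * u (s, a) * ?Z - ?e a * (\<Sum>b\<in>A. ?e b * u (s, b))) / (?Z * ?Z)) (at t)"
    using pos[of t] by (auto intro!: derivative_eq_intros simp: mult.commute)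
  moreover have "(?e a * u (s, a) * ?Z - ?e a * (\<Sum>b\<in>A. ?e b * u (s, b))) / (?Z * ?Z)
      = ?e a / ?Z * (u (s, a) - (\<Sum>b\<in>A. ?e b / ?Z * u (s, b)))"
    using pos[of t] by (simp add: field_simps flip: sum_divide_distrib)
  ultimately show ?thesis
    using assms by (simp add: score_eq P)
qed

text \<open>Only the softmax mean of \<open>v\<close> varies along the line. Its derivative is the
  mean of the score of \<open>u\<close> times \<open>v\<close>, and since scores are centred,
  \<open>v\<close> may be replaced there by its own score.\<close>

lemma DERIV_score:
  assumes "y \<in> X"
  shows "((\<lambda>t. score E (line \<theta> u t) v y) has_real_derivative
    - score2 E (line \<theta> u t) u v (fst y)) (at t)"
proof -
  obtain s a where y: "y = (s, a)" "s \<in> S" "a \<in> A" using assms by auto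
  let ?th = "line \<theta> u t"
  have "((\<lambda>t. v (s, a) - (\<Sum>b\<in>A. P (line \<theta> u t) s b * v (s, b))) has_real_derivative
      0 - (\<Sum>b\<in>A. P ?th s b * score E ?th u (s, b) * v (s, b))) (at t)"
    using y by (intro DERIV_diff DERIV_const DERIV_sum DERIV_cmult_right DERIV_P) auto
  moreover have "score2 E ?th u v s
      = (\<Sum>b\<in>A. P ?th s b * score E ?th u (s, b) * v (s, b))
        - (\<Sum>b\<in>A. P ?th s b * score E ?th u (s, b)) * (\<Sum>b\<in>A. P ?th s b * v (s, b))"
    unfolding score2_def sum_distrib_right sum_subtractf[symmetric]
    using y by (intro sum.cong) (auto simp: score_eq[of s _ _ v] algebra_simps)
  moreover have "(\<lambda>t. score E (line \<theta> u t) v y) = (\<lambda>t. v (s, a) - (\<Sum>b\<in>A. P (line \<theta> u t) s b * v (s, b)))"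
    using y by (simp add: score_eq)
  ultimately show ?thesis
    unfolding y fst_conv sum_P_score[OF y(2)] by simp
qed

text \<open>Differentiating either score inside the covariance leaves a constant times the mean of
  the other score, which is zero. Only the derivative of the weights survives.\<close>

lemma DERIV_score2:
  assumes "s \<in> S"
  shows "((\<lambda>t. score2 E (line \<theta> u t) v w s) has_real_derivative
    score3 E (line \<theta> u t) u v w s) (at t)"
proof -
  let ?th = "line \<theta> u t"
  have "((\<lambda>t. score2 E (line \<theta> u t) v w s) has_real_derivative
     (\<Sum>a\<in>A. P ?th s a * score E ?th u (s, a) * (score E ?th v (s, a) * score E ?th w (s, a))
        + (- score2 E ?th u v s * score E ?th w (s, a) + - score2 E ?th u w s * score E ?th v (s, a)) * P ?th s a))
     (at t)"
    unfolding score2_def[of E "line _ _ _" v w]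
    using assms DERIV_score[of "(s, _)"]
    by (intro DERIV_sum DERIV_mult DERIV_P) auto
  moreover have "(\<Sum>a\<in>A. P ?th s a * score E ?th u (s, a) * (score E ?th v (s, a) * score E ?th w (s, a))
        + (- score2 E ?th u v s * score E ?th w (s, a) + - score2 E ?th u w s * score E ?th v (s, a)) * P ?th s a)
      = score3 E ?th u v w s
        - score2 E ?th u v s * (\<Sum>a\<in>A. P ?th s a * score E ?th w (s, a))
        - score2 E ?th u w s * (\<Sum>a\<in>A. P ?th s a * score E ?th v (s, a))"
    unfolding score3_def sum_distrib_left sum_subtractf[symmetric]
    by (intro sum.cong) (auto simp: algebra_simps)
  ultimately show ?thesis
    using assms by (simp add: sum_P_score)
qed

lemma finite_paths [simp, intro]: "finite (paths E n)"
  using finite_lists_length_eq[of X n] by (simp add: paths_def)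

lemma DERIV_path_prob:
  assumes "set \<tau> \<subseteq> X"
  shows "((\<lambda>t. path_prob E (line \<theta> u t) \<tau>) has_real_derivative
    path_prob E (line \<theta> u t) \<tau> * path_score E (line \<theta> u t) u \<tau>) (at t)"
  using assms
proof (induction \<tau>)
  case (Cons y ys)
  have "((\<lambda>t. P (line \<theta> u t) (fst y) (snd y)) has_real_derivative
      P (line \<theta> u t) (fst y) (snd y) * score E (line \<theta> u t) u y) (at t)"
    using DERIV_P[of "fst y" "snd y"] Cons.prems by auto
  from DERIV_mult[OF this Cons.IH] Cons.prems show ?case
    by (simp add: path_prob_def path_score_def algebra_simps)
qed (simp add: path_prob_def path_score_def)

lemma DERIV_path_score:
  assumes "set \<tau> \<subseteq> X"
  shows "((\<lambda>t. path_score E (line \<theta> u t) v \<tau>) has_real_derivative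
    - path_score2 E (line \<theta> u t) u v \<tau>) (at t)"
  using assms
proof (induction \<tau>)
  case (Cons y ys)
  from DERIV_add[OF DERIV_score Cons.IH] Cons.prems show ?case
    by (simp add: path_score_def path_score2_def algebra_simps)
qed (simp add: path_score_def path_score2_def)

lemma DERIV_path_score2:
  assumes "set \<tau> \<subseteq> X"
  shows "((\<lambda>t. path_score2 E (line \<theta> u t) v w \<tau>) has_real_derivative
    path_score3 E (line \<theta> u t) u v w \<tau>) (at t)"
  using assms
proof (induction \<tau>)
  case (Cons y ys)
  from DERIV_add[OF DERIV_score2 Cons.IH] Cons.prems show ?case
    by (auto simp: path_score2_def path_score3_def algebra_simps)
qed (simp add: path_score2_def path_score3_def)

lemma abs_sum_list_le:
  fixes f :: "'b \<Rightarrow> real"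
  shows "(\<And>y. y \<in> set \<tau> \<Longrightarrow> \<bar>f y\<bar> \<le> K) \<Longrightarrow> \<bar>\<Sum>y\<leftarrow>\<tau>. f y\<bar> \<le> real (length \<tau>) * K"
proof (induction \<tau>)
  case (Cons y ys)
  then have "\<bar>f y\<bar> \<le> K" "\<bar>\<Sum>y\<leftarrow>ys. f y\<bar> \<le> real (length ys) * K" by auto
  then show ?case by (simp add: algebra_simps)
qed simp

lemma abs_sum_list_path_le:
  fixes f :: "nat \<times> nat \<Rightarrow> real"
  assumes "\<tau> \<in> paths E n" "\<And>y. y \<in> X \<Longrightarrow> \<bar>f y\<bar> \<le> K"
  shows "\<bar>\<Sum>y\<leftarrow>\<tau>. f y\<bar> \<le> real n * K"
proof -
  have \<tau>: "set \<tau> \<subseteq> X" "length \<tau> = n" using assms(1) by (auto simp: paths_def)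
  then have "\<And>y. y \<in> set \<tau> \<Longrightarrow> \<bar>f y\<bar> \<le> K" using assms(2) by blast
  from abs_sum_list_le[where f=f and \<tau>=\<tau>, OF this] show ?thesis by (simp add: \<tau>)
qed

lemma abs_path_score_le: "\<tau> \<in> paths E n \<Longrightarrow> \<bar>path_score E \<theta> v \<tau>\<bar> \<le> real n * (2 * N v)"
  unfolding path_score_def by (intro abs_sum_list_path_le abs_score_le)

lemma abs_path_score2_le: "\<tau> \<in> paths E n \<Longrightarrow> \<bar>path_score2 E \<theta> u v \<tau>\<bar> \<le> real n * (4 * N u * N v)"
  unfolding path_score2_def by (intro abs_sum_list_path_le abs_score2_le) auto

lemma abs_path_score3_le: "\<tau> \<in> paths E n \<Longrightarrow> \<bar>path_score3 E \<theta> u v w \<tau>\<bar> \<le> real n * (8 * N u * N v * N w)"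
  unfolding path_score3_def by (intro abs_sum_list_path_le abs_score3_le) auto

text \<open>The log-derivative identity: differentiating the path weight multiplies the integrand by
  the path score. The integrand may itself depend on the parameter, so the rule can be
  iterated.\<close>

lemma DERIV_path_avg:
  assumes "\<And>\<tau>. \<tau> \<in> paths E n \<Longrightarrow> ((\<lambda>t. F (line \<theta> u t) \<tau>) has_real_derivative F' \<tau>) (at t)"
  shows "((\<lambda>t. path_avg E c n (line \<theta> u t) (F (line \<theta> u t))) has_real_derivative
    path_avg E c n (line \<theta> u t) (\<lambda>\<tau>. path_score E (line \<theta> u t) u \<tau> * F (line \<theta> u t) \<tau> + F' \<tau>)) (at t)"
proof -
  let ?th = "line \<theta> u t"
  have "((\<lambda>t. base E c \<tau> * path_prob E (line \<theta> u t) \<tau> * F (line \<theta> u t) \<tau>) has_real_derivative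
      base E c \<tau> * path_prob E ?th \<tau> * (path_score E ?th u \<tau> * F ?th \<tau> + F' \<tau>)) (at t)"
    if "\<tau> \<in> paths E n" for \<tau>
    using DERIV_mult[OF DERIV_cmult[OF DERIV_path_prob, of \<tau> "base E c \<tau>" \<theta> u t] assms[OF that]] that
    by (simp add: paths_def algebra_simps)
  then show ?thesis
    unfolding path_avg_def by (intro DERIV_sum) auto
qed

lemma sa_init_X: "(\<And>s. s \<in> S \<Longrightarrow> set_pmf (\<pi> s) \<subseteq> A) \<Longrightarrow> set_pmf (sa_init E \<pi>) \<subseteq> X"
  using init_S by (auto simp: sa_init_def)

lemma sa_step_X:
  "(\<And>s. s \<in> S \<Longrightarrow> set_pmf (\<pi> s) \<subseteq> A) \<Longrightarrow> c < agents E \<Longrightarrow> y \<in> X \<Longrightarrow> set_pmf (sa_step E c \<pi> y) \<subseteq> X"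
  using kernel_S[of c "fst y" "snd y"] by (fastforce simp: sa_step_def)

lemma set_traj:
  assumes "c < agents E"
  shows "set_pmf (traj E c (softmax E \<theta>) n) \<subseteq> paths E n"
  using set_chain_prefix[of X "sa_step E c (softmax E \<theta>)" "sa_init E (softmax E \<theta>)" _ n]
    sa_init_X[of "softmax E \<theta>"] sa_step_X[of "softmax E \<theta>" c] assms
  by (auto simp: traj_def paths_def set_softmax length_chain_prefix)

lemma finite_traj: "c < agents E \<Longrightarrow> finite (set_pmf (traj E c (softmax E \<theta>) n))"
  by (rule finite_subset[OF set_traj]) auto

lemma path_avg_eq:
  assumes "c < agents E"
  shows "path_avg E c n \<theta> f = expect (traj E c (softmax E \<theta>) n) f"
proof -
  have "expect (traj E c (softmax E \<theta>) n) f
      = (\<Sum>\<tau>\<in>paths E n. f \<tau> * pmf (traj E c (softmax E \<theta>) n) \<tau>)"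
    using set_traj[OF assms] by (intro integral_measure_pmf_real) auto
  also have "\<dots> = path_avg E c n \<theta> f"
    unfolding path_avg_def
    by (intro sum.cong) (auto simp: paths_def mult.commute simp flip: pmf_traj)
  finally show ?thesis by simp
qed

lemma abs_path_avg_le:
  assumes "c < agents E" "\<And>\<tau>. \<tau> \<in> paths E n \<Longrightarrow> \<bar>f \<tau>\<bar> \<le> K"
  shows "\<bar>path_avg E c n \<theta> f\<bar> \<le> K"
proof -
  have "\<bar>expect (traj E c (softmax E \<theta>) n) f\<bar>
      \<le> expect (traj E c (softmax E \<theta>) n) (\<lambda>\<tau>. \<bar>f \<tau>\<bar>)"
    by (rule abs_expectation_le_pmf)
  also have "\<dots> \<le> expect (traj E c (softmax E \<theta>) n) (\<lambda>_. K)"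
    using assms set_traj[OF assms(1)] by (intro expectation_mono_pmf_finite finite_traj) auto
  finally show ?thesis by (simp add: path_avg_eq assms(1))
qed

section \<open>The expected reward at a fixed time and its derivatives\<close>

lemma path_reward_bounds:
  assumes "c < agents E" "\<tau> \<in> paths E n" "t < n"
  shows "0 \<le> path_reward E c t \<tau>" "path_reward E c t \<tau> \<le> 1"
proof -
  have "\<tau> ! t \<in> X" using assms nth_mem[of t \<tau>] by (auto simp: paths_def)
  then show "0 \<le> path_reward E c t \<tau>" "path_reward E c t \<tau> \<le> 1"
    using assms(1) by (auto simp: path_reward_def mem_Times_iff reward_nonneg reward_le)
qed

lemma abs_times_path_reward_le:
  assumes "c < agents E" "\<tau> \<in> paths E n" "t < n" "\<bar>z\<bar> \<le> K"
  shows "\<bar>z * path_reward E c t \<tau>\<bar> \<le> K"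
  using path_reward_bounds[OF assms(1-3)] assms(4)
    mult_mono[of "\<bar>z\<bar>" K "path_reward E c t \<tau>" 1] by (simp add: abs_mult)

text \<open>The trajectory stops at the rewarded time \<open>t\<close> and so has
  \<open>Suc t\<close> pairs. Later actions cannot influence this reward, and each derivative
  accordingly costs one factor \<open>t + 1\<close>.\<close>

definition exp_reward :: "nat \<Rightarrow> nat \<Rightarrow> param \<Rightarrow> real" where
  "exp_reward c t \<theta> = path_avg E c (Suc t) \<theta> (path_reward E c t)"

definition dexp_reward :: "nat \<Rightarrow> nat \<Rightarrow> param \<Rightarrow> param \<Rightarrow> real" where
  "dexp_reward c t \<theta> v = path_avg E c (Suc t) \<theta> (\<lambda>\<tau>. path_score E \<theta> v \<tau> * path_reward E c t \<tau>)"

definition ddexp_reward :: "nat \<Rightarrow> nat \<Rightarrow> param \<Rightarrow> param \<Rightarrow> param \<Rightarrow> real" where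
  "ddexp_reward c t \<theta> u v = path_avg E c (Suc t) \<theta>
    (\<lambda>\<tau>. (path_score E \<theta> u \<tau> * path_score E \<theta> v \<tau> - path_score2 E \<theta> u v \<tau>) * path_reward E c t \<tau>)"

lemma DERIV_exp_reward:
  "((\<lambda>\<alpha>. exp_reward c t (line \<theta> u \<alpha>)) has_real_derivative dexp_reward c t (line \<theta> u \<alpha>) u) (at \<alpha>)"
  unfolding exp_reward_def dexp_reward_def
  using DERIV_path_avg[where F="\<lambda>_. path_reward E c t" and F'="\<lambda>_. 0" and n="Suc t" and c=c] by simp

lemma DERIV_dexp_reward:
  "((\<lambda>\<alpha>. dexp_reward c t (line \<theta> u \<alpha>) v) has_real_derivative ddexp_reward c t (line \<theta> u \<alpha>) u v) (at \<alpha>)"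
proof -
  have "((\<lambda>\<alpha>. path_score E (line \<theta> u \<alpha>) v \<tau> * path_reward E c t \<tau>) has_real_derivative
      - path_score2 E (line \<theta> u \<alpha>) u v \<tau> * path_reward E c t \<tau>) (at \<alpha>)" if "\<tau> \<in> paths E (Suc t)" for \<tau>
    using that by (intro DERIV_cmult_right DERIV_path_score) (auto simp: paths_def)
  from DERIV_path_avg[where F="\<lambda>\<theta> \<tau>. path_score E \<theta> v \<tau> * path_reward E c t \<tau>" and n="Suc t" and c=c, OF this]
  show ?thesis
    unfolding dexp_reward_def ddexp_reward_def by (simp add: algebra_simps)
qed

lemma abs_dexp_reward_le:
  assumes "c < agents E"
  shows "\<bar>dexp_reward c t \<theta> v\<bar> \<le> 2 * (real t + 1) * N v"
  unfolding dexp_reward_def using assms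
  by (intro abs_path_avg_le abs_times_path_reward_le)
    (auto dest: abs_path_score_le[where \<theta>=\<theta> and v=v] simp: algebra_simps)

lemma abs_ddexp_reward_le:
  assumes "c < agents E"
  shows "\<bar>ddexp_reward c t \<theta> u v\<bar> \<le> 8 * (real t + 1) ^ 2 * N u * N v"
  unfolding ddexp_reward_def
proof (intro abs_path_avg_le abs_times_path_reward_le assms)
  fix \<tau> assume \<tau>: "\<tau> \<in> paths E (Suc t)"
  define n where "n = real t + 1"
  have n: "1 \<le> n" "real (Suc t) = n" by (auto simp: n_def)
  have "\<bar>path_score E \<theta> u \<tau>\<bar> * \<bar>path_score E \<theta> v \<tau>\<bar> \<le> (n * (2 * N u)) * (n * (2 * N v))"
    using abs_path_score_le[OF \<tau>] n by (intro mult_mono) (auto simp: L2_set_nonneg)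
  also have "\<dots> = 4 * n ^ 2 * (N u * N v)" by (simp add: power2_eq_square)
  finally have 1: "\<bar>path_score E \<theta> u \<tau> * path_score E \<theta> v \<tau>\<bar> \<le> 4 * n ^ 2 * (N u * N v)"
    by (simp add: abs_mult)
  have "\<bar>path_score2 E \<theta> u v \<tau>\<bar> \<le> n * (4 * N u * N v)"
    using abs_path_score2_le[OF \<tau>] n by simp
  also have "\<dots> \<le> n ^ 2 * (4 * N u * N v)"
    using n(1) by (intro mult_right_mono self_le_power) (auto simp: L2_set_nonneg)
  finally have "\<bar>path_score2 E \<theta> u v \<tau>\<bar> \<le> 4 * n ^ 2 * (N u * N v)" by simp
  with 1 show "\<bar>path_score E \<theta> u \<tau> * path_score E \<theta> v \<tau> - path_score2 E \<theta> u v \<tau>\<bar>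
      \<le> 8 * (real t + 1) ^ 2 * N u * N v"
    unfolding n_def[symmetric] by linarith
qed auto

text \<open>The derivative of the integrand consists of five products of scores, each at most
  \<open>8 * (t + 1) ^ 3 * (N u) ^ 2 * N v\<close>; their number gives the constant 40.\<close>

lemma DERIV_ddexp_reward_bound:
  assumes "c < agents E"
  obtains D where
    "((\<lambda>\<alpha>. ddexp_reward c t (line \<theta> u \<alpha>) u v) has_real_derivative D) (at \<alpha>)"
    "\<bar>D\<bar> \<le> 40 * (real t + 1) ^ 3 * (N u)\<^sup>2 * N v"
proof -
  let ?th = "line \<theta> u \<alpha>"
  let ?X = "path_score E ?th" and ?C = "path_score2 E ?th" and ?K = "path_score3 E ?th"
  let ?F = "\<lambda>\<theta> \<tau>. (path_score E \<theta> u \<tau> * path_score E \<theta> v \<tau> - path_score2 E \<theta> u v \<tau>) * path_reward E c t \<tau>"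
  let ?F' = "\<lambda>\<tau>. (- ?C u u \<tau> * ?X v \<tau> + - ?C u v \<tau> * ?X u \<tau> - ?K u u v \<tau>) * path_reward E c t \<tau>"
  have "((\<lambda>\<alpha>. ?F (line \<theta> u \<alpha>) \<tau>) has_real_derivative ?F' \<tau>) (at \<alpha>)" if "\<tau> \<in> paths E (Suc t)" for \<tau>
    using that by (intro DERIV_cmult_right DERIV_diff DERIV_mult DERIV_path_score DERIV_path_score2) (auto simp: paths_def)
  from DERIV_path_avg[where F="?F" and n="Suc t" and c=c, OF this]
  have "((\<lambda>\<alpha>. ddexp_reward c t (line \<theta> u \<alpha>) u v) has_real_derivative
     path_avg E c (Suc t) ?th (\<lambda>\<tau>. ?X u \<tau> * ?F ?th \<tau> + ?F' \<tau>)) (at \<alpha>)"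
    unfolding ddexp_reward_def .
  moreover have "\<bar>path_avg E c (Suc t) ?th (\<lambda>\<tau>. ?X u \<tau> * ?F ?th \<tau> + ?F' \<tau>)\<bar>
      \<le> 40 * (real t + 1) ^ 3 * (N u)\<^sup>2 * N v"
  proof (intro abs_path_avg_le assms)
    fix \<tau> assume \<tau>: "\<tau> \<in> paths E (Suc t)"
    define n where "n = real t + 1"
    define Z where "Z = (N u)\<^sup>2 * N v"
    have n: "1 \<le> n" "real (Suc t) = n" by (auto simp: n_def)
    have Z: "0 \<le> Z" by (simp add: Z_def L2_set_nonneg)
    have nn: "n ^ 2 * Z \<le> n ^ 3 * Z" "n * Z \<le> n ^ 3 * Z"
      using n(1) Z by (intro mult_right_mono power_increasing self_le_power; simp)+
    have b: "\<bar>?X u \<tau>\<bar> \<le> n * (2 * N u)" "\<bar>?X v \<tau>\<bar> \<le> n * (2 * N v)"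
      "\<bar>?C u v \<tau>\<bar> \<le> n * (4 * N u * N v)" "\<bar>?C u u \<tau>\<bar> \<le> n * (4 * N u * N u)"
      "\<bar>?K u u v \<tau>\<bar> \<le> n * (8 * N u * N u * N v)"
      using abs_path_score_le[OF \<tau>, of ?th u] abs_path_score_le[OF \<tau>, of ?th v]
        abs_path_score2_le[OF \<tau>, of ?th u v] abs_path_score2_le[OF \<tau>, of ?th u u]
        abs_path_score3_le[OF \<tau>, of ?th u u v]
      unfolding n(2) by simp_all
    have nN: "0 \<le> n" "0 \<le> N u" "0 \<le> N v" using n(1) by (auto simp: L2_set_nonneg)
    have "\<bar>?X u \<tau>\<bar> * \<bar>?X u \<tau>\<bar> * \<bar>?X v \<tau>\<bar> \<le> (n * (2 * N u)) * (n * (2 * N u)) * (n * (2 * N v))"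
      using b nN by (intro mult_mono) auto
    also have "\<dots> = 8 * (n ^ 3 * Z)" by (simp add: Z_def power2_eq_square power3_eq_cube)
    finally have 1: "\<bar>?X u \<tau> * ?X u \<tau> * ?X v \<tau>\<bar> \<le> 8 * (n ^ 3 * Z)" by (simp add: abs_mult)
    have "\<bar>?X u \<tau>\<bar> * \<bar>?C u v \<tau>\<bar> \<le> (n * (2 * N u)) * (n * (4 * N u * N v))"
      using b nN by (intro mult_mono) auto
    also have "\<dots> = 8 * (n ^ 2 * Z)" by (simp add: Z_def power2_eq_square)
    finally have 2: "\<bar>?X u \<tau> * ?C u v \<tau>\<bar> \<le> 8 * (n ^ 3 * Z)" using nn by (simp add: abs_mult)
    have "\<bar>?C u u \<tau>\<bar> * \<bar>?X v \<tau>\<bar> \<le> (n * (4 * N u * N u)) * (n * (2 * N v))"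
      using b nN by (intro mult_mono) auto
    also have "\<dots> = 8 * (n ^ 2 * Z)" by (simp add: Z_def power2_eq_square)
    finally have 3: "\<bar>?C u u \<tau> * ?X v \<tau>\<bar> \<le> 8 * (n ^ 3 * Z)" using nn by (simp add: abs_mult)
    have "n * (8 * N u * N u * N v) = 8 * (n * Z)" by (simp add: Z_def power2_eq_square)
    with b(5) nn have 4: "\<bar>?K u u v \<tau>\<bar> \<le> 8 * (n ^ 3 * Z)" by linarith
    have "?X u \<tau> * ?F ?th \<tau> + ?F' \<tau> = (?X u \<tau> * ?X u \<tau> * ?X v \<tau> - ?X u \<tau> * ?C u v \<tau>
        - ?C u u \<tau> * ?X v \<tau> - ?X u \<tau> * ?C u v \<tau> - ?K u u v \<tau>) * path_reward E c t \<tau>"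
      by (simp add: algebra_simps)
    moreover have "\<bar>\<dots>\<bar> \<le> 40 * (n ^ 3 * Z)"
      using 1 2 3 4 by (intro abs_times_path_reward_le[OF assms \<tau>]) auto
    ultimately show "\<bar>?X u \<tau> * ?F ?th \<tau> + ?F' \<tau>\<bar> \<le> 40 * (real t + 1) ^ 3 * (N u)\<^sup>2 * N v"
      by (simp add: n_def Z_def mult.assoc)
  qed
  ultimately show ?thesis by (rule that)
qed

lemma exp_reward_smooth:
  assumes "c < agents E"
  shows "\<bar>exp_reward c t (\<lambda>x. \<theta> x + u x) - exp_reward c t \<theta> - dexp_reward c t \<theta> u\<bar>
    \<le> 4 * (real t + 1) ^ 2 * (N u)\<^sup>2"
  using second_order_remainder_le[where f="\<lambda>\<alpha>. exp_reward c t (line \<theta> u \<alpha>)",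
      OF DERIV_exp_reward DERIV_dexp_reward abs_ddexp_reward_le[OF assms]]
  by (simp add: power2_eq_square[of "N u"] mult_ac)

lemma dexp_reward_Lipschitz:
  assumes "c < agents E"
  shows "\<bar>dexp_reward c t (\<lambda>x. \<theta> x + u x) v - dexp_reward c t \<theta> v\<bar> \<le> 8 * (real t + 1) ^ 2 * N u * N v"
  using first_order_remainder_le[where f="\<lambda>\<alpha>. dexp_reward c t (line \<theta> u \<alpha>) v",
      OF DERIV_dexp_reward abs_ddexp_reward_le[OF assms]] by simp

lemma dexp_reward_second_order:
  assumes "c < agents E"
  shows "\<bar>dexp_reward c t (\<lambda>x. \<theta> x + u x) v - dexp_reward c t \<theta> v - ddexp_reward c t \<theta> u v\<bar>
    \<le> 20 * (real t + 1) ^ 3 * (N u)\<^sup>2 * N v"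
proof -
  have "\<exists>D. \<forall>\<alpha>. ((\<lambda>\<alpha>. ddexp_reward c t (line \<theta> u \<alpha>) u v) has_real_derivative D \<alpha>) (at \<alpha>) \<and>
      \<bar>D \<alpha>\<bar> \<le> 40 * (real t + 1) ^ 3 * (N u)\<^sup>2 * N v"
    by (rule choice) (blast intro: DERIV_ddexp_reward_bound[OF assms])
  then obtain D where D: "\<And>\<alpha>. ((\<lambda>\<alpha>. ddexp_reward c t (line \<theta> u \<alpha>) u v) has_real_derivative D \<alpha>) (at \<alpha>)"
    "\<And>\<alpha>. \<bar>D \<alpha>\<bar> \<le> 40 * (real t + 1) ^ 3 * (N u)\<^sup>2 * N v"
    by blast
  from second_order_remainder_le[OF DERIV_dexp_reward D] show ?thesis by (simp add: mult_ac)
qed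


subsection \<open>Discounted sums\<close>

definition path_grad :: "param \<Rightarrow> (nat \<times> nat) list \<Rightarrow> param" where
  "path_grad \<theta> \<tau> x = (\<Sum>y\<leftarrow>\<tau>. grad_log_policy E \<theta> y x)"

definition grad_reward :: "nat \<Rightarrow> nat \<Rightarrow> param \<Rightarrow> param" where
  "grad_reward c t \<theta> x = path_avg E c (Suc t) \<theta> (\<lambda>\<tau>. path_grad \<theta> \<tau> x * path_reward E c t \<tau>)"

text \<open>The Hessian of the expected reward applied to \<open>v\<close>, in coordinates: the
  vector that represents the linear form
  \<open>\<lambda>u. ddexp_reward c t \<theta> u v\<close>.\<close>

definition hess_reward :: "nat \<Rightarrow> nat \<Rightarrow> param \<Rightarrow> param \<Rightarrow> param" where
  "hess_reward c t \<theta> v x = path_avg E c (Suc t) \<theta>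
    (\<lambda>\<tau>. (path_grad \<theta> \<tau> x * path_score E \<theta> v \<tau>
      - (\<Sum>y\<leftarrow>\<tau>. \<Sum>a\<in>A. P \<theta> (fst y) a * (grad_log_policy E \<theta> (fst y, a) x * score E \<theta> v (fst y, a))))
      * path_reward E c t \<tau>)"

lemma dot_path_grad: "dot X v (path_grad \<theta> \<tau>) = path_score E \<theta> v \<tau>"
proof (induction \<tau>)
  case (Cons y ys)
  have "path_grad \<theta> (y # ys) = (\<lambda>x. grad_log_policy E \<theta> y x + path_grad \<theta> ys x)"
    by (rule ext) (simp add: path_grad_def)
  with Cons show ?case by (simp add: dot_add_right path_score_def score_def)
qed (simp add: path_grad_def path_score_def dot_def)

lemma dot_path_avg:
  "dot X v (\<lambda>x. path_avg E c n \<theta> (\<lambda>\<tau>. F \<tau> x * w \<tau>)) = path_avg E c n \<theta> (\<lambda>\<tau>. dot X v (F \<tau>) * w \<tau>)"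
  unfolding dot_def path_avg_def sum_distrib_left sum_distrib_right
  by (subst sum.swap) (simp add: mult_ac)

lemma dot_grad_reward: "dot X v (grad_reward c t \<theta>) = dexp_reward c t \<theta> v"
  unfolding grad_reward_def dexp_reward_def dot_path_avg dot_path_grad ..

lemma dot_hess_reward: "dot X u (hess_reward c t \<theta> v) = ddexp_reward c t \<theta> u v"
proof -
  have 1: "dot X u (\<lambda>x. \<Sum>y\<leftarrow>\<tau>. \<Sum>a\<in>A. P \<theta> (fst y) a * (grad_log_policy E \<theta> (fst y, a) x * score E \<theta> v (fst y, a)))
      = path_score2 E \<theta> u v \<tau>" for \<tau>
  proof (induction \<tau>)
    case (Cons y ys)
    have "dot X u (\<lambda>x. \<Sum>a\<in>A. P \<theta> (fst y) a * (grad_log_policy E \<theta> (fst y, a) x * score E \<theta> v (fst y, a)))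
        = score2 E \<theta> u v (fst y)"
      unfolding score2_def score_def[of E \<theta> u] dot_def sum_distrib_left sum_distrib_right
      by (subst sum.swap) (simp add: mult_ac)
    with Cons show ?case by (simp add: dot_add_right path_score2_def)
  qed (simp add: path_score2_def dot_def)
  have "dot X u (\<lambda>x. path_grad \<theta> \<tau> x * path_score E \<theta> v \<tau>
      - (\<Sum>y\<leftarrow>\<tau>. \<Sum>a\<in>A. P \<theta> (fst y) a * (grad_log_policy E \<theta> (fst y, a) x * score E \<theta> v (fst y, a))))
      = path_score E \<theta> u \<tau> * path_score E \<theta> v \<tau> - path_score2 E \<theta> u v \<tau>" for \<tau>
    unfolding dot_diff_right 1
    using dot_scale_right[of X u "path_score E \<theta> v \<tau>" "path_grad \<theta> \<tau>"] by (simp add: dot_path_grad mult.commute)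
  then show ?thesis
    unfolding hess_reward_def ddexp_reward_def dot_path_avg by simp
qed

lemma abs_grad_reward_le:
  assumes "c < agents E" "x \<in> X"
  shows "\<bar>grad_reward c t \<theta> x\<bar> \<le> 2 * (real t + 1)"
proof -
  have "dot X (\<lambda>y. of_bool (y = x)) (grad_reward c t \<theta>) = grad_reward c t \<theta> x"
    using dot_indicator[OF finite_X assms(2), of "grad_reward c t \<theta>"] by (simp add: dot_def mult.commute)
  with abs_dexp_reward_le[OF assms(1), of t \<theta> "\<lambda>y. of_bool (y = x)"] show ?thesis
    unfolding dot_grad_reward L2_set_indicator[OF finite_X assms(2)] by simp
qed

lemma abs_hess_reward_le:
  assumes "c < agents E" "x \<in> X"
  shows "\<bar>hess_reward c t \<theta> v x\<bar> \<le> 8 * (real t + 1) ^ 2 * N v"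
proof -
  have "dot X (\<lambda>y. of_bool (y = x)) (hess_reward c t \<theta> v) = hess_reward c t \<theta> v x"
    using dot_indicator[OF finite_X assms(2), of "hess_reward c t \<theta> v"] by (simp add: dot_def mult.commute)
  with abs_ddexp_reward_le[OF assms(1), of t \<theta> "\<lambda>y. of_bool (y = x)" v] show ?thesis
    unfolding dot_hess_reward L2_set_indicator[OF finite_X assms(2)] by simp
qed

lemma abs_exp_reward_le:
  assumes "c < agents E"
  shows "\<bar>exp_reward c t \<theta>\<bar> \<le> 1"
  unfolding exp_reward_def using assms
  by (intro abs_path_avg_le) (auto simp: abs_le_iff dest: path_reward_bounds[of c _ "Suc t" t])

text \<open>
  The weights \<open>w t = \<gamma> ^ t\<close> give the return, and cutting them off at \<open>T\<close> gives the truncated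
  return whose gradient the estimator of the algorithm targets.
\<close>

definition wsum :: "(nat \<Rightarrow> real) \<Rightarrow> (nat \<Rightarrow> real) \<Rightarrow> real" where
  "wsum w f = (\<Sum>t. w t * f t)"

definition wgrad :: "nat \<Rightarrow> (nat \<Rightarrow> real) \<Rightarrow> param \<Rightarrow> param" where
  "wgrad c w \<theta> x = wsum w (\<lambda>t. grad_reward c t \<theta> x)"

definition weights :: "(nat \<Rightarrow> real) \<Rightarrow> bool" where
  "weights w \<longleftrightarrow> (\<forall>t. 0 \<le> w t \<and> w t \<le> \<gamma> ^ t)"

lemma wsum_bound:
  assumes w: "weights w" and f: "\<And>t. \<bar>f t\<bar> \<le> K * (real t + 1) ^ k"
    and s: "summable (\<lambda>t. \<gamma> ^ t * (real t + 1) ^ k)" "(\<Sum>t. \<gamma> ^ t * (real t + 1) ^ k) \<le> z" and K: "0 \<le> K"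
  shows "summable (\<lambda>t. w t * f t)" "\<bar>wsum w f\<bar> \<le> K * z"
proof -
  have b: "\<bar>w t * f t\<bar> \<le> K * (\<gamma> ^ t * (real t + 1) ^ k)" for t
  proof -
    have "\<bar>w t * f t\<bar> \<le> \<gamma> ^ t * (K * (real t + 1) ^ k)"
      unfolding abs_mult using w f[of t] \<gamma>_pos by (intro mult_mono) (auto simp: weights_def)
    then show ?thesis by (simp add: mult_ac)
  qed
  note abs_suminf_le[OF b summable_mult[OF s(1)]]
  then show "summable (\<lambda>t. w t * f t)" "\<bar>wsum w f\<bar> \<le> K * z"
    using mult_left_mono[OF s(2) K] by (auto simp: wsum_def suminf_mult[OF s(1)])
qed

lemmas wsum_bound1 = wsum_bound[where k=1, simplified, OF _ _
    summable_power_weights(1)[OF \<gamma>_pos \<gamma>_less] eq_refl[OF suminf_power_weight1[OF \<gamma>_pos \<gamma>_less]]]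
lemmas wsum_bound2 = wsum_bound[where k=2, OF _ _
    summable_power_weights(2)[OF \<gamma>_pos \<gamma>_less] suminf_power_weight2[OF \<gamma>_pos \<gamma>_less]]
lemmas wsum_bound3 = wsum_bound[where k=3, OF _ _
    summable_power_weights(3)[OF \<gamma>_pos \<gamma>_less] suminf_power_weight3[OF \<gamma>_pos \<gamma>_less]]

lemma summable_exp_reward:
  assumes "c < agents E" "weights w"
  shows "summable (\<lambda>t. w t * exp_reward c t \<theta>)"
  by (rule wsum_bound1[OF assms(2), of _ 1])
    (auto intro!: order_trans[OF abs_exp_reward_le[OF assms(1)]])

lemma summable_dexp_reward:
  assumes "c < agents E" "weights w"
  shows "summable (\<lambda>t. w t * dexp_reward c t \<theta> v)"
  by (rule wsum_bound1[OF assms(2), of _ "2 * N v"])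
    (auto intro!: order_trans[OF abs_dexp_reward_le[OF assms(1)]] simp: L2_set_nonneg algebra_simps)

lemma summable_ddexp_reward:
  assumes "c < agents E" "weights w"
  shows "summable (\<lambda>t. w t * ddexp_reward c t \<theta> u v)"
  by (rule wsum_bound2[OF assms(2), of _ "8 * N u * N v"])
    (use abs_ddexp_reward_le[OF assms(1), of _ \<theta> u v] in \<open>auto simp: L2_set_nonneg mult_ac\<close>)

lemma summable_grad_reward:
  assumes "c < agents E" "weights w" "x \<in> X"
  shows "summable (\<lambda>t. w t * grad_reward c t \<theta> x)"
  by (rule wsum_bound1[OF assms(2), of _ 2])
    (use abs_grad_reward_le[OF assms(1,3), of _ \<theta>] in auto)

lemma summable_hess_reward:
  assumes "c < agents E" "weights w" "x \<in> X"
  shows "summable (\<lambda>t. w t * hess_reward c t \<theta> v x)"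
  by (rule wsum_bound2[OF assms(2), of _ "8 * N v"])
    (use abs_hess_reward_le[OF assms(1,3), of _ \<theta> v] in \<open>auto simp: L2_set_nonneg mult_ac\<close>)

lemma dot_wsum:
  assumes "\<And>x. x \<in> X \<Longrightarrow> summable (\<lambda>t. w t * f t x)"
  shows "dot X v (\<lambda>x. wsum w (\<lambda>t. f t x)) = wsum w (\<lambda>t. dot X v (f t))"
proof -
  have "dot X v (\<lambda>x. wsum w (\<lambda>t. f t x)) = (\<Sum>x\<in>X. \<Sum>t. v x * (w t * f t x))"
    unfolding dot_def wsum_def using assms by (intro sum.cong suminf_mult[symmetric]) auto
  also have "\<dots> = (\<Sum>t. \<Sum>x\<in>X. v x * (w t * f t x))"
    using assms by (intro suminf_sum[symmetric] summable_mult)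
  also have "\<dots> = wsum w (\<lambda>t. dot X v (f t))"
    by (simp add: wsum_def dot_def sum_distrib_left mult_ac)
  finally show ?thesis .
qed

lemma dot_wgrad:
  assumes "c < agents E" "weights w"
  shows "dot X v (wgrad c w \<theta>) = wsum w (\<lambda>t. dexp_reward c t \<theta> v)"
  unfolding wgrad_def[abs_def] using summable_grad_reward[OF assms]
  by (subst dot_wsum) (auto simp: dot_grad_reward)

lemma wsum_diff:
  assumes "summable (\<lambda>t. w t * f t)" "summable (\<lambda>t. w t * g t)"
  shows "wsum w (\<lambda>t. f t - g t) = wsum w f - wsum w g"
  using suminf_diff[OF assms] by (simp add: wsum_def right_diff_distrib)

lemma wsum_exp_reward_smooth:
  assumes "c < agents E" "weights w"
  shows "\<bar>wsum w (\<lambda>t. exp_reward c t \<theta>') - wsum w (\<lambda>t. exp_reward c t \<theta>) - dot X (wgrad c w \<theta>) (\<lambda>x. \<theta>' x - \<theta> x)\<bar>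
    \<le> 8 / (1 - \<gamma>) ^ 3 * (N (\<lambda>x. \<theta>' x - \<theta> x))\<^sup>2"
proof -
  let ?u = "\<lambda>x. \<theta>' x - \<theta> x"
  have "\<bar>wsum w (\<lambda>t. exp_reward c t \<theta>' - exp_reward c t \<theta> - dexp_reward c t \<theta> ?u)\<bar>
      \<le> (4 * (N ?u)\<^sup>2) * (2 / (1 - \<gamma>) ^ 3)"
    by (rule wsum_bound2(2)[OF assms(2)])
      (use exp_reward_smooth[OF assms(1), of _ \<theta> ?u] in \<open>auto simp: mult_ac\<close>)
  moreover have "wsum w (\<lambda>t. exp_reward c t \<theta>' - exp_reward c t \<theta> - dexp_reward c t \<theta> ?u)
      = wsum w (\<lambda>t. exp_reward c t \<theta>') - wsum w (\<lambda>t. exp_reward c t \<theta>) - dot X (wgrad c w \<theta>) ?u"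
    unfolding dot_commute[of X "wgrad c w \<theta>"] dot_wgrad[OF assms]
    using summable_exp_reward[OF assms] summable_dexp_reward[OF assms]
    by (subst wsum_diff) (auto simp: wsum_diff right_diff_distrib intro!: summable_diff)
  ultimately show ?thesis by simp
qed

lemma wgrad_Lipschitz:
  assumes "c < agents E" "weights w"
  shows "N (\<lambda>x. wgrad c w \<theta>' x - wgrad c w \<theta> x) \<le> 16 / (1 - \<gamma>) ^ 3 * N (\<lambda>x. \<theta>' x - \<theta> x)"
proof (rule L2_set_le_if_dot_le)
  fix v
  let ?u = "\<lambda>x. \<theta>' x - \<theta> x"
  have "\<bar>wsum w (\<lambda>t. dexp_reward c t \<theta>' v - dexp_reward c t \<theta> v)\<bar> \<le> (8 * N ?u * N v) * (2 / (1 - \<gamma>) ^ 3)"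
    by (rule wsum_bound2(2)[OF assms(2)])
      (use dexp_reward_Lipschitz[OF assms(1), of _ \<theta> ?u v] in \<open>auto simp: mult_ac L2_set_nonneg\<close>)
  moreover have "wsum w (\<lambda>t. dexp_reward c t \<theta>' v - dexp_reward c t \<theta> v)
      = dot X (\<lambda>x. wgrad c w \<theta>' x - wgrad c w \<theta> x) v"
    unfolding dot_commute[of X _ v] dot_diff_right dot_wgrad[OF assms]
    using summable_dexp_reward[OF assms] by (subst wsum_diff) auto
  ultimately show "dot X (\<lambda>x. wgrad c w \<theta>' x - wgrad c w \<theta> x) v \<le> 16 / (1 - \<gamma>) ^ 3 * N ?u * N v"
    by simp
qed (use \<gamma>_less in \<open>simp add: L2_set_nonneg\<close>)

text \<open>The witness \<open>h\<close> is the weighted Hessian at \<open>\<theta>\<close> applied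
  to \<open>v\<close>. It is fixed before \<open>\<theta>'\<close>, so that the linear term can be
  averaged over a random \<open>\<theta>'\<close>. The constant is \<open>20 * 6\<close>: the
  second-order remainder at each time and the weighted sum of cubes.\<close>

lemma wgrad_second_order:
  assumes "c < agents E" "weights w"
  shows "\<exists>h. \<forall>\<theta>'. \<bar>dot X (\<lambda>x. wgrad c w \<theta>' x - wgrad c w \<theta> x) v - dot X h (\<lambda>x. \<theta>' x - \<theta> x)\<bar>
    \<le> 120 / (1 - \<gamma>) ^ 4 * (N (\<lambda>x. \<theta>' x - \<theta> x))\<^sup>2 * N v"
proof (intro exI allI)
  fix \<theta>'
  let ?u = "\<lambda>x. \<theta>' x - \<theta> x"
  have dh: "dot X ?u (\<lambda>x. wsum w (\<lambda>t. hess_reward c t \<theta> v x)) = wsum w (\<lambda>t. ddexp_reward c t \<theta> ?u v)"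
    unfolding dot_hess_reward[symmetric] by (rule dot_wsum) (rule summable_hess_reward[OF assms])
  have "\<bar>wsum w (\<lambda>t. dexp_reward c t \<theta>' v - dexp_reward c t \<theta> v - ddexp_reward c t \<theta> ?u v)\<bar>
      \<le> (20 * (N ?u)\<^sup>2 * N v) * (6 / (1 - \<gamma>) ^ 4)"
    by (rule wsum_bound3(2)[OF assms(2)])
      (use dexp_reward_second_order[OF assms(1), of _ \<theta> ?u v] in \<open>auto simp: mult_ac L2_set_nonneg\<close>)
  moreover have "wsum w (\<lambda>t. dexp_reward c t \<theta>' v - dexp_reward c t \<theta> v - ddexp_reward c t \<theta> ?u v)
      = dot X (\<lambda>x. wgrad c w \<theta>' x - wgrad c w \<theta> x) v - dot X (\<lambda>x. wsum w (\<lambda>t. hess_reward c t \<theta> v x)) ?u"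
    unfolding dot_commute[of X _ v] dot_commute[of X _ ?u] dot_diff_right[of X v] dot_wgrad[OF assms]
      dh
    using summable_dexp_reward[OF assms] summable_ddexp_reward[OF assms]
    by (subst wsum_diff) (auto simp: wsum_diff right_diff_distrib intro!: summable_diff)
  ultimately show "\<bar>dot X (\<lambda>x. wgrad c w \<theta>' x - wgrad c w \<theta> x) v
      - dot X (\<lambda>x. wsum w (\<lambda>t. hess_reward c t \<theta> v x)) ?u\<bar>
      \<le> 120 / (1 - \<gamma>) ^ 4 * (N ?u)\<^sup>2 * N v"
    by (simp add: mult_ac)
qed

text \<open>Expansion at the mean of \<open>p\<close>: the Hessian term is linear in a centred
  deviation and integrates to zero, which leaves the quadratic remainder.\<close>

lemma wgrad_pmean_bound:
  assumes "c < agents E" "weights w" "finite (set_pmf p)"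
  shows "N (\<lambda>x. pmean p (\<lambda>\<theta>. wgrad c w \<theta>) x - wgrad c w (pmean p (\<lambda>z. z)) x)
    \<le> 120 / (1 - \<gamma>) ^ 4 * pvar X p (\<lambda>z. z)"
proof (rule L2_set_le_if_dot_le)
  fix v
  note [simp] = integrable_measure_pmf_finite[OF assms(3)]
  let ?m = "pmean p (\<lambda>z. z)"
  let ?K = "120 / (1 - \<gamma>) ^ 4"
  obtain h where h: "\<And>\<theta>'. \<bar>dot X (\<lambda>x. wgrad c w \<theta>' x - wgrad c w ?m x) v - dot X h (\<lambda>x. \<theta>' x - ?m x)\<bar>
      \<le> ?K * (N (\<lambda>x. \<theta>' x - ?m x))\<^sup>2 * N v"
    using wgrad_second_order[OF assms(1,2)] by blast
  have "dot X (\<lambda>x. pmean p (\<lambda>\<theta>. wgrad c w \<theta>) x - wgrad c w ?m x) v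
      = expect p (\<lambda>\<theta>. dot X (\<lambda>x. wgrad c w \<theta> x - wgrad c w ?m x) v)"
    unfolding dot_diff_left dot_pmean[OF assms(3)] by simp
  also have "\<dots> \<le> expect p (\<lambda>\<theta>. dot X h (\<lambda>x. \<theta> x - ?m x) + ?K * (N (\<lambda>x. \<theta> x - ?m x))\<^sup>2 * N v)"
    using h by (intro expectation_mono_pmf_finite assms(3)) (smt (verit))
  also have "\<dots> = expect p (\<lambda>\<theta>. dot X h (\<lambda>x. \<theta> x - ?m x))
      + ?K * pvar X p (\<lambda>z. z) * N v"
    by (simp add: pvar_def)
  also have "expect p (\<lambda>\<theta>. dot X h (\<lambda>x. \<theta> x - ?m x)) = 0"
    unfolding dot_diff_right dot_commute[of X h] using dot_pmean[OF assms(3), of X "\<lambda>\<theta>. \<theta>" h] by simp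
  finally show "dot X (\<lambda>x. pmean p (\<lambda>\<theta>. wgrad c w \<theta>) x - wgrad c w ?m x) v \<le> ?K * pvar X p (\<lambda>z. z) * N v"
    by simp
qed (simp add: pvar_nonneg)


subsection \<open>Truncation and heterogeneity\<close>

definition full_weight :: "nat \<Rightarrow> real" where
  "full_weight t = \<gamma> ^ t"

definition trunc_weight :: "nat \<Rightarrow> nat \<Rightarrow> real" where
  "trunc_weight T t = (if t < T then \<gamma> ^ t else 0)"

lemma weights_full: "weights full_weight" and weights_trunc: "weights (trunc_weight T)"
  using \<gamma>_pos by (auto simp: weights_def full_weight_def trunc_weight_def)

lemma wgrad_trunc_bound:
  assumes "c < agents E" and T: "1 / (1 - \<gamma>) \<le> real T"
  shows "N (\<lambda>x. wgrad c full_weight \<theta> x - wgrad c (trunc_weight T) \<theta> x) \<le> 4 * (\<gamma> ^ T * real T / (1 - \<gamma>))"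
proof (rule L2_set_le_if_dot_le)
  fix v
  let ?f = "\<lambda>t. dexp_reward c t \<theta> v"
  let ?y = "1 - \<gamma>"
  have y: "0 < ?y" using \<gamma>_less by simp
  have geo: "(\<lambda>t. \<gamma> ^ t) sums (1 / ?y)" using \<gamma>_pos \<gamma>_less by (intro geometric_sums) auto
  have "dot X (\<lambda>x. wgrad c full_weight \<theta> x - wgrad c (trunc_weight T) \<theta> x) v
      = wsum full_weight ?f - wsum (trunc_weight T) ?f"
    unfolding dot_commute[of X _ v] dot_diff_right using assms(1) by (simp add: dot_wgrad weights_full weights_trunc)
  also have "wsum (trunc_weight T) ?f = (\<Sum>t<T. \<gamma> ^ t * ?f t)"
    unfolding wsum_def by (subst suminf_finite[of "{..<T}"]) (auto simp: trunc_weight_def)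
  also have "wsum full_weight ?f = (\<Sum>t. \<gamma> ^ (t + T) * ?f (t + T)) + (\<Sum>t<T. \<gamma> ^ t * ?f t)"
    unfolding wsum_def using summable_dexp_reward[OF assms(1) weights_full, of \<theta> v]
    by (subst suminf_split_initial_segment[of _ T]) (auto simp: full_weight_def)
  also have "(\<Sum>t. \<gamma> ^ (t + T) * ?f (t + T)) + (\<Sum>t<T. \<gamma> ^ t * ?f t) - (\<Sum>t<T. \<gamma> ^ t * ?f t)
      \<le> \<bar>\<Sum>t. \<gamma> ^ (t + T) * ?f (t + T)\<bar>" by simp
  also have "\<dots> \<le> (\<Sum>t. 2 * N v * \<gamma> ^ T * (real T * \<gamma> ^ t + \<gamma> ^ t * (real t + 1)))"
  proof (rule abs_suminf_le(2))
    fix t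
    have "\<bar>\<gamma> ^ (t + T) * ?f (t + T)\<bar> \<le> \<gamma> ^ (t + T) * (2 * (real (t + T) + 1) * N v)"
      unfolding abs_mult using abs_dexp_reward_le[OF assms(1), of "t + T" \<theta> v] \<gamma>_pos
      by (intro mult_mono) auto
    then show "\<bar>\<gamma> ^ (t + T) * ?f (t + T)\<bar> \<le> 2 * N v * \<gamma> ^ T * (real T * \<gamma> ^ t + \<gamma> ^ t * (real t + 1))"
      by (simp add: power_add algebra_simps)
  next
    show "summable (\<lambda>t. 2 * N v * \<gamma> ^ T * (real T * \<gamma> ^ t + \<gamma> ^ t * (real t + 1)))"
      using summable_power_weights(1)[OF \<gamma>_pos \<gamma>_less] geo
      by (intro summable_mult summable_add) (auto simp: sums_iff)
  qed
  also have "\<dots> = 2 * N v * \<gamma> ^ T * (real T * (1 / ?y) + 1 / ?y\<^sup>2)"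
    using sums_mult[OF sums_add[OF sums_mult[OF geo, of "real T"]
          summable_sums[OF summable_power_weights(1)[OF \<gamma>_pos \<gamma>_less]]], of "2 * N v * \<gamma> ^ T"]
    unfolding suminf_power_weight1[OF \<gamma>_pos \<gamma>_less] by (simp add: sums_iff)
  \<comment> \<open>The shifted tail splits into \<open>T / (1 - \<gamma>)\<close> and
    \<open>1 / (1 - \<gamma>) ^ 2\<close>; the assumption \<open>T \<ge> 1 / (1 - \<gamma>)\<close>
    absorbs the second part into the first.\<close>
  also have "\<dots> \<le> 2 * N v * \<gamma> ^ T * (real T * (1 / ?y) + real T * (1 / ?y))"
  proof -
    have "1 / ?y\<^sup>2 = (1 / ?y) * (1 / ?y)" by (simp add: power2_eq_square)
    also have "\<dots> \<le> real T * (1 / ?y)" using T y by (intro mult_right_mono) auto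
    finally show ?thesis using \<gamma>_pos by (intro mult_left_mono) (auto simp: L2_set_nonneg)
  qed
  finally show "dot X (\<lambda>x. wgrad c full_weight \<theta> x - wgrad c (trunc_weight T) \<theta> x) v
      \<le> 4 * (\<gamma> ^ T * real T / ?y) * N v"
    by (simp add: mult_ac)
qed (use \<gamma>_pos \<gamma>_less in simp)

section \<open>Comparison of the gradients of two agents\<close>

lemma Max_set_ge:
  assumes "finite {g s a c c' | s a c c'. s \<in> S \<and> a \<in> A \<and> c < agents E \<and> c' < agents E}"
    "s \<in> S" "a \<in> A" "c < agents E" "c' < agents E"
  shows "(g s a c c' :: real) \<le> Max {g s a c c' | s a c c'. s \<in> S \<and> a \<in> A \<and> c < agents E \<and> c' < agents E}"
  using assms by (intro Max_ge) blast+

lemma finite_comparison: "finite {g s a c c' | s a c c'. s \<in> S \<and> a \<in> A \<and> c < agents E \<and> c' < agents E}"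
proof -
  have "{g s a c c' | s a c c'. s \<in> S \<and> a \<in> A \<and> c < agents E \<and> c' < agents E}
      = (\<Union>s\<in>S. \<Union>a\<in>A. \<Union>c\<in>{..<agents E}. \<Union>c'\<in>{..<agents E}. {g s a c c'})"
    by auto
  then show ?thesis by simp
qed

lemma eps_P_ge:
  assumes "s \<in> S" "a \<in> A" "c < agents E" "c' < agents E"
  shows "(\<Sum>s'\<in>S. \<bar>pmf (kernel E c s a) s' - pmf (kernel E c' s a) s'\<bar>) \<le> eps_P E"
  unfolding eps_P_def by (rule Max_set_ge[OF finite_comparison assms])

lemma eps_r_ge:
  assumes "s \<in> S" "a \<in> A" "c < agents E" "c' < agents E"
  shows "\<bar>reward E c s a - reward E c' s a\<bar> \<le> eps_r E"
  unfolding eps_r_def by (rule Max_set_ge[OF finite_comparison assms])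

lemma eps_nonneg: "0 \<le> eps_P E" "0 \<le> eps_r E"
proof -
  obtain s a where sa: "s \<in> S" "a \<in> A" using S_ne A_ne by blast
  with agents_pos show "0 \<le> eps_P E" "0 \<le> eps_r E"
    using eps_P_ge[of s a 0 0] eps_r_ge[of s a 0 0] by auto
qed

lemma sum_paths_Suc: "(\<Sum>\<tau>\<in>paths E (Suc n). f \<tau>) = (\<Sum>y\<in>X. \<Sum>\<tau>\<in>paths E n. f (y # \<tau>))"
proof -
  have 1: "paths E (Suc n) = (\<lambda>(y, \<tau>). y # \<tau>) ` (X \<times> paths E n)"
    by (auto simp: paths_def length_Suc_conv image_iff)
  have 2: "inj_on (\<lambda>(y, \<tau>). y # \<tau>) (X \<times> paths E n)"
    by (auto simp: inj_on_def)
  show ?thesis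
    unfolding 1 sum.reindex[OF 2] sum.cartesian_product by (simp add: o_def case_prod_beta)
qed

lemma base_run_nonneg: "0 \<le> base_run E c y \<tau>"
  by (induction \<tau> arbitrary: y) auto

lemma path_prob_nonneg: "0 \<le> path_prob E \<theta> \<tau>"
  unfolding path_prob_def by (intro prod_list_nonneg) auto

lemma path_prob_Cons: "path_prob E \<theta> (y # \<tau>) = P \<theta> (fst y) (snd y) * path_prob E \<theta> \<tau>"
  by (simp add: path_prob_def)

lemma sum_kernel: "c < agents E \<Longrightarrow> y \<in> X \<Longrightarrow> (\<Sum>s\<in>S. pmf (kernel E c (fst y) (snd y)) s) = 1"
  using kernel_S[of c "fst y" "snd y"] by (intro sum_pmf_eq_1) auto

lemma sum_base_run:
  assumes "c < agents E" "y \<in> X"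
  shows "(\<Sum>\<tau>\<in>paths E n. base_run E c y \<tau> * path_prob E \<theta> \<tau>) = 1"
  using assms(2)
proof (induction n arbitrary: y)
  case 0
  have "paths E 0 = {[]}" by (auto simp: paths_def)
  then show ?case by (simp add: path_prob_def)
next
  case (Suc n)
  have "(\<Sum>\<tau>\<in>paths E (Suc n). base_run E c y \<tau> * path_prob E \<theta> \<tau>)
      = (\<Sum>z\<in>X. pmf (kernel E c (fst y) (snd y)) (fst z) * P \<theta> (fst z) (snd z)
          * (\<Sum>\<tau>\<in>paths E n. base_run E c z \<tau> * path_prob E \<theta> \<tau>))"
    unfolding sum_paths_Suc sum_distrib_left by (intro sum.cong) (auto simp: path_prob_Cons mult_ac)
  also have "\<dots> = (\<Sum>z\<in>X. pmf (kernel E c (fst y) (snd y)) (fst z) * P \<theta> (fst z) (snd z))"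
    by (intro sum.cong refl) (simp add: Suc.IH)
  also have "\<dots> = 1"
    unfolding sum_X using sum_kernel[OF assms(1) Suc.prems] by (simp add: sum_P flip: sum_distrib_left)
  finally show ?case .
qed

text \<open>A hybrid argument: the two kernels are exchanged one transition at a time. Each exchange
  costs at most \<open>eps_P E\<close>, because the rest of the path has total weight 1 under either
  agent.\<close>

lemma sum_abs_base_run_diff:
  assumes c: "c < agents E" "c' < agents E" "y \<in> X"
  shows "(\<Sum>\<tau>\<in>paths E n. \<bar>base_run E c y \<tau> - base_run E c' y \<tau>\<bar> * path_prob E \<theta> \<tau>) \<le> real n * eps_P E"
  using assms(3)
proof (induction n arbitrary: y)
  case 0
  have "paths E 0 = {[]}" by (auto simp: paths_def)
  then show ?case by simp
next
  case (Suc n)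
  let ?pp = "path_prob E \<theta>" and ?b = "base_run E c" and ?b' = "base_run E c'"
    and ?pi = "\<lambda>z. P \<theta> (fst z) (snd z)"
  let ?k = "pmf (kernel E c (fst y) (snd y))" and ?k' = "pmf (kernel E c' (fst y) (snd y))"
  have "(\<Sum>\<tau>\<in>paths E (Suc n). \<bar>?b y \<tau> - ?b' y \<tau>\<bar> * ?pp \<tau>)
      \<le> (\<Sum>z\<in>X. \<Sum>\<tau>\<in>paths E n. \<bar>?k (fst z) - ?k' (fst z)\<bar> * ?pi z * (?b z \<tau> * ?pp \<tau>)
          + ?k' (fst z) * ?pi z * (\<bar>?b z \<tau> - ?b' z \<tau>\<bar> * ?pp \<tau>))"
    unfolding sum_paths_Suc
  proof (intro sum_mono)
    fix z \<tau>
    have "\<bar>?k (fst z) * ?b z \<tau> - ?k' (fst z) * ?b' z \<tau>\<bar>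
        = \<bar>(?k (fst z) - ?k' (fst z)) * ?b z \<tau> + ?k' (fst z) * (?b z \<tau> - ?b' z \<tau>)\<bar>"
      by (simp add: algebra_simps)
    also have "\<dots> \<le> \<bar>?k (fst z) - ?k' (fst z)\<bar> * ?b z \<tau> + ?k' (fst z) * \<bar>?b z \<tau> - ?b' z \<tau>\<bar>"
      by (rule order_trans[OF abs_triangle_ineq]) (simp add: abs_mult base_run_nonneg)
    finally have "\<bar>?b y (z # \<tau>) - ?b' y (z # \<tau>)\<bar> * ?pp (z # \<tau>)
      \<le> (\<bar>?k (fst z) - ?k' (fst z)\<bar> * ?b z \<tau> + ?k' (fst z) * \<bar>?b z \<tau> - ?b' z \<tau>\<bar>)
        * ?pp (z # \<tau>)"
      by (intro mult_right_mono path_prob_nonneg) simp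
    then show "\<bar>?b y (z # \<tau>) - ?b' y (z # \<tau>)\<bar> * ?pp (z # \<tau>)
      \<le> \<bar>?k (fst z) - ?k' (fst z)\<bar> * ?pi z * (?b z \<tau> * ?pp \<tau>)
          + ?k' (fst z) * ?pi z * (\<bar>?b z \<tau> - ?b' z \<tau>\<bar> * ?pp \<tau>)"
      by (simp add: path_prob_Cons algebra_simps)
  qed
  also have "\<dots> = (\<Sum>z\<in>X. \<bar>?k (fst z) - ?k' (fst z)\<bar> * ?pi z * (\<Sum>\<tau>\<in>paths E n. ?b z \<tau> * ?pp \<tau>))
      + (\<Sum>z\<in>X. ?k' (fst z) * ?pi z * (\<Sum>\<tau>\<in>paths E n. \<bar>?b z \<tau> - ?b' z \<tau>\<bar> * ?pp \<tau>))"
    by (simp add: sum.distrib sum_distrib_left)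
  also have "\<dots> \<le> (\<Sum>z\<in>X. \<bar>?k (fst z) - ?k' (fst z)\<bar> * ?pi z)
      + (\<Sum>z\<in>X. ?k' (fst z) * ?pi z * (real n * eps_P E))"
    by (intro add_mono sum_mono mult_left_mono Suc.IH) (auto simp: sum_base_run[OF c(1)])
  also have "(\<Sum>z\<in>X. \<bar>?k (fst z) - ?k' (fst z)\<bar> * ?pi z) = (\<Sum>s\<in>S. \<bar>?k s - ?k' s\<bar>)"
    unfolding sum_X by (simp add: sum_P flip: sum_distrib_left)
  also have "(\<Sum>s\<in>S. \<bar>?k s - ?k' s\<bar>) \<le> eps_P E"
    using Suc.prems c by (intro eps_P_ge) auto
  also have "(\<Sum>z\<in>X. ?k' (fst z) * ?pi z * (real n * eps_P E)) = real n * eps_P E"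
    unfolding sum_X using sum_kernel[OF c(2) Suc.prems]
    by (simp add: sum_P flip: sum_distrib_left sum_distrib_right)
  finally show ?case by (simp add: algebra_simps)
qed

lemma sum_init: "(\<Sum>s\<in>S. pmf (init E) s) = 1"
  using init_S by (intro sum_pmf_eq_1) auto

text \<open>A path of \<open>Suc n\<close> pairs has only \<open>n\<close> transitions, and the
  initial law is common to all agents.\<close>

lemma sum_abs_base_diff:
  assumes c: "c < agents E" "c' < agents E"
  shows "(\<Sum>\<tau>\<in>paths E (Suc n). \<bar>base E c \<tau> - base E c' \<tau>\<bar> * path_prob E \<theta> \<tau>) \<le> real n * eps_P E"
proof -
  have b: "\<bar>base E c (z # \<tau>) - base E c' (z # \<tau>)\<bar>
      = pmf (init E) (fst z) * \<bar>base_run E c z \<tau> - base_run E c' z \<tau>\<bar>" for z \<tau>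
    by (simp add: abs_mult flip: right_diff_distrib)
  have "(\<Sum>\<tau>\<in>paths E (Suc n). \<bar>base E c \<tau> - base E c' \<tau>\<bar> * path_prob E \<theta> \<tau>)
      = (\<Sum>z\<in>X. pmf (init E) (fst z) * P \<theta> (fst z) (snd z)
        * (\<Sum>\<tau>\<in>paths E n. \<bar>base_run E c z \<tau> - base_run E c' z \<tau>\<bar> * path_prob E \<theta> \<tau>))"
    unfolding sum_paths_Suc sum_distrib_left
    by (intro sum.cong refl) (simp only: b path_prob_Cons mult_ac)
  also have "\<dots> \<le> (\<Sum>z\<in>X. pmf (init E) (fst z) * P \<theta> (fst z) (snd z) * (real n * eps_P E))"
    using c by (intro sum_mono mult_left_mono sum_abs_base_run_diff) auto
  also have "\<dots> = real n * eps_P E"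
    unfolding sum_X by (simp add: sum_P sum_init flip: sum_distrib_left sum_distrib_right)
  finally show ?thesis .
qed

lemma base_nonneg: "0 \<le> base E c \<tau>"
  by (cases \<tau>) (auto simp: base_run_nonneg)

text \<open>Kernel and reward are exchanged separately. The path score is the same function for both
  agents and is bounded by \<open>2 * (t + 1) * N v\<close>, which multiplies either error.\<close>

lemma dexp_reward_hetero:
  assumes c: "c < agents E" "c' < agents E"
  shows "\<bar>dexp_reward c t \<theta> v - dexp_reward c' t \<theta> v\<bar> \<le> 2 * (real t + 1) * N v * (real t * eps_P E + eps_r E)"
proof -
  let ?b = "2 * (real t + 1) * N v"
  let ?p = "path_prob E \<theta>"
  have "\<bar>dexp_reward c t \<theta> v - dexp_reward c' t \<theta> v\<bar>
    \<le> (\<Sum>\<tau>\<in>paths E (Suc t). \<bar>base E c \<tau> * ?p \<tau> * (path_score E \<theta> v \<tau> * path_reward E c t \<tau>)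
        - base E c' \<tau> * ?p \<tau> * (path_score E \<theta> v \<tau> * path_reward E c' t \<tau>)\<bar>)"
    unfolding dexp_reward_def path_avg_def sum_subtractf[symmetric] by (rule sum_abs)
  also have "\<dots> \<le> (\<Sum>\<tau>\<in>paths E (Suc t). (\<bar>base E c \<tau> - base E c' \<tau>\<bar> * ?p \<tau>) * ?b + base E c' \<tau> * ?p \<tau> * (?b * eps_r E))"
  proof (intro sum_mono)
    fix \<tau> assume \<tau>: "\<tau> \<in> paths E (Suc t)"
    let ?x = "path_score E \<theta> v \<tau>" and ?r = "path_reward E c t \<tau>" and ?r' = "path_reward E c' t \<tau>"
    have x: "\<bar>?x\<bar> \<le> ?b" using abs_path_score_le[OF \<tau>, of \<theta> v] by (simp add: algebra_simps)
    have xr: "\<bar>?x * ?r\<bar> \<le> ?b" by (rule abs_times_path_reward_le[OF c(1) \<tau> _ x]) simp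
    have "\<tau> ! t \<in> X" using \<tau> nth_mem[of t \<tau>] by (auto simp: paths_def)
    then have "\<bar>?r - ?r'\<bar> \<le> eps_r E"
      unfolding path_reward_def using c by (intro eps_r_ge) auto
    with x have xrr: "\<bar>?x\<bar> * \<bar>?r - ?r'\<bar> \<le> ?b * eps_r E"
      by (intro mult_mono) (auto simp: L2_set_nonneg)
    have "base E c \<tau> * ?p \<tau> * (?x * ?r) - base E c' \<tau> * ?p \<tau> * (?x * ?r')
        = (base E c \<tau> - base E c' \<tau>) * ?p \<tau> * (?x * ?r) + base E c' \<tau> * ?p \<tau> * (?x * (?r - ?r'))"
      by (simp add: algebra_simps)
    then have "\<bar>base E c \<tau> * ?p \<tau> * (?x * ?r) - base E c' \<tau> * ?p \<tau> * (?x * ?r')\<bar>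
        \<le> \<bar>(base E c \<tau> - base E c' \<tau>) * ?p \<tau> * (?x * ?r)\<bar> + \<bar>base E c' \<tau> * ?p \<tau> * (?x * (?r - ?r'))\<bar>"
      by (simp only: abs_triangle_ineq)
    also have "\<dots> = (\<bar>base E c \<tau> - base E c' \<tau>\<bar> * ?p \<tau>) * \<bar>?x * ?r\<bar> + base E c' \<tau> * ?p \<tau> * (\<bar>?x\<bar> * \<bar>?r - ?r'\<bar>)"
      by (simp add: abs_mult path_prob_nonneg base_nonneg)
    also have "\<dots> \<le> (\<bar>base E c \<tau> - base E c' \<tau>\<bar> * ?p \<tau>) * ?b + base E c' \<tau> * ?p \<tau> * (?b * eps_r E)"
      using xr xrr by (intro add_mono mult_left_mono) (auto simp: path_prob_nonneg base_nonneg)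
    finally show "\<bar>base E c \<tau> * ?p \<tau> * (?x * ?r) - base E c' \<tau> * ?p \<tau> * (?x * ?r')\<bar>
        \<le> (\<bar>base E c \<tau> - base E c' \<tau>\<bar> * ?p \<tau>) * ?b + base E c' \<tau> * ?p \<tau> * (?b * eps_r E)" .
  qed
  also have "\<dots> = (\<Sum>\<tau>\<in>paths E (Suc t). \<bar>base E c \<tau> - base E c' \<tau>\<bar> * ?p \<tau>) * ?b
      + path_avg E c' (Suc t) \<theta> (\<lambda>_. ?b * eps_r E)"
    by (simp add: sum.distrib sum_distrib_right path_avg_def)
  also have "path_avg E c' (Suc t) \<theta> (\<lambda>_. ?b * eps_r E) = ?b * eps_r E"
    by (simp add: path_avg_eq c)
  also have "(\<Sum>\<tau>\<in>paths E (Suc t). \<bar>base E c \<tau> - base E c' \<tau>\<bar> * ?p \<tau>) * ?b \<le> (real t * eps_P E) * ?b"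
    using sum_abs_base_diff[OF c] by (intro mult_right_mono) (auto simp: L2_set_nonneg)
  finally show ?thesis by (simp add: algebra_simps)
qed

text \<open>The kernel error at time \<open>t\<close> grows like \<open>(t + 1) ^ 2\<close> and the
  reward error like \<open>t + 1\<close>; discounting turns these into inverse powers 3 and 2 of
  \<open>1 - \<gamma>\<close>.\<close>

lemma wgrad_hetero:
  assumes c: "c < agents E" "c' < agents E"
  shows "N (\<lambda>x. wgrad c full_weight \<theta> x - wgrad c' full_weight \<theta> x)
    \<le> 4 * eps_P E / (1 - \<gamma>) ^ 3 + 2 * eps_r E / (1 - \<gamma>)\<^sup>2"
proof (rule L2_set_le_if_dot_le)
  fix v
  let ?f = "\<lambda>t. dexp_reward c t \<theta> v - dexp_reward c' t \<theta> v"
  have s: "summable (\<lambda>t. 2 * N v * eps_P E * (\<gamma> ^ t * (real t + 1) ^ 2) + 2 * N v * eps_r E * (\<gamma> ^ t * (real t + 1)))"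
    using summable_power_weights[OF \<gamma>_pos \<gamma>_less] by (intro summable_add summable_mult)
  have b: "\<bar>full_weight t * ?f t\<bar> \<le> 2 * N v * eps_P E * (\<gamma> ^ t * (real t + 1) ^ 2) + 2 * N v * eps_r E * (\<gamma> ^ t * (real t + 1))"
    for t
  proof -
    have "\<bar>?f t\<bar> \<le> 2 * (real t + 1) * N v * ((real t + 1) * eps_P E + eps_r E)"
      using eps_nonneg by (intro order_trans[OF dexp_reward_hetero[OF c]] mult_left_mono add_right_mono mult_right_mono)
        (auto simp: L2_set_nonneg)
    then have "\<gamma> ^ t * \<bar>?f t\<bar> \<le> \<gamma> ^ t * (2 * (real t + 1) * N v * ((real t + 1) * eps_P E + eps_r E))"
      using \<gamma>_pos by (intro mult_left_mono) auto
    moreover have "\<bar>full_weight t * ?f t\<bar> = \<gamma> ^ t * \<bar>?f t\<bar>"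
      using \<gamma>_pos by (simp add: full_weight_def abs_mult)
    moreover have "\<gamma> ^ t * (2 * (real t + 1) * N v * ((real t + 1) * eps_P E + eps_r E))
        = 2 * N v * eps_P E * (\<gamma> ^ t * (real t + 1) ^ 2) + 2 * N v * eps_r E * (\<gamma> ^ t * (real t + 1))"
      by (simp add: power2_eq_square algebra_simps)
    ultimately show ?thesis by simp
  qed
  have "dot X (\<lambda>x. wgrad c full_weight \<theta> x - wgrad c' full_weight \<theta> x) v = wsum full_weight ?f"
    unfolding dot_commute[of X _ v] dot_diff_right using c summable_dexp_reward[OF _ weights_full]
    by (simp add: dot_wgrad weights_full wsum_diff)
  also have "\<dots> \<le> (\<Sum>t. 2 * N v * eps_P E * (\<gamma> ^ t * (real t + 1) ^ 2) + 2 * N v * eps_r E * (\<gamma> ^ t * (real t + 1)))"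
    using abs_suminf_le(2)[OF b s] by (simp add: wsum_def)
  also have "\<dots> = 2 * N v * eps_P E * (\<Sum>t. \<gamma> ^ t * (real t + 1) ^ 2) + 2 * N v * eps_r E * (\<Sum>t. \<gamma> ^ t * (real t + 1))"
    using summable_power_weights[OF \<gamma>_pos \<gamma>_less]
    by (subst suminf_add[symmetric]) (auto intro!: summable_mult simp: suminf_mult)
  also have "\<dots> \<le> 2 * N v * eps_P E * (2 / (1 - \<gamma>) ^ 3) + 2 * N v * eps_r E * (1 / (1 - \<gamma>)\<^sup>2)"
    unfolding suminf_power_weight1[OF \<gamma>_pos \<gamma>_less] using eps_nonneg
    by (intro add_mono mult_left_mono suminf_power_weight2 \<gamma>_pos \<gamma>_less) (auto simp: L2_set_nonneg)
  finally show "dot X (\<lambda>x. wgrad c full_weight \<theta> x - wgrad c' full_weight \<theta> x) v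
      \<le> (4 * eps_P E / (1 - \<gamma>) ^ 3 + 2 * eps_r E / (1 - \<gamma>)\<^sup>2) * N v"
    by (simp add: algebra_simps)
qed (use eps_nonneg \<gamma>_less in auto)


section \<open>Policy gradient theorem and gradient domination\<close>

definition admissible :: "policy \<Rightarrow> bool" where
  "admissible \<pi> \<longleftrightarrow> (\<forall>s\<in>S. set_pmf (\<pi> s) \<subseteq> A)"

lemma admissible_softmax: "admissible (softmax E \<theta>)"
  by (simp add: admissible_def set_softmax)

definition sa_law :: "nat \<Rightarrow> policy \<Rightarrow> nat \<Rightarrow> (nat \<times> nat) pmf" where
  "sa_law c \<pi> = chain_law (sa_init E \<pi>) (sa_step E c \<pi>)"

primrec visit :: "nat \<Rightarrow> policy \<Rightarrow> nat \<Rightarrow> nat \<Rightarrow> real" where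
  "visit c \<pi> 0 s = pmf (init E) s"
| "visit c \<pi> (Suc t) s' = (\<Sum>s\<in>S. visit c \<pi> t s * (\<Sum>a\<in>A. pmf (\<pi> s) a * pmf (kernel E c s a) s'))"

lemma sa_law_X: "admissible \<pi> \<Longrightarrow> c < agents E \<Longrightarrow> set_pmf (sa_law c \<pi> t) \<subseteq> X"
  unfolding sa_law_def admissible_def by (intro set_chain_law sa_step_X sa_init_X) auto

lemma finite_sa_law: "admissible \<pi> \<Longrightarrow> c < agents E \<Longrightarrow> finite (set_pmf (sa_law c \<pi> t))"
  by (rule finite_subset[OF sa_law_X]) auto

lemma pmf_sa_law:
  assumes "admissible \<pi>" "c < agents E"
  shows "pmf (sa_law c \<pi> t) (s, a) = visit c \<pi> t s * pmf (\<pi> s) a"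
proof (induction t arbitrary: s a)
  case 0
  show ?case by (simp add: sa_law_def pmf_sa_init)
next
  case (Suc t)
  have "pmf (sa_law c \<pi> (Suc t)) (s, a)
      = expect (sa_law c \<pi> t) (\<lambda>y. pmf (sa_step E c \<pi> y) (s, a))"
    by (simp add: sa_law_def pmf_bind)
  also have "\<dots> = (\<Sum>y\<in>X. pmf (sa_step E c \<pi> y) (s, a) * pmf (sa_law c \<pi> t) y)"
    using sa_law_X[OF assms] by (intro integral_measure_pmf_real) auto
  also have "\<dots> = visit c \<pi> (Suc t) s * pmf (\<pi> s) a"
    by (simp add: sum_X pmf_sa_step Suc.IH sum_distrib_left sum_distrib_right mult_ac)
  finally show ?case .
qed

lemma expectation_sa_law:
  fixes f :: "nat \<times> nat \<Rightarrow> real"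
  assumes "admissible \<pi>" "c < agents E"
  shows "expect (sa_law c \<pi> t) f = (\<Sum>s\<in>S. visit c \<pi> t s * (\<Sum>a\<in>A. pmf (\<pi> s) a * f (s, a)))"
proof -
  have "expect (sa_law c \<pi> t) f = (\<Sum>y\<in>X. f y * pmf (sa_law c \<pi> t) y)"
    using sa_law_X[OF assms] by (intro integral_measure_pmf_real) auto
  then show ?thesis
    by (simp add: sum_X pmf_sa_law[OF assms] sum_distrib_left mult_ac)
qed

lemma visit_nonneg: "0 \<le> visit c \<pi> t s"
  by (induction t arbitrary: s) (auto intro!: sum_nonneg mult_nonneg_nonneg)

lemma sum_policy: "admissible \<pi> \<Longrightarrow> s \<in> S \<Longrightarrow> (\<Sum>a\<in>A. pmf (\<pi> s) a) = 1"
  by (intro sum_pmf_eq_1) (auto simp: admissible_def)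

lemma sum_visit:
  assumes "admissible \<pi>" "c < agents E"
  shows "(\<Sum>s\<in>S. visit c \<pi> t s) = 1"
  using expectation_sa_law[OF assms, of t "\<lambda>_. 1"] sum_policy[OF assms(1)] by simp

lemma visit_le_1:
  assumes "admissible \<pi>" "c < agents E" "s \<in> S"
  shows "visit c \<pi> t s \<le> 1"
  using member_le_sum[of s S "visit c \<pi> t"] assms by (simp add: visit_nonneg sum_visit)

lemma prob_fst_sa_law:
  assumes "admissible \<pi>" "c < agents E" "s \<in> S"
  shows "measure_pmf.prob (sa_law c \<pi> t) {y. fst y = s} = visit c \<pi> t s"
proof -
  have "measure_pmf.prob (sa_law c \<pi> t) {y. fst y = s}
      = expect (sa_law c \<pi> t) (\<lambda>y. of_bool (fst y = s))"
  proof -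
    have "(\<lambda>y :: nat \<times> nat. of_bool (fst y = s) :: real) = indicator {y. fst y = s}"
      by (auto simp: indicator_def)
    then show ?thesis by simp
  qed
  also have "\<dots> = (\<Sum>s'\<in>S. visit c \<pi> t s' * of_bool (s' = s))"
    unfolding expectation_sa_law[OF assms(1,2)] using sum_policy[OF assms(1)]
    by (intro sum.cong) (auto simp flip: sum_distrib_right)
  also have "\<dots> = visit c \<pi> t s"
    using assms(3) by (simp add: of_bool_def if_distrib cong: if_cong)
  finally show ?thesis .
qed

lemma summable_discounted:
  assumes "\<And>t. \<bar>f t\<bar> \<le> K"
  shows "summable (\<lambda>t. \<gamma> ^ t * f t)" "summable (\<lambda>t. norm (\<gamma> ^ t * f t))"
proof -
  have "summable (\<lambda>t. \<gamma> ^ t * K)"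
    using \<gamma>_pos \<gamma>_less by (intro summable_mult2 summable_geometric) auto
  then show "summable (\<lambda>t. norm (\<gamma> ^ t * f t))"
    using assms \<gamma>_pos
    by (intro summable_comparison_test_ev[OF always_eventually \<open>summable (\<lambda>t. \<gamma> ^ t * K)\<close>])
      (auto simp: abs_mult mult_left_mono)
  then show "summable (\<lambda>t. \<gamma> ^ t * f t)"
    by (rule summable_norm_cancel)
qed

lemma abs_visit_le: "admissible \<pi> \<Longrightarrow> c < agents E \<Longrightarrow> s \<in> S \<Longrightarrow> \<bar>visit c \<pi> t s\<bar> \<le> 1"
  by (simp add: visit_nonneg visit_le_1)

lemma summable_visit:
  assumes "admissible \<pi>" "c < agents E" "s \<in> S"
  shows "summable (\<lambda>t. \<gamma> ^ t * visit c \<pi> t s)" "summable (\<lambda>t. norm (\<gamma> ^ t * visit c \<pi> t s))"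
  by (rule summable_discounted[OF abs_visit_le[OF assms]])+

text \<open>The occupancy without its normalising factor \<open>1 - \<gamma>\<close>, which cancels
  in the ratios of \<open>mu_agent\<close>.\<close>

definition dvisit :: "nat \<Rightarrow> policy \<Rightarrow> nat \<Rightarrow> real" where
  "dvisit c \<pi> s = (\<Sum>t. \<gamma> ^ t * visit c \<pi> t s)"

lemma occupancy_eq:
  assumes "admissible \<pi>" "c < agents E" "s \<in> S"
  shows "occupancy E c \<pi> s = (1 - \<gamma>) * dvisit c \<pi> s"
proof -
  have "measure (path_measure E c \<pi>) {\<omega> \<in> space (path_measure E c \<pi>). fst (\<omega> t) = s} = visit c \<pi> t s" for t
    unfolding path_measure_def measure_chain_coordinate[where P="\<lambda>y. fst y = s"]
    using prob_fst_sa_law[OF assms] by (simp add: sa_law_def)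
  then show ?thesis by (simp add: occupancy_def dvisit_def)
qed

text \<open>The visit at time 0 alone. When the initial law charges every state, this keeps the
  occupancies in the denominators of \<open>mu_agent\<close> positive.\<close>

lemma dvisit_ge:
  assumes "admissible \<pi>" "c < agents E" "s \<in> S"
  shows "pmf (init E) s \<le> dvisit c \<pi> s"
  unfolding dvisit_def
  using sum_le_suminf[OF summable_visit(1)[OF assms], of "{0}"] \<gamma>_pos by (simp add: visit_nonneg)

text \<open>Rewards are bounded only on the carriers, where paths stay almost surely. Domination by
  a geometric series then allows the exchange of integral and series.\<close>

lemma policy_return_eq:
  assumes "admissible \<pi>" "c < agents E"
  shows "policy_return E c \<pi>
    = (\<Sum>t. \<gamma> ^ t * expect (sa_law c \<pi> t) (\<lambda>y. reward E c (fst y) (snd y)))"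
proof -
  let ?M = "path_measure E c \<pi>" and ?r = "\<lambda>y. reward E c (fst y) (snd y)"
  let ?f = "\<lambda>t \<omega>. \<gamma> ^ t * ?r (\<omega> t)"
  have r: "\<bar>?r y\<bar> \<le> 1" if "y \<in> X" for y
    using that assms(2) by (auto simp: mem_Times_iff reward_nonneg reward_le)
  have eq: "(\<integral>\<omega>. g (\<omega> t) \<partial>?M) = expect (sa_law c \<pi> t) g" for g :: "nat \<times> nat \<Rightarrow> real" and t
    unfolding path_measure_def sa_law_def by (rule integral_chain_coordinate)
  have int: "integrable ?M (?f t)" for t
    unfolding path_measure_def
    by (subst integrable_chain_coordinate[where f="\<lambda>y. \<gamma> ^ t * ?r y"])
      (use finite_sa_law[OF assms] in \<open>auto simp: sa_law_def intro!: integrable_measure_pmf_finite\<close>)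
  have "AE \<omega> in ?M. \<forall>t. \<omega> t \<in> X"
    unfolding AE_all_countable path_measure_def AE_chain_coordinate[where P="\<lambda>y. y \<in> X"]
    using sa_law_X[OF assms] by (auto simp: sa_law_def)
  then have sm: "AE \<omega> in ?M. summable (\<lambda>t. norm (?f t \<omega>))"
    by eventually_elim (rule summable_discounted(2)[where K=1], use r in blast)
  have "(\<integral>\<omega>. norm (?f t \<omega>) \<partial>?M) = \<gamma> ^ t * expect (sa_law c \<pi> t) (\<lambda>y. \<bar>?r y\<bar>)" for t
    using eq[of "\<lambda>y. norm (\<gamma> ^ t * ?r y)" t] \<gamma>_pos by (simp add: abs_mult)
  moreover have "\<bar>expect (sa_law c \<pi> t) (\<lambda>y. \<bar>?r y\<bar>)\<bar> \<le> 1" for t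
  proof -
    have "expect (sa_law c \<pi> t) (\<lambda>y. \<bar>?r y\<bar>) \<le> expect (sa_law c \<pi> t) (\<lambda>y. 1)"
      using sa_law_X[OF assms] r by (intro expectation_mono_pmf_finite finite_sa_law assms) blast
    then show ?thesis by (simp add: integral_nonneg_AE)
  qed
  then have "summable (\<lambda>t. \<gamma> ^ t * expect (sa_law c \<pi> t) (\<lambda>y. \<bar>?r y\<bar>))"
    by (rule summable_discounted(1))
  ultimately have "summable (\<lambda>t. \<integral>\<omega>. norm (?f t \<omega>) \<partial>?M)"
    by simp
  from integral_suminf[OF int sm this] show ?thesis
    unfolding policy_return_def by (simp add: eq[of ?r])
qed

section \<open>Value functions and the policy gradient theorem\<close>

lemma exp_reward_eq:
  "c < agents E \<Longrightarrow>
    exp_reward c t \<theta> = expect (sa_law c (softmax E \<theta>) t) (\<lambda>y. reward E c (fst y) (snd y))"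
  unfolding exp_reward_def sa_law_def map_nth_chain_prefix[symmetric]
  by (simp add: path_avg_eq path_reward_def[abs_def] traj_def)

lemma Jc_eq: "c < agents E \<Longrightarrow> Jc E c \<theta> = wsum full_weight (\<lambda>t. exp_reward c t \<theta>)"
  by (simp add: Jc_def policy_return_eq admissible_softmax wsum_def full_weight_def exp_reward_eq)

lemma Jc_bounds:
  assumes "c < agents E"
  shows "0 \<le> Jc E c \<theta>" "Jc E c \<theta> \<le> 1 / (1 - \<gamma>)"
proof -
  have s: "summable (\<lambda>t. \<gamma> ^ t * exp_reward c t \<theta>)"
    using summable_exp_reward[OF assms weights_full, of \<theta>] by (simp add: full_weight_def)
  have geo: "(\<lambda>t. \<gamma> ^ t) sums (1 / (1 - \<gamma>))" using \<gamma>_pos \<gamma>_less by (intro geometric_sums) auto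
  have nonneg: "0 \<le> exp_reward c t \<theta>" for t
    unfolding exp_reward_eq[OF assms]
    using sa_law_X[OF admissible_softmax assms, of \<theta> t] assms
    by (intro integral_nonneg_AE) (auto simp: AE_measure_pmf_iff intro!: reward_nonneg)
  show "0 \<le> Jc E c \<theta>"
    unfolding Jc_eq[OF assms] wsum_def full_weight_def using nonneg \<gamma>_pos by (intro suminf_nonneg s) auto
  have "\<gamma> ^ t * exp_reward c t \<theta> \<le> \<gamma> ^ t" for t
    using abs_exp_reward_le[OF assms, of t \<theta>] \<gamma>_pos mult_left_mono[of "exp_reward c t \<theta>" 1 "\<gamma> ^ t"] by auto
  then show "Jc E c \<theta> \<le> 1 / (1 - \<gamma>)"
    unfolding Jc_eq[OF assms] wsum_def full_weight_def
    using suminf_le[OF _ s sums_summable[OF geo]] geo by (simp add: sums_iff)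
qed

text \<open>The undiscounted expected reward exactly \<open>k\<close> steps after taking
  \<open>a\<close> in \<open>s\<close>. Keeping the delay separate makes every derivative a finite
  sum; discounting is postponed to \<open>Q\<close>.\<close>

fun qval :: "nat \<Rightarrow> param \<Rightarrow> nat \<Rightarrow> nat \<Rightarrow> nat \<Rightarrow> real" where
  "qval c \<theta> 0 s a = reward E c s a"
| "qval c \<theta> (Suc k) s a = (\<Sum>s'\<in>S. pmf (kernel E c s a) s' * (\<Sum>b\<in>A. P \<theta> s' b * qval c \<theta> k s' b))"

definition val :: "nat \<Rightarrow> param \<Rightarrow> nat \<Rightarrow> nat \<Rightarrow> real" where
  "val c \<theta> k s = (\<Sum>a\<in>A. P \<theta> s a * qval c \<theta> k s a)"

lemma sum_kernel_pmf: "c < agents E \<Longrightarrow> s \<in> S \<Longrightarrow> a \<in> A \<Longrightarrow> (\<Sum>s'\<in>S. pmf (kernel E c s a) s') = 1"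
  using sum_kernel[of c "(s, a)"] by simp

lemma abs_qval_le:
  assumes "c < agents E"
  shows "s \<in> S \<Longrightarrow> a \<in> A \<Longrightarrow> \<bar>qval c \<theta> k s a\<bar> \<le> 1"
proof (induction k arbitrary: s a)
  case 0
  then show ?case by (simp add: assms reward_nonneg reward_le)
next
  case (Suc k)
  have "\<bar>qval c \<theta> (Suc k) s a\<bar> \<le> (\<Sum>s'\<in>S. pmf (kernel E c s a) s' * 1)"
    unfolding qval.simps
    by (intro order_trans[OF sum_abs] sum_mono) (simp add: abs_mult mult_left_le abs_P_avg_le Suc.IH)
  then show ?case using sum_kernel_pmf[OF assms Suc.prems] by simp
qed

lemma abs_val_le: "c < agents E \<Longrightarrow> s \<in> S \<Longrightarrow> \<bar>val c \<theta> k s\<bar> \<le> 1"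
  unfolding val_def by (intro abs_P_avg_le abs_qval_le)

lemma visit_Suc_avg:
  "(\<Sum>s'\<in>S. visit c \<pi> (Suc t) s' * f s')
    = (\<Sum>s\<in>S. visit c \<pi> t s * (\<Sum>a\<in>A. pmf (\<pi> s) a * (\<Sum>s'\<in>S. pmf (kernel E c s a) s' * f s')))"
proof -
  have "(\<Sum>s'\<in>S. visit c \<pi> (Suc t) s' * f s')
      = (\<Sum>s'\<in>S. \<Sum>s\<in>S. \<Sum>a\<in>A. visit c \<pi> t s * (pmf (\<pi> s) a * (pmf (kernel E c s a) s' * f s')))"
    by (simp add: sum_distrib_left sum_distrib_right mult_ac)
  also have "\<dots> = (\<Sum>s\<in>S. \<Sum>s'\<in>S. \<Sum>a\<in>A. visit c \<pi> t s * (pmf (\<pi> s) a * (pmf (kernel E c s a) s' * f s')))"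
    by (rule sum.swap)
  also have "\<dots> = (\<Sum>s\<in>S. \<Sum>a\<in>A. \<Sum>s'\<in>S. visit c \<pi> t s * (pmf (\<pi> s) a * (pmf (kernel E c s a) s' * f s')))"
    by (intro sum.cong refl sum.swap)
  finally show ?thesis
    by (simp add: sum_distrib_left mult_ac)
qed

lemma visit_val: "(\<Sum>s\<in>S. visit c (softmax E \<theta>) l s * val c \<theta> k s) = (\<Sum>s\<in>S. visit c (softmax E \<theta>) (l + k) s * val c \<theta> 0 s)"
proof (induction k arbitrary: l)
  case (Suc k)
  have "(\<Sum>s\<in>S. visit c (softmax E \<theta>) (Suc l) s * val c \<theta> k s) = (\<Sum>s\<in>S. visit c (softmax E \<theta>) l s * val c \<theta> (Suc k) s)"
    unfolding visit_Suc_avg by (simp add: val_def)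
  with Suc[of "Suc l"] show ?case by simp
qed simp

lemma exp_reward_val: "c < agents E \<Longrightarrow> exp_reward c t \<theta> = (\<Sum>s\<in>S. pmf (init E) s * val c \<theta> t s)"
  using visit_val[where l=0 and k=t and c=c and \<theta>=\<theta>]
  by (simp add: exp_reward_eq expectation_sa_law[OF admissible_softmax] val_def[of c \<theta> 0])

text \<open>The part of the derivative of \<open>val\<close> caused by changing the policy at the
  current state only, with all later decisions frozen. \<open>dval\<close> collects these parts
  along the trajectory.\<close>

definition gain :: "nat \<Rightarrow> param \<Rightarrow> param \<Rightarrow> nat \<Rightarrow> nat \<Rightarrow> real" where
  "gain c \<theta> u k s = (\<Sum>a\<in>A. P \<theta> s a * score E \<theta> u (s, a) * qval c \<theta> k s a)"

fun dval :: "nat \<Rightarrow> param \<Rightarrow> param \<Rightarrow> nat \<Rightarrow> nat \<Rightarrow> real" where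
  "dval c \<theta> u 0 s = gain c \<theta> u 0 s"
| "dval c \<theta> u (Suc k) s = gain c \<theta> u (Suc k) s
    + (\<Sum>a\<in>A. P \<theta> s a * (\<Sum>s'\<in>S. pmf (kernel E c s a) s' * dval c \<theta> u k s'))"

lemma DERIV_val:
  "s \<in> S \<Longrightarrow> ((\<lambda>\<alpha>. val c (line \<theta> u \<alpha>) k s) has_real_derivative dval c (line \<theta> u \<alpha>) u k s) (at \<alpha>)"
proof (induction k arbitrary: s)
  case 0
  then show ?case
    unfolding val_def dval.simps gain_def qval.simps
    by (intro DERIV_sum DERIV_cmult_right DERIV_P) auto
next
  case (Suc k)
  let ?th = "line \<theta> u \<alpha>"
  have q: "((\<lambda>\<alpha>. qval c (line \<theta> u \<alpha>) (Suc k) s a) has_real_derivative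
      (\<Sum>s'\<in>S. pmf (kernel E c s a) s' * dval c ?th u k s')) (at \<alpha>)" for a
    using Suc.IH unfolding qval.simps val_def[symmetric] by (intro DERIV_sum DERIV_cmult) auto
  have "((\<lambda>\<alpha>. val c (line \<theta> u \<alpha>) (Suc k) s) has_real_derivative
      (\<Sum>a\<in>A. P ?th s a * score E ?th u (s, a) * qval c ?th (Suc k) s a
        + (\<Sum>s'\<in>S. pmf (kernel E c s a) s' * dval c ?th u k s') * P ?th s a)) (at \<alpha>)"
    unfolding val_def using Suc.prems by (intro DERIV_sum DERIV_mult DERIV_P q) auto
  then show ?case by (simp add: gain_def sum.distrib mult_ac)
qed

text \<open>Unrolling \<open>dval\<close>: by \<open>visit_Suc_avg\<close>, averaging over one
  transition is the same as starting one time unit later. The starting time \<open>l\<close> stays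
  general for the sake of the induction.\<close>

lemma visit_dval:
  "(\<Sum>s\<in>S. visit c (softmax E \<theta>) l s * dval c \<theta> u k s)
    = (\<Sum>j\<le>k. \<Sum>s\<in>S. visit c (softmax E \<theta>) (l + j) s * gain c \<theta> u (k - j) s)"
proof (induction k arbitrary: l)
  case (Suc k)
  have "(\<Sum>s\<in>S. visit c (softmax E \<theta>) l s * dval c \<theta> u (Suc k) s)
      = (\<Sum>s\<in>S. visit c (softmax E \<theta>) l s * gain c \<theta> u (Suc k) s)
        + (\<Sum>s\<in>S. visit c (softmax E \<theta>) (Suc l) s * dval c \<theta> u k s)"
    unfolding visit_Suc_avg by (simp add: distrib_left sum.distrib)
  also have "\<dots> = (\<Sum>j\<le>Suc k. \<Sum>s\<in>S. visit c (softmax E \<theta>) (l + j) s * gain c \<theta> u (Suc k - j) s)"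
    unfolding Suc sum.atMost_Suc_shift by simp
  finally show ?case .
qed simp

text \<open>Both sides are derivatives of the same function at the same point, one obtained from
  path weights and one from the value recursion. Uniqueness of the derivative gives the policy
  gradient theorem for a fixed time without any conditioning argument.\<close>

lemma dexp_reward_eq:
  assumes "c < agents E"
  shows "dexp_reward c t \<theta> u
    = (\<Sum>l\<le>t. \<Sum>s\<in>S. visit c (softmax E \<theta>) l s * gain c \<theta> u (t - l) s)"
proof -
  have "((\<lambda>\<alpha>. exp_reward c t (line \<theta> u \<alpha>)) has_real_derivative (\<Sum>s\<in>S. pmf (init E) s * dval c (line \<theta> u 0) u t s)) (at 0)"
    unfolding exp_reward_val[OF assms] by (intro DERIV_sum DERIV_cmult DERIV_val)
  from DERIV_unique[OF this DERIV_exp_reward] show ?thesis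
    using visit_dval[of c \<theta> 0 u t] by simp
qed

definition Q :: "nat \<Rightarrow> param \<Rightarrow> nat \<Rightarrow> nat \<Rightarrow> real" where
  "Q c \<theta> s a = (\<Sum>k. \<gamma> ^ k * qval c \<theta> k s a)"

definition V :: "nat \<Rightarrow> param \<Rightarrow> nat \<Rightarrow> real" where
  "V c \<theta> s = (\<Sum>a\<in>A. P \<theta> s a * Q c \<theta> s a)"

lemma summable_qval:
  assumes "c < agents E" "s \<in> S" "a \<in> A"
  shows "summable (\<lambda>k. \<gamma> ^ k * qval c \<theta> k s a)" "summable (\<lambda>k. norm (\<gamma> ^ k * qval c \<theta> k s a))"
  by (rule summable_discounted[OF abs_qval_le[OF assms]])+

lemma summable_val:
  assumes "c < agents E" "s \<in> S"
  shows "summable (\<lambda>k. \<gamma> ^ k * val c \<theta> k s)"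
  by (rule summable_discounted[OF abs_val_le[OF assms]])

lemma V_eq:
  assumes "c < agents E" "s \<in> S"
  shows "V c \<theta> s = (\<Sum>k. \<gamma> ^ k * val c \<theta> k s)"
proof -
  have "V c \<theta> s = (\<Sum>a\<in>A. \<Sum>k. P \<theta> s a * (\<gamma> ^ k * qval c \<theta> k s a))"
    unfolding V_def Q_def using summable_qval(1)[OF assms] by (intro sum.cong suminf_mult[symmetric]) auto
  also have "\<dots> = (\<Sum>k. \<Sum>a\<in>A. P \<theta> s a * (\<gamma> ^ k * qval c \<theta> k s a))"
    using summable_qval(1)[OF assms] by (intro suminf_sum[symmetric] summable_mult)
  finally show ?thesis by (simp add: val_def sum_distrib_left mult_ac)
qed

lemma Jc_V:
  assumes "c < agents E"
  shows "Jc E c \<theta> = (\<Sum>s\<in>S. pmf (init E) s * V c \<theta> s)"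
proof -
  note s = summable_val[OF assms]
  have "(\<Sum>s\<in>S. pmf (init E) s * V c \<theta> s) = (\<Sum>s\<in>S. \<Sum>k. pmf (init E) s * (\<gamma> ^ k * val c \<theta> k s))"
    using s by (intro sum.cong refl) (simp add: V_eq[OF assms] suminf_mult)
  also have "\<dots> = (\<Sum>k. \<Sum>s\<in>S. pmf (init E) s * (\<gamma> ^ k * val c \<theta> k s))"
    using s by (intro suminf_sum[symmetric] summable_mult)
  finally show ?thesis
    by (simp add: Jc_eq[OF assms] wsum_def full_weight_def exp_reward_val[OF assms] sum_distrib_left mult_ac)
qed

lemma Q_Bellman:
  assumes "c < agents E" "s \<in> S" "a \<in> A"
  shows "Q c \<theta> s a = reward E c s a + \<gamma> * (\<Sum>s'\<in>S. pmf (kernel E c s a) s' * V c \<theta> s')"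
proof -
  note s = summable_val[OF assms(1)]
  have "Q c \<theta> s a = reward E c s a + (\<Sum>k. \<gamma> ^ Suc k * qval c \<theta> (Suc k) s a)"
    unfolding Q_def using suminf_split_head[OF summable_qval(1)[OF assms]] by simp
  also have "(\<Sum>k. \<gamma> ^ Suc k * qval c \<theta> (Suc k) s a)
      = (\<Sum>k. \<Sum>s'\<in>S. \<gamma> * pmf (kernel E c s a) s' * (\<gamma> ^ k * val c \<theta> k s'))"
    by (simp add: val_def sum_distrib_left mult_ac)
  also have "\<dots> = (\<Sum>s'\<in>S. \<Sum>k. \<gamma> * pmf (kernel E c s a) s' * (\<gamma> ^ k * val c \<theta> k s'))"
    using s by (intro suminf_sum summable_mult)
  also have "\<dots> = (\<Sum>s'\<in>S. \<gamma> * pmf (kernel E c s a) s' * V c \<theta> s')"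
    using s by (intro sum.cong refl) (simp add: V_eq[OF assms(1)] suminf_mult)
  finally show ?thesis by (simp add: sum_distrib_left mult_ac)
qed

text \<open>Visits at time \<open>l\<close> meet rewards delayed by \<open>t - l\<close>. This
  convolution is the Cauchy product of two absolutely convergent series, so occupancy and action
  value separate.\<close>

lemma dot_wgrad_occupancy:
  assumes "c < agents E"
  shows "dot X u (wgrad c full_weight \<theta>)
    = (\<Sum>s\<in>S. \<Sum>a\<in>A. P \<theta> s a * score E \<theta> u (s, a) * (dvisit c (softmax E \<theta>) s * Q c \<theta> s a))"
proof -
  let ?w = "visit c (softmax E \<theta>)" and ?f = "\<lambda>s a. P \<theta> s a * score E \<theta> u (s, a)"
  let ?v = "\<lambda>l s. \<gamma> ^ l * ?w l s" and ?q = "\<lambda>k s a. \<gamma> ^ k * qval c \<theta> k s a"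
  have C: "(\<lambda>t. \<Sum>l\<le>t. ?v l s * ?q (t - l) s a) sums (dvisit c (softmax E \<theta>) s * Q c \<theta> s a)"
    if "s \<in> S" "a \<in> A" for s a
    unfolding dvisit_def Q_def
    by (intro Cauchy_product_sums summable_visit(2) summable_qval(2) assms that admissible_softmax)
  have "(\<lambda>t. \<Sum>s\<in>S. \<Sum>a\<in>A. ?f s a * (\<Sum>l\<le>t. ?v l s * ?q (t - l) s a))
      sums (\<Sum>s\<in>S. \<Sum>a\<in>A. ?f s a * (dvisit c (softmax E \<theta>) s * Q c \<theta> s a))"
    by (intro sums_sum sums_mult C)
  moreover have "(\<Sum>s\<in>S. \<Sum>a\<in>A. ?f s a * (\<Sum>l\<le>t. ?v l s * ?q (t - l) s a))
      = full_weight t * dexp_reward c t \<theta> u" for t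
  proof -
    have "(\<Sum>s\<in>S. \<Sum>a\<in>A. ?f s a * (\<Sum>l\<le>t. ?v l s * ?q (t - l) s a))
        = (\<Sum>s\<in>S. \<Sum>a\<in>A. \<Sum>l\<le>t. \<gamma> ^ t * (?w l s * (?f s a * qval c \<theta> (t - l) s a)))"
      unfolding sum_distrib_left
    proof (intro sum.cong refl)
      fix s a l assume "l \<in> {..t}"
      then have "\<gamma> ^ t = \<gamma> ^ l * \<gamma> ^ (t - l)" by (simp flip: power_add)
      then show "?f s a * (?v l s * ?q (t - l) s a)
          = \<gamma> ^ t * (?w l s * (?f s a * qval c \<theta> (t - l) s a))"
        by simp
    qed
    also have "\<dots> = (\<Sum>s\<in>S. \<Sum>l\<le>t. \<Sum>a\<in>A. \<gamma> ^ t * (?w l s * (?f s a * qval c \<theta> (t - l) s a)))"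
      by (intro sum.cong refl sum.swap)
    also have "\<dots> = (\<Sum>l\<le>t. \<Sum>s\<in>S. \<Sum>a\<in>A. \<gamma> ^ t * (?w l s * (?f s a * qval c \<theta> (t - l) s a)))"
      by (rule sum.swap)
    also have "\<dots> = full_weight t * dexp_reward c t \<theta> u"
      by (simp add: dexp_reward_eq[OF assms] full_weight_def gain_def sum_distrib_left)
    finally show ?thesis .
  qed
  ultimately show ?thesis
    unfolding dot_wgrad[OF assms weights_full] wsum_def by (simp add: sums_iff)
qed

text \<open>The direction is a coordinate vector. The mean subtracted in its score is what produces
  the baseline \<open>V\<close>.\<close>

lemma wgrad_eq:
  assumes "c < agents E" "s \<in> S" "a \<in> A"
  shows "wgrad c full_weight \<theta> (s, a)
    = dvisit c (softmax E \<theta>) s * P \<theta> s a * (Q c \<theta> s a - V c \<theta> s)"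
proof -
  let ?e = "\<lambda>y. of_bool (y = (s, a)) :: real"
  let ?D = "dvisit c (softmax E \<theta>)"
  have sc: "score E \<theta> ?e (s', b) = (if s' = s then of_bool (a = b) - P \<theta> s a else 0)" if "s' \<in> S" "b \<in> A" for s' b
    unfolding score_def using dot_indicator[OF finite_X, of "(s, a)" "grad_log_policy E \<theta> (s', b)"] that assms
    by (subst dot_commute) (simp add: grad_log_eq)
  have "wgrad c full_weight \<theta> (s, a) = dot X ?e (wgrad c full_weight \<theta>)"
    using dot_indicator[OF finite_X, of "(s, a)" "wgrad c full_weight \<theta>"] assms by (simp add: dot_commute)
  also have "\<dots> = (\<Sum>s'\<in>S. if s' = s then (\<Sum>b\<in>A. P \<theta> s b * (of_bool (a = b) - P \<theta> s a) * (?D s * Q c \<theta> s b)) else 0)"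
    unfolding dot_wgrad_occupancy[OF assms(1)]
    by (intro sum.cong refl) (auto simp: sc intro!: sum.cong)
  also have "\<dots> = (\<Sum>b\<in>A. P \<theta> s b * (of_bool (a = b) - P \<theta> s a) * (?D s * Q c \<theta> s b))"
    using assms by simp
  also have "\<dots> = (\<Sum>b\<in>A. of_bool (a = b) * (P \<theta> s b * (?D s * Q c \<theta> s b))) - P \<theta> s a * ?D s * V c \<theta> s"
    unfolding V_def sum_distrib_left sum_subtractf[symmetric] by (intro sum.cong) (simp_all add: algebra_simps)
  also have "(\<Sum>b\<in>A. of_bool (a = b) * (P \<theta> s b * (?D s * Q c \<theta> s b))) = P \<theta> s a * (?D s * Q c \<theta> s a)"
    using assms by (simp add: of_bool_def if_distrib if_distribR cong: if_cong)
  finally show ?thesis by (simp add: algebra_simps)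
qed

section \<open>Performance difference and gradient domination\<close>

lemma admissible_det: "(\<forall>s\<in>S. d s \<in> A) \<Longrightarrow> admissible (det_policy d)"
  by (simp add: admissible_def det_policy_def)

lemma sum_det_policy: "d s \<in> A \<Longrightarrow> (\<Sum>a\<in>A. pmf (det_policy d s) a * f a) = f (d s)"
  by (simp add: det_policy_def indicator_def of_bool_def if_distrib if_distribR cong: if_cong)

text \<open>\<open>W t\<close> is the softmax value averaged over the states that the deterministic
  policy visits at time \<open>t\<close>. By the Bellman equation the averaged advantage is the
  reward plus \<open>\<gamma> * W (Suc t) - W t\<close>; the discounted sum telescopes and leaves
  \<open>- W 0\<close>, which is minus the softmax return.\<close>

lemma performance_difference:
  assumes c: "c < agents E" and d: "\<forall>s\<in>S. d s \<in> A"
  shows "policy_return E c (det_policy d) - Jc E c \<theta>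
    = (\<Sum>s\<in>S. dvisit c (det_policy d) s * (Q c \<theta> s (d s) - V c \<theta> s))"
proof -
  note adm = admissible_det[OF d]
  let ?v = "visit c (det_policy d)" and ?adv = "\<lambda>s. Q c \<theta> s (d s) - V c \<theta> s"
  define W where "W t = (\<Sum>s\<in>S. ?v t s * V c \<theta> s)" for t
  define R where "R t = expect (sa_law c (det_policy d) t) (\<lambda>y. reward E c (fst y) (snd y))" for t
  have R: "R t = (\<Sum>s\<in>S. ?v t s * reward E c s (d s))" for t
    unfolding R_def expectation_sa_law[OF adm c]
    using d by (intro sum.cong refl) (simp add: sum_det_policy[where f="\<lambda>a. reward E c _ a"])
  have step: "W (Suc t) = (\<Sum>s\<in>S. ?v t s * (\<Sum>s'\<in>S. pmf (kernel E c s (d s)) s' * V c \<theta> s'))" for t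
    unfolding W_def visit_Suc_avg using d
    by (intro sum.cong refl) (simp add: sum_det_policy[where f="\<lambda>a. \<Sum>s'\<in>S. pmf (kernel E c _ a) s' * V c \<theta> s'"])
  have sumQ: "(\<Sum>s\<in>S. ?v t s * ?adv s) = R t + (\<gamma> * W (Suc t) - W t)" for t
  proof -
    have "(\<Sum>s\<in>S. ?v t s * ?adv s)
        = (\<Sum>s\<in>S. ?v t s * reward E c s (d s) + \<gamma> * (?v t s * (\<Sum>s'\<in>S. pmf (kernel E c s (d s)) s' * V c \<theta> s')) - ?v t s * V c \<theta> s)"
      using d by (intro sum.cong refl) (simp add: Q_Bellman[OF c] algebra_simps)
    then show ?thesis
      by (simp add: R step sum.distrib sum_subtractf W_def[of t] flip: sum_distrib_left)
  qed
  have absW: "\<bar>W t\<bar> \<le> (\<Sum>s\<in>S. \<bar>V c \<theta> s\<bar>)" for t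
    unfolding W_def using abs_visit_le[OF adm c]
    by (intro order_trans[OF sum_abs] sum_mono) (simp add: abs_mult mult_left_le_one_le)
  have absR: "\<bar>R t\<bar> \<le> (\<Sum>s\<in>S. \<bar>reward E c s (d s)\<bar>)" for t
    unfolding R using abs_visit_le[OF adm c]
    by (intro order_trans[OF sum_abs] sum_mono) (simp add: abs_mult mult_left_le_one_le)
  have "(\<lambda>t. \<gamma> ^ t * W t) \<longlonglongrightarrow> 0"
    by (rule summable_LIMSEQ_zero) (rule summable_discounted(1)[OF absW])
  from telescope_sums[OF this]
  have "(\<lambda>t. \<gamma> ^ Suc t * W (Suc t) - \<gamma> ^ t * W t) sums (- W 0)" by simp
  from sums_add[OF summable_sums[OF summable_discounted(1)[OF absR]] this]
  have 1: "(\<lambda>t. \<gamma> ^ t * R t + (\<gamma> ^ Suc t * W (Suc t) - \<gamma> ^ t * W t)) sums ((\<Sum>t. \<gamma> ^ t * R t) - W 0)" by simp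
  have "(\<lambda>t. \<Sum>s\<in>S. \<gamma> ^ t * ?v t s * ?adv s)
      sums (\<Sum>s\<in>S. dvisit c (det_policy d) s * ?adv s)"
    unfolding dvisit_def by (intro sums_sum sums_mult2 summable_sums summable_visit(1)[OF adm c])
  moreover have "(\<Sum>s\<in>S. \<gamma> ^ t * ?v t s * ?adv s) = \<gamma> ^ t * R t + (\<gamma> ^ Suc t * W (Suc t) - \<gamma> ^ t * W t)" for t
  proof -
    have "(\<Sum>s\<in>S. \<gamma> ^ t * ?v t s * ?adv s) = \<gamma> ^ t * (\<Sum>s\<in>S. ?v t s * ?adv s)"
      by (simp add: sum_distrib_left mult.assoc)
    then show ?thesis unfolding sumQ by (simp add: algebra_simps)
  qed
  ultimately have "(\<lambda>t. \<gamma> ^ t * R t + (\<gamma> ^ Suc t * W (Suc t) - \<gamma> ^ t * W t))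
      sums (\<Sum>s\<in>S. dvisit c (det_policy d) s * ?adv s)" by simp
  from sums_unique2[OF 1 this] show ?thesis
    by (simp add: policy_return_eq[OF adm c] R_def Jc_V[OF c] W_def)
qed

lemma Jc_le_optimal: "c < agents E \<Longrightarrow> optimal_det E c d \<Longrightarrow> Jc E c \<theta> \<le> policy_return E c (det_policy d)"
  using admissible_softmax[of \<theta>] by (auto simp: optimal_det_def Jc_def admissible_def)

lemma Jc_le_star:
  assumes "c < agents E"
  shows "Jc E c \<theta> \<le> Jc_star E c"
  unfolding Jc_star_def using Jc_bounds(2)[OF assms] by (intro cSUP_upper bdd_aboveI2) auto

lemma mu_agent_nonneg: "0 \<le> mu_agent E c d \<theta>"
proof -
  have "0 \<le> Min ((\<lambda>s. (P \<theta> s (d s))\<^sup>2) ` S)"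
    by (subst Min_ge_iff) auto
  then show ?thesis by (simp add: mu_agent_def power_int_def)
qed

text \<open>The gap is a sum of advantages over the occupancy of the optimal policy. Passing to the
  softmax occupancy costs the ratio \<open>\<rho>\<close>, passing from an advantage to the gradient
  coordinate at \<open>(s, d s)\<close> costs \<open>sqrt m\<close>, and Cauchy-Schwarz over the
  states costs \<open>card S\<close>. Absolute values are taken before the occupancy is changed,
  since an advantage may be negative.\<close>

lemma gradient_domination:
  assumes c: "c < agents E" and opt: "optimal_det E c d" and pos: "\<And>s. s \<in> S \<Longrightarrow> 0 < pmf (init E) s"
  shows "2 * mu_agent E c d \<theta> * (Jc_star E c - Jc E c \<theta>)\<^sup>2 \<le> (N (wgrad c full_weight \<theta>))\<^sup>2"
proof -
  have d: "\<forall>s\<in>S. d s \<in> A" using opt by (simp add: optimal_det_def)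
  let ?D = "dvisit c (softmax E \<theta>)" and ?D' = "dvisit c (det_policy d)"
  let ?g = "wgrad c full_weight \<theta>"
  define m where "m = Min ((\<lambda>s. (P \<theta> s (d s))\<^sup>2) ` S)"
  define \<rho> where "\<rho> = Max ((\<lambda>s. occupancy E c (det_policy d) s / occupancy E c (softmax E \<theta>) s) ` S)"
  have m_pos: "0 < m"
  proof -
    have "P \<theta> s (d s) \<noteq> 0" if "s \<in> S" for s
      using P_pos[of "d s" \<theta> s] d that by force
    then show ?thesis unfolding m_def by (subst Min_gr_iff) auto
  qed
  have m_le: "sqrt m \<le> P \<theta> s (d s)" if "s \<in> S" for s
    unfolding m_def by (rule real_le_lsqrt) (use that in auto)
  have Dpos: "0 < ?D s" if "s \<in> S" for s
    using dvisit_ge[OF admissible_softmax c that, of \<theta>] pos[OF that] by linarith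
  have D'nonneg: "0 \<le> ?D' s" if "s \<in> S" for s
    using dvisit_ge[OF admissible_det[OF d] c that] pos[OF that] by linarith
  have ratio: "?D' s \<le> \<rho> * ?D s" if "s \<in> S" for s
  proof -
    have "occupancy E c (det_policy d) s / occupancy E c (softmax E \<theta>) s \<le> \<rho>"
      unfolding \<rho>_def using that by (intro Max_ge) auto
    then have "?D' s / ?D s \<le> \<rho>"
      using \<gamma>_less by (simp add: occupancy_eq[OF admissible_det[OF d] c that] occupancy_eq[OF admissible_softmax c that])
    then show ?thesis using Dpos[OF that] by (simp add: divide_simps)
  qed
  have \<rho>_nonneg: "0 \<le> \<rho>"
  proof -
    obtain s where s: "s \<in> S" using S_ne by blast
    have "0 \<le> \<rho> * ?D s" using ratio[OF s] D'nonneg[OF s] by linarith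
    then show ?thesis using Dpos[OF s] by (simp add: zero_le_mult_iff)
  qed
  have gs: "sqrt m * (?D s * \<bar>Q c \<theta> s (d s) - V c \<theta> s\<bar>) \<le> \<bar>?g (s, d s)\<bar>" if s: "s \<in> S" for s
  proof -
    have "\<bar>?g (s, d s)\<bar> = P \<theta> s (d s) * (?D s * \<bar>Q c \<theta> s (d s) - V c \<theta> s\<bar>)"
      using wgrad_eq[OF c s, of "d s" \<theta>] d s Dpos[OF s] by (simp add: abs_mult)
    then show ?thesis
      using m_le[OF s] Dpos[OF s] by (simp add: mult_right_mono)
  qed
  have norm1: "(\<Sum>s\<in>S. \<bar>?g (s, d s)\<bar>) \<le> sqrt (real (card S)) * N ?g"
  proof -
    have "(\<Sum>s\<in>S. \<bar>1\<bar> * \<bar>?g (s, d s)\<bar>) \<le> L2_set (\<lambda>_. 1) S * L2_set (\<lambda>s. ?g (s, d s)) S"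
      by (rule L2_set_mult_ineq)
    moreover have "L2_set (\<lambda>s. ?g (s, d s)) S \<le> N ?g"
      unfolding L2_set_def sum_X using d
      by (intro real_sqrt_le_mono sum_mono member_le_sum[of "d _" A "\<lambda>a. (?g (_, a))\<^sup>2"]) auto
    moreover have "L2_set (\<lambda>_. 1) S = sqrt (real (card S))"
      by (simp add: L2_set_def)
    ultimately show ?thesis
      using mult_left_mono[of "L2_set (\<lambda>s. ?g (s, d s)) S" "N ?g" "sqrt (real (card S))"] by simp
  qed
  have star: "Jc_star E c \<le> policy_return E c (det_policy d)"
    unfolding Jc_star_def by (intro cSUP_least Jc_le_optimal c opt) simp
  have "sqrt m * (Jc_star E c - Jc E c \<theta>) \<le> sqrt m * (policy_return E c (det_policy d) - Jc E c \<theta>)"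
    using star m_pos by (intro mult_left_mono) auto
  also have "\<dots> = (\<Sum>s\<in>S. sqrt m * (?D' s * (Q c \<theta> s (d s) - V c \<theta> s)))"
    unfolding performance_difference[OF c d] sum_distrib_left ..
  also have "\<dots> \<le> (\<Sum>s\<in>S. sqrt m * (\<rho> * ?D s * \<bar>Q c \<theta> s (d s) - V c \<theta> s\<bar>))"
  proof (intro sum_mono mult_left_mono)
    fix s assume s: "s \<in> S"
    have "?D' s * (Q c \<theta> s (d s) - V c \<theta> s) \<le> ?D' s * \<bar>Q c \<theta> s (d s) - V c \<theta> s\<bar>"
      using D'nonneg[OF s] by (intro mult_left_mono) auto
    also have "\<dots> \<le> \<rho> * ?D s * \<bar>Q c \<theta> s (d s) - V c \<theta> s\<bar>"
      using ratio[OF s] by (intro mult_right_mono) auto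
    finally show "?D' s * (Q c \<theta> s (d s) - V c \<theta> s) \<le> \<rho> * ?D s * \<bar>Q c \<theta> s (d s) - V c \<theta> s\<bar>" .
  qed (use m_pos in auto)
  also have "\<dots> = \<rho> * (\<Sum>s\<in>S. sqrt m * (?D s * \<bar>Q c \<theta> s (d s) - V c \<theta> s\<bar>))"
    by (simp add: sum_distrib_left mult_ac)
  also have "\<dots> \<le> \<rho> * (\<Sum>s\<in>S. \<bar>?g (s, d s)\<bar>)"
    using gs \<rho>_nonneg by (intro mult_left_mono sum_mono) auto
  also have "\<dots> \<le> \<rho> * (sqrt (real (card S)) * N ?g)"
    using norm1 \<rho>_nonneg by (intro mult_left_mono) auto
  finally have "(sqrt m * (Jc_star E c - Jc E c \<theta>))\<^sup>2 \<le> (\<rho> * (sqrt (real (card S)) * N ?g))\<^sup>2"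
    using Jc_le_star[OF c, of \<theta>] m_pos by (intro power_mono) auto
  then have main: "m * (Jc_star E c - Jc E c \<theta>)\<^sup>2 \<le> \<rho>\<^sup>2 * real (card S) * (N ?g)\<^sup>2"
    using m_pos by (simp add: power_mult_distrib)
  \<comment> \<open>This also holds for \<open>\<rho> = 0\<close>: inversion of zero gives zero, so
    \<open>mu_agent\<close> vanishes and the claim becomes trivial.\<close>
  have mu: "2 * mu_agent E c d \<theta> = m / (real (card S) * \<rho>\<^sup>2)"
    by (simp add: mu_agent_def m_def[symmetric] \<rho>_def[symmetric] power_int_def divide_simps)
  show ?thesis
  proof (cases "\<rho> = 0")
    case False
    moreover have "0 < real (card S)" by (simp add: card_gt_0_iff)
    ultimately have "0 < real (card S) * \<rho>\<^sup>2" by simp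
    then show ?thesis
      unfolding mu using main by (simp add: divide_simps mult_ac)
  qed (simp add: mu)
qed


section \<open>One communication round\<close>

definition traj_est :: "nat \<Rightarrow> nat \<Rightarrow> param \<Rightarrow> (nat \<times> nat) list \<Rightarrow> param" where
  "traj_est c T \<theta> \<tau> x = (\<Sum>t<T. \<gamma> ^ t * (\<Sum>l\<le>t. grad_log_policy E \<theta> (\<tau> ! l) x) * path_reward E c t \<tau>)"

text \<open>Each summand is rewritten to depend on the first \<open>Suc t\<close> pairs only. The
  law of this prefix is the shorter trajectory law used in \<open>grad_reward\<close>, so the mean
  can be read off term by term.\<close>

lemma traj_est_eq:
  assumes "\<tau> \<in> paths E T"
  shows "traj_est c T \<theta> \<tau> x
    = (\<Sum>t<T. \<gamma> ^ t * (path_grad \<theta> (take (Suc t) \<tau>) x * path_reward E c t (take (Suc t) \<tau>)))"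
  unfolding traj_est_def
proof (intro sum.cong refl)
  fix t assume t: "t \<in> {..<T}"
  have len: "length \<tau> = T" using assms by (simp add: paths_def)
  have "path_grad \<theta> (take (Suc t) \<tau>) x = (\<Sum>l\<le>t. grad_log_policy E \<theta> (\<tau> ! l) x)"
    unfolding path_grad_def sum_list_sum_nth using t len
    by (intro sum.cong) auto
  moreover have "path_reward E c t (take (Suc t) \<tau>) = path_reward E c t \<tau>"
    by (simp add: path_reward_def)
  ultimately show "\<gamma> ^ t * (\<Sum>l\<le>t. grad_log_policy E \<theta> (\<tau> ! l) x) * path_reward E c t \<tau>
      = \<gamma> ^ t * (path_grad \<theta> (take (Suc t) \<tau>) x * path_reward E c t (take (Suc t) \<tau>))"
    by simp
qed

lemma pmean_traj_est:
  assumes c: "c < agents E"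
  shows "pmean (traj E c (softmax E \<theta>) T) (traj_est c T \<theta>) = wgrad c (trunc_weight T) \<theta>"
proof
  fix x
  let ?p = "traj E c (softmax E \<theta>)"
  let ?F = "\<lambda>t \<tau>. path_grad \<theta> \<tau> x * path_reward E c t \<tau>"
  note [simp] = integrable_measure_pmf_finite[OF finite_traj[OF c]]
  have "pmean (?p T) (traj_est c T \<theta>) x
      = expect (?p T) (\<lambda>\<tau>. \<Sum>t<T. \<gamma> ^ t * ?F t (take (Suc t) \<tau>))"
    unfolding pmean_def using set_traj[OF c] by (intro expectation_cong_pmf) (simp add: traj_est_eq subset_iff)
  also have "\<dots> = (\<Sum>t<T. \<gamma> ^ t * expect (?p T) (\<lambda>\<tau>. ?F t (take (Suc t) \<tau>)))"
    by (simp add: Bochner_Integration.integral_sum)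
  also have "\<dots> = (\<Sum>t<T. \<gamma> ^ t * grad_reward c t \<theta> x)"
  proof (intro sum.cong refl)
    fix t assume "t \<in> {..<T}"
    then have "expect (?p T) (\<lambda>\<tau>. ?F t (take (Suc t) \<tau>)) = expect (?p (Suc t)) (?F t)"
      using take_traj[of "Suc t" T E c "softmax E \<theta>"] integral_map_pmf[of "take (Suc t)" "?p T" "?F t"] by simp
    then show "\<gamma> ^ t * expect (?p T) (\<lambda>\<tau>. ?F t (take (Suc t) \<tau>)) = \<gamma> ^ t * grad_reward c t \<theta> x"
      by (simp add: grad_reward_def path_avg_eq[OF c])
  qed
  also have "\<dots> = wgrad c (trunc_weight T) \<theta> x"
    unfolding wgrad_def wsum_def by (subst suminf_finite[of "{..<T}"]) (auto simp: trunc_weight_def)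
  finally show "pmean (?p T) (traj_est c T \<theta>) x = wgrad c (trunc_weight T) \<theta> x" .
qed

lemma L2_path_grad_le:
  assumes "\<tau> \<in> paths E n"
  shows "N (path_grad \<theta> \<tau>) \<le> 2 * real n"
proof (rule L2_set_le_if_dot_le)
  fix v
  show "dot X (path_grad \<theta> \<tau>) v \<le> 2 * real n * N v"
    using abs_path_score_le[OF assms, of \<theta> v] by (simp add: dot_commute[of X _ v] dot_path_grad)
qed simp

lemma L2_traj_est_le:
  assumes c: "c < agents E" and \<tau>: "\<tau> \<in> paths E T"
  shows "N (traj_est c T \<theta> \<tau>) \<le> 2 / (1 - \<gamma>)\<^sup>2"
proof -
  have "N (traj_est c T \<theta> \<tau>) \<le> (\<Sum>t<T. N (\<lambda>x. \<gamma> ^ t * path_reward E c t (take (Suc t) \<tau>) * path_grad \<theta> (take (Suc t) \<tau>) x))"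
    using L2_set_sum[where I="{..<T}" and X=X and u="\<lambda>t x. \<gamma> ^ t * path_reward E c t (take (Suc t) \<tau>) * path_grad \<theta> (take (Suc t) \<tau>) x"]
    by (simp add: traj_est_eq[OF \<tau>] mult_ac cong: L2_set_cong)
  also have "\<dots> \<le> (\<Sum>t<T. \<gamma> ^ t * (2 * (real t + 1)))"
  proof (intro sum_mono)
    fix t assume t: "t \<in> {..<T}"
    then have p: "take (Suc t) \<tau> \<in> paths E (Suc t)"
      using \<tau> set_take_subset[of "Suc t" \<tau>] by (auto simp: paths_def)
    have "\<bar>path_reward E c t (take (Suc t) \<tau>)\<bar> * N (path_grad \<theta> (take (Suc t) \<tau>)) \<le> 1 * (2 * real (Suc t))"
      using path_reward_bounds[OF c p, of t] L2_path_grad_le[OF p] by (intro mult_mono) (auto simp: L2_set_nonneg)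
    then have "\<gamma> ^ t * (\<bar>path_reward E c t (take (Suc t) \<tau>)\<bar> * N (path_grad \<theta> (take (Suc t) \<tau>))) \<le> \<gamma> ^ t * (2 * (real t + 1))"
      using \<gamma>_pos by (intro mult_left_mono) auto
    then show "N (\<lambda>x. \<gamma> ^ t * path_reward E c t (take (Suc t) \<tau>) * path_grad \<theta> (take (Suc t) \<tau>) x) \<le> \<gamma> ^ t * (2 * (real t + 1))"
      using \<gamma>_pos by (simp add: L2_set_scale abs_mult)
  qed
  also have "\<dots> = 2 * (\<Sum>t<T. \<gamma> ^ t * (real t + 1))"
    unfolding sum_distrib_left by (intro sum.cong) (simp_all add: algebra_simps)
  also have "\<dots> \<le> 2 * (1 / (1 - \<gamma>)\<^sup>2)"
    unfolding suminf_power_weight1[OF \<gamma>_pos \<gamma>_less, symmetric] using \<gamma>_pos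
    by (intro mult_left_mono sum_le_suminf summable_power_weights(1) \<gamma>_pos \<gamma>_less) auto
  finally show ?thesis by simp
qed

text \<open>Every trajectory estimate has norm at most \<open>2 / (1 - \<gamma>) ^ 2\<close>. Its
  square bounds the variance of one trajectory, and a batch of \<open>B\<close> independent ones
  divides this by \<open>B\<close>.\<close>

definition noise :: "nat \<Rightarrow> real" where
  "noise B = 4 / ((1 - \<gamma>) ^ 4 * real B)"

lemma finite_batch: "c < agents E \<Longrightarrow> finite (set_pmf (batch_pmf E T B c \<theta>))"
  unfolding batch_pmf_def traj_def[symmetric] by (intro finite_set_Pi_pmf finite_traj) auto

lemma grad_est_eq: "grad_est E T B c z \<theta> = (\<lambda>x. 1 / real B * (\<Sum>b<B. traj_est c T \<theta> (z b) x))"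
  by (simp add: grad_est_def traj_est_def path_reward_def)

lemma pmean_grad_est:
  assumes c: "c < agents E" and B: "1 \<le> B"
  shows "pmean (batch_pmf E T B c \<theta>) (\<lambda>z. grad_est E T B c z \<theta>) = wgrad c (trunc_weight T) \<theta>"
proof
  fix x
  have "pmean (batch_pmf E T B c \<theta>) (\<lambda>z. grad_est E T B c z \<theta>) x
      = 1 / real B * pmean (batch_pmf E T B c \<theta>) (\<lambda>z x. \<Sum>b<B. traj_est c T \<theta> (z b) x) x"
    by (simp add: pmean_def grad_est_eq)
  also have "\<dots> = 1 / real B * (\<Sum>b<B. pmean (traj E c (softmax E \<theta>) T) (traj_est c T \<theta>) x)"
    unfolding batch_pmf_def traj_def[symmetric]
    using pmean_Pi_pmf_sum[where I="{..<B}" and p="\<lambda>_. traj E c (softmax E \<theta>) T" and f="\<lambda>_. traj_est c T \<theta>"]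
      finite_traj[OF c] by simp
  finally show "pmean (batch_pmf E T B c \<theta>) (\<lambda>z. grad_est E T B c z \<theta>) x = wgrad c (trunc_weight T) \<theta> x"
    using B by (simp add: pmean_traj_est[OF c])
qed

lemma pvar_grad_est:
  assumes c: "c < agents E" and B: "1 \<le> B"
  shows "pvar X (batch_pmf E T B c \<theta>) (\<lambda>z. grad_est E T B c z \<theta>) \<le> noise B"
proof -
  let ?p = "traj E c (softmax E \<theta>) T"
  have "pvar X ?p (traj_est c T \<theta>) \<le> expect ?p (\<lambda>\<tau>. (N (\<lambda>x. traj_est c T \<theta> \<tau> x - 0))\<^sup>2)"
    by (rule pvar_le[OF finite_traj[OF c]])
  also have "\<dots> \<le> expect ?p (\<lambda>\<tau>. (2 / (1 - \<gamma>)\<^sup>2)\<^sup>2)"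
    using subsetD[OF set_traj[OF c]]
    by (intro expectation_mono_pmf_finite finite_traj c power_mono) (auto simp: L2_set_nonneg intro!: L2_traj_est_le[OF c])
  finally have 1: "pvar X ?p (traj_est c T \<theta>) \<le> 4 / (1 - \<gamma>) ^ 4"
    by (simp add: power_divide flip: power_mult)
  have "pvar X (batch_pmf E T B c \<theta>) (\<lambda>z. grad_est E T B c z \<theta>)
      = (1 / real B)\<^sup>2 * (\<Sum>b<B. pvar X ?p (traj_est c T \<theta>))"
    unfolding grad_est_eq pvar_scale batch_pmf_def traj_def[symmetric]
    using pvar_Pi_pmf_sum[where I="{..<B}" and p="\<lambda>_. ?p" and f="\<lambda>_. traj_est c T \<theta>" and X=X] finite_traj[OF c]
    by simp
  also have "\<dots> \<le> (1 / real B)\<^sup>2 * (\<Sum>b<B. 4 / (1 - \<gamma>) ^ 4)"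
    using 1 by (intro mult_left_mono sum_mono) auto
  also have "\<dots> = noise B"
    using B by (simp add: noise_def power2_eq_square)
  finally show ?thesis .
qed

section \<open>Local iterations of a single agent\<close>

lemma finite_local_step: "c < agents E \<Longrightarrow> finite (set_pmf (local_step E T B \<eta> c \<theta>))"
  by (simp add: local_step_def finite_batch)

lemma pmean_local_step:
  assumes c: "c < agents E" and B: "1 \<le> B"
  shows "pmean (local_step E T B \<eta> c \<theta>) (\<lambda>z. z) = (\<lambda>x. \<theta> x + \<eta> * wgrad c (trunc_weight T) \<theta> x)"
  unfolding local_step_def pmean_map pmean_grad_est[OF c B, symmetric]
  by (rule ext) (simp add: pmean_def integrable_measure_pmf_finite[OF finite_batch[OF c]])

lemma pvar_local_step:
  assumes c: "c < agents E" and B: "1 \<le> B"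
  shows "pvar X (local_step E T B \<eta> c \<theta>) (\<lambda>z. z) \<le> \<eta>\<^sup>2 * noise B"
  unfolding local_step_def pvar_map pvar_add_const[OF finite_batch[OF c]] pvar_scale
  by (intro mult_left_mono pvar_grad_est c B) simp

lemma finite_local_iter: "c < agents E \<Longrightarrow> finite (set_pmf (local_iter E T B \<eta> c h \<theta>))"
  by (induction h) (auto simp: finite_local_step)

definition smoothness :: real where
  "smoothness = 16 / (1 - \<gamma>) ^ 3"

lemma smoothness_pos: "0 < smoothness"
  using \<gamma>_less by (simp add: smoothness_def)

lemma noise_nonneg: "0 \<le> noise B"
  by (simp add: noise_def)

lemma pmean_local_iter_Suc:
  assumes c: "c < agents E" and B: "1 \<le> B"
  shows "pmean (local_iter E T B \<eta> c (Suc h) \<theta>) (\<lambda>z. z) x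
    = pmean (local_iter E T B \<eta> c h \<theta>) (\<lambda>z. z) x + \<eta> * pmean (local_iter E T B \<eta> c h \<theta>) (wgrad c (trunc_weight T)) x"
proof -
  let ?q = "local_iter E T B \<eta> c h \<theta>"
  note [simp] = integrable_measure_pmf_finite[OF finite_local_iter[OF c]]
  have "pmean (local_iter E T B \<eta> c (Suc h) \<theta>) (\<lambda>z. z) x
      = expect ?q (\<lambda>\<theta>'. pmean (local_step E T B \<eta> c \<theta>') (\<lambda>z. z) x)"
    unfolding pmean_def using finite_local_iter[OF c] finite_local_step[OF c]
    by (simp add: expectation_bind_pmf_finite)
  then show ?thesis
    by (simp add: pmean_local_step[OF c B] pmean_def)
qed

text \<open>Given the current iterate, the fresh batch adds \<open>\<eta> ^ 2 * noise B\<close> and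
  the expected step stretches the deviation already present. The objective is not concave, so a
  stretch factor above 1 has to be allowed.\<close>

lemma pvar_local_iter_Suc:
  assumes c: "c < agents E" and B: "1 \<le> B" and \<eta>: "0 < \<eta>"
  shows "pvar X (local_iter E T B \<eta> c (Suc h) \<theta>) (\<lambda>z. z)
    \<le> (1 + \<eta> * smoothness)\<^sup>2 * pvar X (local_iter E T B \<eta> c h \<theta>) (\<lambda>z. z) + \<eta>\<^sup>2 * noise B"
proof -
  let ?q = "local_iter E T B \<eta> c h \<theta>" and ?G = "wgrad c (trunc_weight T)"
  let ?k = "local_step E T B \<eta> c"
  note fq = finite_local_iter[OF c, of T B \<eta> h \<theta>]
  note [simp] = integrable_measure_pmf_finite[OF fq]
  let ?m = "pmean ?q (\<lambda>z. z)"
  \<comment> \<open>The deterministic gradient step from the old mean, in place of the new mean: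
    \<open>pvar_le\<close> admits any reference point, and relative to this one the Lipschitz bound
    of the gradient applies directly.\<close>
  let ?a = "\<lambda>x. ?m x + \<eta> * ?G ?m x"
  have "pvar X (local_iter E T B \<eta> c (Suc h) \<theta>) (\<lambda>z. z)
      \<le> expect (local_iter E T B \<eta> c (Suc h) \<theta>) (\<lambda>\<theta>'. (N (\<lambda>x. \<theta>' x - ?a x))\<^sup>2)"
    by (rule pvar_le[OF finite_local_iter[OF c]])
  also have "\<dots> = expect ?q (\<lambda>\<theta>'. expect (?k \<theta>') (\<lambda>\<theta>''. (N (\<lambda>x. \<theta>'' x - ?a x))\<^sup>2))"
    using fq finite_local_step[OF c] by (simp add: expectation_bind_pmf_finite)
  also have "\<dots> \<le> expect ?q (\<lambda>\<theta>'. \<eta>\<^sup>2 * noise B + (1 + \<eta> * smoothness)\<^sup>2 * (N (\<lambda>x. \<theta>' x - ?m x))\<^sup>2)"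
  proof (intro expectation_mono_pmf_finite fq)
    fix \<theta>'
    have "N (\<lambda>x. \<theta>' x + \<eta> * ?G \<theta>' x - ?a x)
        = N (\<lambda>x. (\<theta>' x - ?m x) + \<eta> * (?G \<theta>' x - ?G ?m x))"
      by (simp add: algebra_simps)
    also have "\<dots> \<le> N (\<lambda>x. \<theta>' x - ?m x) + \<eta> * N (\<lambda>x. ?G \<theta>' x - ?G ?m x)"
      using L2_set_triangle_ineq[of "\<lambda>x. \<theta>' x - ?m x" "\<lambda>x. \<eta> * (?G \<theta>' x - ?G ?m x)" X] \<eta>
      by (simp only: L2_set_scale)
    also have "\<dots> \<le> N (\<lambda>x. \<theta>' x - ?m x) + \<eta> * (smoothness * N (\<lambda>x. \<theta>' x - ?m x))"
      unfolding smoothness_def using \<eta> by (intro add_left_mono mult_left_mono wgrad_Lipschitz c weights_trunc) auto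
    also have "\<dots> = (1 + \<eta> * smoothness) * N (\<lambda>x. \<theta>' x - ?m x)"
      by (simp add: algebra_simps)
    finally have "(N (\<lambda>x. \<theta>' x + \<eta> * ?G \<theta>' x - ?a x))\<^sup>2 \<le> (1 + \<eta> * smoothness)\<^sup>2 * (N (\<lambda>x. \<theta>' x - ?m x))\<^sup>2"
      unfolding power_mult_distrib[symmetric] by (intro power_mono) (auto simp: L2_set_nonneg)
    then show "expect (?k \<theta>') (\<lambda>\<theta>''. (N (\<lambda>x. \<theta>'' x - ?a x))\<^sup>2)
        \<le> \<eta>\<^sup>2 * noise B + (1 + \<eta> * smoothness)\<^sup>2 * (N (\<lambda>x. \<theta>' x - ?m x))\<^sup>2"
      unfolding expectation_L2_set_diff[OF finite_local_step[OF c], where f="\<lambda>z. z"] pmean_local_step[OF c B]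
      using pvar_local_step[OF c B, of T \<eta> \<theta>'] by simp
  qed
  also have "\<dots> = (1 + \<eta> * smoothness)\<^sup>2 * pvar X ?q (\<lambda>z. z) + \<eta>\<^sup>2 * noise B"
    by (simp add: pvar_def)
  finally show ?thesis .
qed

definition drift :: "nat \<Rightarrow> real \<Rightarrow> nat \<Rightarrow> real" where
  "drift B \<eta> H = 2 * real H * \<eta>\<^sup>2 * noise B"

lemma pvar_local_iter:
  assumes c: "c < agents E" and B: "1 \<le> B" and \<eta>: "0 < \<eta>"
    and H: "\<eta> * real H * smoothness \<le> 1 / 16" and h: "h \<le> H"
  shows "pvar X (local_iter E T B \<eta> c h \<theta>) (\<lambda>z. z) \<le> drift B \<eta> H"
proof -
  define r where "r = (1 + \<eta> * smoothness)\<^sup>2"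
  have es: "0 \<le> \<eta> * smoothness" using \<eta> smoothness_pos by simp
  have r: "1 \<le> r" unfolding r_def by (rule one_le_power) (use es in simp)
  have "pvar X (local_iter E T B \<eta> c h \<theta>) (\<lambda>z. z) \<le> r ^ h * (real h * (\<eta>\<^sup>2 * noise B))"
  proof (induction h)
    case 0
    show ?case by (simp add: pvar_def pmean_def L2_set_def)
  next
    case (Suc h)
    have "pvar X (local_iter E T B \<eta> c (Suc h) \<theta>) (\<lambda>z. z)
        \<le> r * (r ^ h * (real h * (\<eta>\<^sup>2 * noise B))) + \<eta>\<^sup>2 * noise B"
      unfolding r_def
      by (rule order_trans[OF pvar_local_iter_Suc[OF c B \<eta>]])
        (intro add_right_mono mult_left_mono Suc[unfolded r_def], simp)
    also have "\<dots> \<le> r ^ Suc h * (real h * (\<eta>\<^sup>2 * noise B)) + r ^ Suc h * (\<eta>\<^sup>2 * noise B)"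
      using mult_right_mono[OF one_le_power[OF r, of "Suc h"], of "\<eta>\<^sup>2 * noise B"] by (simp add: noise_nonneg)
    finally show ?case by (simp add: algebra_simps)
  qed
  also have "\<dots> \<le> 2 * (real H * (\<eta>\<^sup>2 * noise B))"
  proof (intro mult_mono)
    have "r ^ h \<le> (exp (\<eta> * smoothness) ^ 2) ^ h"
      unfolding r_def using exp_ge_add_one_self[of "\<eta> * smoothness"] es by (intro power_mono) auto
    also have "\<dots> = exp (2 * (real h * (\<eta> * smoothness)))"
      by (simp add: power_mult[symmetric] exp_of_nat_mult[symmetric] mult_ac)
    also have "\<dots> \<le> exp (1 / 8)"
      using H mult_right_mono[of "real h" "real H" "\<eta> * smoothness"] h es by (simp add: mult_ac)
    also have "\<dots> \<le> 2"
      using exp_bound[of "1/8"] by (simp add: power2_eq_square)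
    finally show "r ^ h \<le> 2" .
  qed (use h in \<open>auto simp: noise_nonneg mult_right_mono\<close>)
  finally show ?thesis by (simp add: drift_def mult_ac)
qed

definition bias :: "nat \<Rightarrow> real \<Rightarrow> nat \<Rightarrow> real" where
  "bias B \<eta> H = 120 / (1 - \<gamma>) ^ 4 * drift B \<eta> H"

lemma bias_nonneg: "0 \<le> bias B \<eta> H"
  by (simp add: drift_def bias_def noise_nonneg)

text \<open>
  Since the fluctuation of the local iterate around its mean is centred, the linear term of the
  gradient averages out and only the second-order remainder, proportional to the variance, is
  left. This is what lets the drift error scale with the step size and not with its square root.
\<close>

lemma local_iter_mean_gradient:
  fixes \<theta> :: param and T :: nat
  assumes c: "c < agents E" and B: "1 \<le> B" and \<eta>: "0 < \<eta>"
    and H: "\<eta> * real H * smoothness \<le> 1 / 16"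
  defines "q \<equiv> \<lambda>h. local_iter E T B \<eta> c h \<theta>" and "G \<equiv> wgrad c (trunc_weight T)"
  assumes h: "h \<le> H"
  shows "N (\<lambda>x. pmean (q h) G x - G \<theta> x) \<le> bias B \<eta> H + (N (G \<theta>) + bias B \<eta> H) / 8"
proof -
  let ?b = "N (G \<theta>) + bias B \<eta> H"
  let ?m = "\<lambda>h. pmean (q h) (\<lambda>z. z)"
  have b: "0 \<le> ?b" by (simp add: L2_set_nonneg bias_nonneg)
  have es: "0 \<le> \<eta> * smoothness" using \<eta> smoothness_pos by simp
  have B1: "N (\<lambda>x. pmean (q h) G x - G (?m h) x) \<le> bias B \<eta> H" if "h \<le> H" for h
  proof -
    have "N (\<lambda>x. pmean (q h) G x - G (?m h) x) \<le> 120 / (1 - \<gamma>) ^ 4 * pvar X (q h) (\<lambda>z. z)"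
      unfolding q_def G_def by (rule wgrad_pmean_bound[OF c weights_trunc finite_local_iter[OF c]])
    also have "\<dots> \<le> bias B \<eta> H"
      unfolding bias_def q_def by (intro mult_left_mono pvar_local_iter[OF c B \<eta> H that]) simp
    finally show ?thesis .
  qed
  have lip: "N (\<lambda>x. G (?m h) x - G \<theta> x) \<le> smoothness * N (\<lambda>x. ?m h x - \<theta> x)" for h
    unfolding G_def smoothness_def by (rule wgrad_Lipschitz[OF c weights_trunc])
  have small: "smoothness * (2 * \<eta> * real h * ?b) \<le> ?b / 8" if "h \<le> H" for h
  proof -
    have "\<eta> * smoothness * real h \<le> \<eta> * smoothness * real H"
      using that es by (intro mult_left_mono) auto
    then have "2 * (\<eta> * smoothness * real h) \<le> 1 / 8" using H by (simp add: mult_ac)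
    from mult_right_mono[OF this b] show ?thesis by (simp add: mult_ac)
  qed
  \<comment> \<open>Displacement of the mean and size of its gradient control each other, so they
    are bounded together by induction. While the displacement obeys the bound, the gradient at the
    mean is within \<open>?b\<close> of \<open>G \<theta>\<close>, and the bias brings the mean
    gradient to at most \<open>2 * ?b\<close>, which is the rate claimed here.\<close>
  have D: "h \<le> H \<Longrightarrow> N (\<lambda>x. ?m h x - \<theta> x) \<le> 2 * \<eta> * real h * ?b" for h
  proof (induction h)
    case 0
    show ?case by (simp add: q_def pmean_def L2_set_def)
  next
    case (Suc h)
    then have IH: "N (\<lambda>x. ?m h x - \<theta> x) \<le> 2 * \<eta> * real h * ?b" and hH: "h \<le> H" by auto
    have "N (\<lambda>x. G (?m h) x - G \<theta> x) \<le> ?b"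
    proof -
      have "N (\<lambda>x. G (?m h) x - G \<theta> x) \<le> smoothness * (2 * \<eta> * real h * ?b)"
        using smoothness_pos by (intro order_trans[OF lip] mult_left_mono IH) auto
      also have "\<dots> \<le> ?b / 8" by (rule small[OF hH])
      also have "\<dots> \<le> ?b" using b by simp
      finally show ?thesis .
    qed
    then have "N (pmean (q h) G) \<le> 2 * ?b"
      using L2_set_le_diff[of "pmean (q h) G" X "G (?m h)"] L2_set_le_diff[of "G (?m h)" X "G \<theta>"] B1[OF hH]
      by argo
    then have "\<eta> * N (pmean (q h) G) \<le> \<eta> * (2 * ?b)" using \<eta> by (intro mult_left_mono) auto
    moreover have "N (\<lambda>x. ?m (Suc h) x - \<theta> x) \<le> N (\<lambda>x. ?m h x - \<theta> x) + \<eta> * N (pmean (q h) G)"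
    proof -
      have "(\<lambda>x. ?m (Suc h) x - \<theta> x) = (\<lambda>x. (?m h x - \<theta> x) + \<eta> * pmean (q h) G x)"
        unfolding q_def G_def pmean_local_iter_Suc[OF c B] by (simp add: algebra_simps)
      then show ?thesis
        using L2_set_triangle_ineq[of "\<lambda>x. ?m h x - \<theta> x" "\<lambda>x. \<eta> * pmean (q h) G x" X] \<eta>
        by (simp add: L2_set_scale)
    qed
    ultimately show ?case using IH by (simp add: algebra_simps)
  qed
  have "N (\<lambda>x. G (?m h) x - G \<theta> x) \<le> smoothness * (2 * \<eta> * real h * ?b)"
    using smoothness_pos by (intro order_trans[OF lip] mult_left_mono D h) auto
  then have "N (\<lambda>x. G (?m h) x - G \<theta> x) \<le> ?b / 8" using small[OF h] by linarith
  then show ?thesis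
    using L2_set_diff_triangle[of "pmean (q h) G" "G \<theta>" X "G (?m h)"] B1[OF h] by linarith
qed

lemma local_iter_mean:
  fixes \<theta> :: param and T :: nat
  assumes c: "c < agents E" and B: "1 \<le> B" and \<eta>: "0 < \<eta>"
    and H: "\<eta> * real H * smoothness \<le> 1 / 16"
  defines "G \<equiv> wgrad c (trunc_weight T)"
  shows "N (\<lambda>x. pmean (local_iter E T B \<eta> c H \<theta>) (\<lambda>z. z) x - \<theta> x - \<eta> * real H * G \<theta> x)
    \<le> \<eta> * real H * (bias B \<eta> H + (N (G \<theta>) + bias B \<eta> H) / 8)"
proof -
  let ?q = "\<lambda>h. local_iter E T B \<eta> c h \<theta>"
  have m: "pmean (?q k) (\<lambda>z. z) x - \<theta> x = \<eta> * (\<Sum>h<k. pmean (?q h) G x)" for k x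
  proof (induction k)
    case (Suc k)
    then show ?case unfolding pmean_local_iter_Suc[OF c B] by (simp add: G_def algebra_simps)
  qed (simp add: pmean_def)
  have "N (\<lambda>x. pmean (?q H) (\<lambda>z. z) x - \<theta> x - \<eta> * real H * G \<theta> x)
      = N (\<lambda>x. \<eta> * (\<Sum>h<H. pmean (?q h) G x - G \<theta> x))"
    unfolding m by (simp add: sum_subtractf algebra_simps)
  also have "\<dots> \<le> \<eta> * (\<Sum>h<H. N (\<lambda>x. pmean (?q h) G x - G \<theta> x))"
    unfolding L2_set_scale using \<eta>
    by (simp add: mult_left_mono L2_set_sum[where u="\<lambda>h x. pmean (?q h) G x - G \<theta> x"])
  also have "\<dots> \<le> \<eta> * (\<Sum>h<H. bias B \<eta> H + (N (G \<theta>) + bias B \<eta> H) / 8)"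
    unfolding G_def using \<eta> local_iter_mean_gradient[OF c B \<eta> H, of _ T \<theta>] by (intro mult_left_mono sum_mono) auto
  finally show ?thesis by (simp add: mult_ac)
qed

section \<open>Averaging over the agents\<close>

lemma finite_agents_pmf:
  "finite (set_pmf (Pi_pmf {..<agents E} d (\<lambda>c. local_iter E T B \<eta> c H \<theta>)))"
  by (intro finite_set_Pi_pmf finite_local_iter) auto

lemma finite_round: "finite (set_pmf (fedpg_round E T B \<eta> H \<theta>))"
  by (simp add: fedpg_round_def finite_agents_pmf)

lemma pmean_round:
  "pmean (fedpg_round E T B \<eta> H \<theta>) (\<lambda>z. z) x
    = 1 / real (agents E) * (\<Sum>c<agents E. pmean (local_iter E T B \<eta> c H \<theta>) (\<lambda>z. z) x)"
proof -
  let ?P = "Pi_pmf {..<agents E} (\<lambda>_. 0) (\<lambda>c. local_iter E T B \<eta> c H \<theta>)"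
  have "pmean (fedpg_round E T B \<eta> H \<theta>) (\<lambda>z. z) x = 1 / real (agents E) * pmean ?P (\<lambda>v x. \<Sum>c<agents E. v c x) x"
    unfolding fedpg_round_def pmean_map by (simp add: pmean_def)
  then show ?thesis
    using pmean_Pi_pmf_sum[where I="{..<agents E}" and p="\<lambda>c. local_iter E T B \<eta> c H \<theta>" and f="\<lambda>_ \<theta>. \<theta>"]
      finite_local_iter by simp
qed

lemma pvar_round:
  assumes B: "1 \<le> B" and \<eta>: "0 < \<eta>" and H: "\<eta> * real H * smoothness \<le> 1 / 16"
  shows "pvar X (fedpg_round E T B \<eta> H \<theta>) (\<lambda>z. z) \<le> drift B \<eta> H / real (agents E)"
proof -
  let ?M = "real (agents E)"
  have "pvar X (fedpg_round E T B \<eta> H \<theta>) (\<lambda>z. z)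
      = (1 / ?M)\<^sup>2 * (\<Sum>c<agents E. pvar X (local_iter E T B \<eta> c H \<theta>) (\<lambda>z. z))"
    unfolding fedpg_round_def pvar_map pvar_scale
    using pvar_Pi_pmf_sum[where I="{..<agents E}" and p="\<lambda>c. local_iter E T B \<eta> c H \<theta>" and f="\<lambda>_ \<theta>. \<theta>" and X=X]
      finite_local_iter by simp
  also have "\<dots> \<le> (1 / ?M)\<^sup>2 * (\<Sum>c<agents E. drift B \<eta> H)"
    using pvar_local_iter[OF _ B \<eta> H order_refl] by (intro mult_left_mono sum_mono) auto
  also have "\<dots> = drift B \<eta> H / ?M"
    using agents_pos by (simp add: power2_eq_square)
  finally show ?thesis .
qed

definition Jgrad :: "param \<Rightarrow> param" where
  "Jgrad \<theta> x = 1 / real (agents E) * (\<Sum>c<agents E. wgrad c full_weight \<theta> x)"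

lemma L2_avg_le:
  assumes "\<And>c. c < agents E \<Longrightarrow> N (f c) \<le> K"
  shows "N (\<lambda>x. 1 / real (agents E) * (\<Sum>c<agents E. f c x)) \<le> K"
proof -
  have "N (\<lambda>x. 1 / real (agents E) * (\<Sum>c<agents E. f c x)) \<le> 1 / real (agents E) * (\<Sum>c<agents E. N (f c))"
    unfolding L2_set_scale by (simp add: divide_right_mono L2_set_sum)
  also have "\<dots> \<le> 1 / real (agents E) * (\<Sum>c<agents E. K)"
    using assms by (intro mult_left_mono sum_mono) auto
  also have "\<dots> = K" using agents_pos by simp
  finally show ?thesis .
qed

definition hetero :: real where
  "hetero = 4 * eps_P E / (1 - \<gamma>) ^ 3 + 2 * eps_r E / (1 - \<gamma>)\<^sup>2"

definition trunc_err :: "nat \<Rightarrow> real" where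
  "trunc_err T = 4 * (\<gamma> ^ T * real T / (1 - \<gamma>))"

lemma hetero_nonneg: "0 \<le> hetero" and trunc_err_nonneg: "0 \<le> trunc_err T"
  using eps_nonneg \<gamma>_pos \<gamma>_less by (auto simp: hetero_def trunc_err_def)

lemma wgrad_Jgrad:
  assumes c: "c < agents E"
  shows "N (\<lambda>x. wgrad c full_weight \<theta> x - Jgrad \<theta> x) \<le> hetero"
proof -
  have "(\<lambda>x. wgrad c full_weight \<theta> x - Jgrad \<theta> x)
      = (\<lambda>x. 1 / real (agents E) * (\<Sum>c'<agents E. wgrad c full_weight \<theta> x - wgrad c' full_weight \<theta> x))"
    using agents_pos by (simp add: Jgrad_def sum_subtractf right_diff_distrib)
  then show ?thesis
    unfolding hetero_def using L2_avg_le[OF wgrad_hetero[OF c]] by simp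
qed

lemma J_smooth:
  "J E \<theta> + dot X (Jgrad \<theta>) (\<lambda>x. \<theta>' x - \<theta> x) - smoothness / 2 * (N (\<lambda>x. \<theta>' x - \<theta> x))\<^sup>2 \<le> J E \<theta>'"
proof -
  let ?M = "real (agents E)" and ?u = "\<lambda>x. \<theta>' x - \<theta> x"
  have M: "0 < ?M" using agents_pos by simp
  have "Jc E c \<theta> + dot X (wgrad c full_weight \<theta>) ?u - smoothness / 2 * (N ?u)\<^sup>2 \<le> Jc E c \<theta>'"
    if "c < agents E" for c
    using wsum_exp_reward_smooth[OF that weights_full, of \<theta>' \<theta>] that by (simp add: Jc_eq smoothness_def abs_le_iff)
  then have "(\<Sum>c<agents E. Jc E c \<theta> + dot X (wgrad c full_weight \<theta>) ?u - smoothness / 2 * (N ?u)\<^sup>2)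
      \<le> (\<Sum>c<agents E. Jc E c \<theta>')"
    by (intro sum_mono) auto
  then have "1 / ?M * (\<Sum>c<agents E. Jc E c \<theta> + dot X (wgrad c full_weight \<theta>) ?u - smoothness / 2 * (N ?u)\<^sup>2) \<le> J E \<theta>'"
    unfolding J_def by (intro mult_left_mono) auto
  moreover have "dot X (Jgrad \<theta>) ?u = 1 / ?M * (\<Sum>c<agents E. dot X (wgrad c full_weight \<theta>) ?u)"
    unfolding Jgrad_def[abs_def] dot_scale_left dot_sum_left ..
  moreover have "1 / ?M * (\<Sum>c<agents E. Jc E c \<theta> + dot X (wgrad c full_weight \<theta>) ?u - smoothness / 2 * (N ?u)\<^sup>2)
      = J E \<theta> + 1 / ?M * (\<Sum>c<agents E. dot X (wgrad c full_weight \<theta>) ?u) - smoothness / 2 * (N ?u)\<^sup>2"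
    using M by (simp add: J_def sum.distrib sum_subtractf distrib_left right_diff_distrib)
  ultimately show ?thesis by simp
qed

text \<open>Each agent is compared with a step along its own full gradient, and these average
  exactly to \<open>Jgrad\<close>, so differing directions cancel. Heterogeneity returns only
  through the local drift, where the norm of an agent's gradient is bounded by that of
  \<open>Jgrad\<close> plus \<open>hetero\<close> and the truncation error.\<close>

lemma round_mean:
  assumes B: "1 \<le> B" and \<eta>: "0 < \<eta>" and H: "\<eta> * real H * smoothness \<le> 1 / 16"
    and T: "1 / (1 - \<gamma>) \<le> real T"
  shows "N (\<lambda>x. pmean (fedpg_round E T B \<eta> H \<theta>) (\<lambda>z. z) x - \<theta> x - \<eta> * real H * Jgrad \<theta> x)
    \<le> \<eta> * real H * (N (Jgrad \<theta>) / 8 + 2 * (hetero + trunc_err T + bias B \<eta> H))"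
proof -
  let ?M = "real (agents E)" and ?G = "\<lambda>c. wgrad c (trunc_weight T) \<theta>" and ?F = "\<lambda>c. wgrad c full_weight \<theta>"
  let ?q = "\<lambda>c. local_iter E T B \<eta> c H \<theta>"
  have eH: "0 \<le> \<eta> * real H" using \<eta> by simp
  have "(\<lambda>x. pmean (fedpg_round E T B \<eta> H \<theta>) (\<lambda>z. z) x - \<theta> x - \<eta> * real H * Jgrad \<theta> x)
      = (\<lambda>x. 1 / ?M * (\<Sum>c<agents E. pmean (?q c) (\<lambda>z. z) x - \<theta> x - \<eta> * real H * ?F c x))"
    using agents_pos
    by (simp add: pmean_round Jgrad_def sum_subtractf right_diff_distrib sum_distrib_left)
  moreover have "N (\<lambda>x. pmean (?q c) (\<lambda>z. z) x - \<theta> x - \<eta> * real H * ?F c x)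
      \<le> \<eta> * real H * (N (Jgrad \<theta>) / 8 + 2 * (hetero + trunc_err T + bias B \<eta> H))" if c: "c < agents E" for c
  proof -
    have tr: "N (\<lambda>x. ?F c x - ?G c x) \<le> trunc_err T"
      unfolding trunc_err_def by (rule wgrad_trunc_bound[OF c T])
    then have tr': "N (\<lambda>x. ?G c x - ?F c x) \<le> trunc_err T"
      by (simp add: L2_set_minus_commute)
    have G: "N (?G c) \<le> N (Jgrad \<theta>) + hetero + trunc_err T"
      using L2_set_le_diff[of "?G c" X "?F c"] L2_set_le_diff[of "?F c" X "Jgrad \<theta>"] wgrad_Jgrad[OF c, of \<theta>] tr'
      by linarith
    have "(\<lambda>x. pmean (?q c) (\<lambda>z. z) x - \<theta> x - \<eta> * real H * ?F c x)
        = (\<lambda>x. (pmean (?q c) (\<lambda>z. z) x - \<theta> x - \<eta> * real H * ?G c x) + (\<eta> * real H) * (?G c x - ?F c x))"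
      by (simp add: algebra_simps)
    then have "N (\<lambda>x. pmean (?q c) (\<lambda>z. z) x - \<theta> x - \<eta> * real H * ?F c x)
        \<le> N (\<lambda>x. pmean (?q c) (\<lambda>z. z) x - \<theta> x - \<eta> * real H * ?G c x) + \<eta> * real H * N (\<lambda>x. ?G c x - ?F c x)"
      using L2_set_triangle_ineq[of "\<lambda>x. pmean (?q c) (\<lambda>z. z) x - \<theta> x - \<eta> * real H * ?G c x"
          "\<lambda>x. (\<eta> * real H) * (?G c x - ?F c x)" X] eH
      by (simp only: L2_set_scale abs_of_nonneg)
    also have "\<dots> \<le> \<eta> * real H * (bias B \<eta> H + (N (?G c) + bias B \<eta> H) / 8) + \<eta> * real H * trunc_err T"
      using tr' eH by (intro add_mono local_iter_mean[OF c B \<eta> H] mult_left_mono) auto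
    also have "\<dots> = \<eta> * real H * (bias B \<eta> H + (N (?G c) + bias B \<eta> H) / 8 + trunc_err T)"
      by (simp add: algebra_simps)
    also have "\<dots> \<le> \<eta> * real H * (N (Jgrad \<theta>) / 8 + 2 * (hetero + trunc_err T + bias B \<eta> H))"
      using G hetero_nonneg trunc_err_nonneg[of T] bias_nonneg[of B \<eta> H] eH by (intro mult_left_mono) (argo, assumption)
    finally show ?thesis .
  qed
  ultimately show ?thesis
    using L2_avg_le[where f="\<lambda>c x. pmean (?q c) (\<lambda>z. z) x - \<theta> x - \<eta> * real H * ?F c x"] by simp
qed

text \<open>The scalar core of the descent step: \<open>a\<close> is the length of a round,
  \<open>s\<close> the smoothness, \<open>g\<close> the gradient norm, \<open>q\<close> the
  systematic error, \<open>d\<close> the inner product of gradient and mean displacement, and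
  \<open>n\<close> the norm of that displacement. The factor \<open>9 / 8\<close> is the exact step
  plus the relative error \<open>1 / 8\<close>.\<close>

lemma descent_arithmetic:
  fixes g q a s d n :: real
  assumes g: "0 \<le> g" and q: "0 \<le> q" and a: "0 \<le> a" and s: "0 \<le> s" and as: "a * s \<le> 1 / 16"
    and d: "a * g\<^sup>2 - g * (a * (g / 8 + q)) \<le> d" and n: "0 \<le> n" "n \<le> a * (9 / 8 * g + q)"
  shows "a * (g\<^sup>2 / 2 - 2 * q\<^sup>2) \<le> d - s / 2 * n\<^sup>2"
proof -
  have "s / 2 * n\<^sup>2 \<le> s / 2 * (a * (9 / 8 * g + q))\<^sup>2"
    using s n by (intro mult_left_mono power_mono) auto
  also have "\<dots> = a * s * (a / 2 * (9 / 8 * g + q)\<^sup>2)"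
    by (simp add: power_mult_distrib power2_eq_square[of a])
  also have "\<dots> \<le> 1 / 16 * (a / 2 * (9 / 8 * g + q)\<^sup>2)"
    using as a by (intro mult_right_mono) auto
  finally have 1: "s / 2 * n\<^sup>2 \<le> a * ((9 / 8 * g + q)\<^sup>2 / 32)" by simp
  \<comment> \<open>The weight \<open>8 / 5\<close> is chosen so that the multiple of this square
    cancelling the cross term \<open>137 / 128 * (g * q)\<close> stays below both remaining
    coefficients, \<open>687 / 2048\<close> and \<open>63 / 32\<close>.\<close>
  have "0 \<le> (g - 8 / 5 * q)\<^sup>2" by simp
  then have "0 \<le> g * g - 16 / 5 * (g * q) + 64 / 25 * (q * q)"
    by (simp add: power2_eq_square algebra_simps)
  moreover have "0 \<le> g * g" "0 \<le> q * q" by simp_all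
  moreover have "g\<^sup>2 - g * (g / 8 + q) - (9 / 8 * g + q)\<^sup>2 / 32 - (g\<^sup>2 / 2 - 2 * q\<^sup>2)
      = 687 / 2048 * (g * g) - 137 / 128 * (g * q) + 63 / 32 * (q * q)"
    by (simp add: power2_eq_square field_simps)
  ultimately have "g\<^sup>2 / 2 - 2 * q\<^sup>2 \<le> g\<^sup>2 - g * (g / 8 + q) - (9 / 8 * g + q)\<^sup>2 / 32"
    by linarith
  from mult_left_mono[OF this a] 1 d show ?thesis
    by (simp add: algebra_simps)
qed

text \<open>Smoothness is applied once, from the server point to the averaged point. In expectation
  the linear term sees only the mean displacement, while the quadratic term splits into the squared
  mean displacement, handled by \<open>descent_arithmetic\<close>, and the variance.\<close>

lemma round_progress:
  assumes B: "1 \<le> B" and \<eta>: "0 < \<eta>" and H: "\<eta> * real H * smoothness \<le> 1 / 16"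
    and T: "1 / (1 - \<gamma>) \<le> real T"
  shows "J E \<theta> + \<eta> * real H * ((N (Jgrad \<theta>))\<^sup>2 / 2 - 2 * (2 * (hetero + trunc_err T + bias B \<eta> H))\<^sup>2)
      - smoothness / 2 * (drift B \<eta> H / real (agents E))
    \<le> expect (fedpg_round E T B \<eta> H \<theta>) (J E)"
proof -
  let ?p = "fedpg_round E T B \<eta> H \<theta>" and ?g = "Jgrad \<theta>"
  let ?m = "pmean ?p (\<lambda>z. z)"
  define q where "q = 2 * (hetero + trunc_err T + bias B \<eta> H)"
  define a where "a = \<eta> * real H"
  note [simp] = integrable_measure_pmf_finite[OF finite_round]
  have a: "0 \<le> a" using \<eta> by (simp add: a_def)
  have q: "0 \<le> q" by (simp add: q_def hetero_nonneg trunc_err_nonneg bias_nonneg)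
  let ?e = "\<lambda>x. ?m x - \<theta> x - a * ?g x"
  have e: "N ?e \<le> a * (N ?g / 8 + q)"
    using round_mean[OF B \<eta> H T, of \<theta>] by (simp add: a_def q_def)
  have split: "(\<lambda>x. ?m x - \<theta> x) = (\<lambda>x. a * ?g x + ?e x)" by auto
  have "N (\<lambda>x. ?m x - \<theta> x) \<le> a * N ?g + N ?e"
    unfolding split using L2_set_triangle_ineq[of "\<lambda>x. a * ?g x" ?e X] a by (simp only: L2_set_scale)
  with e have n: "N (\<lambda>x. ?m x - \<theta> x) \<le> a * (9 / 8 * N ?g + q)" by (simp add: algebra_simps)
  have "\<bar>dot X ?g ?e\<bar> \<le> N ?g * (a * (N ?g / 8 + q))"
    using e by (intro order_trans[OF abs_dot_le] mult_left_mono) (auto simp: L2_set_nonneg)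
  moreover have "dot X ?g (\<lambda>x. ?m x - \<theta> x) = a * (N ?g)\<^sup>2 + dot X ?g ?e"
    by (subst split) (simp only: dot_add_right dot_scale_right dot_self)
  ultimately have d: "a * (N ?g)\<^sup>2 - N ?g * (a * (N ?g / 8 + q)) \<le> dot X ?g (\<lambda>x. ?m x - \<theta> x)"
    by linarith
  have main: "a * ((N ?g)\<^sup>2 / 2 - 2 * q\<^sup>2) \<le> dot X ?g (\<lambda>x. ?m x - \<theta> x) - smoothness / 2 * (N (\<lambda>x. ?m x - \<theta> x))\<^sup>2"
    using H smoothness_pos by (intro descent_arithmetic[OF _ q a _ _ d _ n]) (auto simp: a_def L2_set_nonneg)
  have "expect ?p (\<lambda>\<theta>'. J E \<theta> + dot X ?g (\<lambda>x. \<theta>' x - \<theta> x) - smoothness / 2 * (N (\<lambda>x. \<theta>' x - \<theta> x))\<^sup>2)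
      \<le> expect ?p (J E)"
    by (intro expectation_mono_pmf_finite finite_round J_smooth)
  moreover have "expect ?p (\<lambda>\<theta>'. J E \<theta> + dot X ?g (\<lambda>x. \<theta>' x - \<theta> x) - smoothness / 2 * (N (\<lambda>x. \<theta>' x - \<theta> x))\<^sup>2)
      = J E \<theta> + dot X ?g (\<lambda>x. ?m x - \<theta> x) - smoothness / 2 * (pvar X ?p (\<lambda>z. z) + (N (\<lambda>x. ?m x - \<theta> x))\<^sup>2)"
  proof -
    have "expect ?p (\<lambda>\<theta>'. dot X ?g (\<lambda>x. \<theta>' x - \<theta> x)) = dot X ?g (\<lambda>x. ?m x - \<theta> x)"
      unfolding dot_diff_right dot_commute[of X ?g] by (simp add: dot_pmean[OF finite_round])
    then show ?thesis
      using expectation_L2_set_diff[OF finite_round, where f="\<lambda>z. z" and a=\<theta> and X=X, of T B \<eta> H \<theta>] by simp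
  qed
  moreover have "smoothness / 2 * pvar X ?p (\<lambda>z. z) \<le> smoothness / 2 * (drift B \<eta> H / real (agents E))"
    using smoothness_pos by (intro mult_left_mono pvar_round B \<eta> H) auto
  ultimately show ?thesis
    using main unfolding a_def[symmetric] q_def[symmetric] by (simp add: algebra_simps)
qed

end

section \<open>Convergence\<close>

context fed begin

section \<open>The optimality gap and its contraction in one round\<close>

lemma mu_soft_le_agent: "c < agents E \<Longrightarrow> mu_soft E d \<theta> \<le> mu_agent E c (d c) \<theta>"
  unfolding mu_soft_def by (intro Min_le) auto

lemma mu_soft_nonneg: "0 \<le> mu_soft E d \<theta>"
  unfolding mu_soft_def using agents_pos mu_agent_nonneg
  by (subst Min_ge_iff) (auto simp: lessThan_empty_iff)

lemma gap_eq: "J_star E - J E \<theta> = 1 / real (agents E) * (\<Sum>c<agents E. Jc_star E c - Jc E c \<theta>)"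
  by (simp add: J_star_def J_def sum_subtractf right_diff_distrib)

lemma gap_nonneg: "0 \<le> J_star E - J E \<theta>"
  unfolding gap_eq using Jc_le_star by (intro mult_nonneg_nonneg sum_nonneg) auto

lemma gap_le: "J_star E - J E \<theta> \<le> 1 / (1 - \<gamma>)"
proof -
  have "Jc_star E c - Jc E c \<theta> \<le> 1 / (1 - \<gamma>)" if "c < agents E" for c
  proof -
    have "Jc_star E c \<le> 1 / (1 - \<gamma>)"
      unfolding Jc_star_def using Jc_bounds(2)[OF that] by (intro cSUP_least) auto
    then show ?thesis using Jc_bounds(1)[OF that, of \<theta>] by linarith
  qed
  then have "(\<Sum>c<agents E. Jc_star E c - Jc E c \<theta>) \<le> (\<Sum>c<agents E. 1 / (1 - \<gamma>))"
    by (intro sum_mono) auto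
  then have "1 / real (agents E) * (\<Sum>c<agents E. Jc_star E c - Jc E c \<theta>)
      \<le> 1 / real (agents E) * (\<Sum>c<agents E. 1 / (1 - \<gamma>))"
    by (intro mult_left_mono) auto
  also have "\<dots> = 1 / (1 - \<gamma>)" using agents_pos by simp
  finally show ?thesis unfolding gap_eq .
qed

text \<open>\<open>J_star\<close> averages the separate optima of the agents, so domination is used
  agent by agent, in square-root form, where it can be averaged linearly. The factor 2 of
  \<open>gradient_domination\<close> then pays for squaring the sum of gradient norm and
  \<open>hetero\<close>.\<close>

lemma gap_domination:
  assumes opt: "\<And>c. c < agents E \<Longrightarrow> optimal_det E c (d c)" and pos: "\<And>s. s \<in> S \<Longrightarrow> 0 < pmf (init E) s"
    and \<mu>: "0 < \<mu>" "\<mu> \<le> mu_soft E d \<theta>"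
  shows "\<mu> * (J_star E - J E \<theta>)\<^sup>2 \<le> (N (Jgrad \<theta>))\<^sup>2 + hetero\<^sup>2"
proof -
  let ?k = "N (Jgrad \<theta>) + hetero"
  have k: "0 \<le> ?k" by (simp add: L2_set_nonneg hetero_nonneg)
  have one: "sqrt (2 * \<mu>) * (Jc_star E c - Jc E c \<theta>) \<le> ?k" if c: "c < agents E" for c
  proof -
    have "(sqrt (2 * \<mu>) * (Jc_star E c - Jc E c \<theta>))\<^sup>2 = 2 * \<mu> * (Jc_star E c - Jc E c \<theta>)\<^sup>2"
      using \<mu> by (simp add: power_mult_distrib)
    also have "\<dots> \<le> 2 * mu_agent E c (d c) \<theta> * (Jc_star E c - Jc E c \<theta>)\<^sup>2"
      using \<mu>(2) mu_soft_le_agent[OF c, of d \<theta>] by (intro mult_right_mono) auto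
    also have "\<dots> \<le> (N (wgrad c full_weight \<theta>))\<^sup>2"
      by (rule gradient_domination[OF c opt[OF c] pos])
    finally have "sqrt (2 * \<mu>) * (Jc_star E c - Jc E c \<theta>) \<le> N (wgrad c full_weight \<theta>)"
      by (rule power2_le_imp_le) (simp add: L2_set_nonneg)
    also have "\<dots> \<le> ?k"
      using L2_set_le_diff[of "wgrad c full_weight \<theta>" X "Jgrad \<theta>"] wgrad_Jgrad[OF c, of \<theta>] by linarith
    finally show ?thesis .
  qed
  have "sqrt (2 * \<mu>) * (J_star E - J E \<theta>)
      = 1 / real (agents E) * (\<Sum>c<agents E. sqrt (2 * \<mu>) * (Jc_star E c - Jc E c \<theta>))"
    unfolding gap_eq by (simp add: sum_distrib_left)
  also have "\<dots> \<le> 1 / real (agents E) * (\<Sum>c<agents E. ?k)"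
    using one by (intro mult_left_mono sum_mono) auto
  also have "\<dots> = ?k" using agents_pos by simp
  finally have "(sqrt (2 * \<mu>) * (J_star E - J E \<theta>))\<^sup>2 \<le> ?k\<^sup>2"
    using gap_nonneg \<mu> by (intro power_mono) auto
  then have "2 * (\<mu> * (J_star E - J E \<theta>)\<^sup>2) \<le> ?k\<^sup>2"
    using \<mu> by (simp add: power_mult_distrib)
  also have "\<dots> \<le> 2 * ((N (Jgrad \<theta>))\<^sup>2 + hetero\<^sup>2)"
    using sum_squares_bound[of "N (Jgrad \<theta>)" hetero] by (simp add: power2_sum)
  finally show ?thesis by simp
qed

lemma round_contraction:
  assumes opt: "\<And>c. c < agents E \<Longrightarrow> optimal_det E c (d c)" and pos: "\<And>s. s \<in> S \<Longrightarrow> 0 < pmf (init E) s"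
    and \<mu>: "0 < \<mu>" "\<mu> \<le> mu_soft E d \<theta>"
    and B: "1 \<le> B" and \<eta>: "0 < \<eta>" and \<epsilon>: "0 < \<epsilon>"
    and T: "1 / (1 - \<gamma>) \<le> real T"
    and H: "\<eta> * real H \<le> (1 - \<gamma>) ^ 3 / 256"
    and err: "hetero + trunc_err T \<le> sqrt \<mu> * \<epsilon> / 500"
    and \<eta>1: "\<eta> \<le> 1 / 10000 * ((1 - \<gamma>) ^ 7 * \<mu> * real B * real (agents E) * \<epsilon>\<^sup>2)"
    and \<eta>2: "\<eta> \<le> 1 / 10000 * (sqrt \<mu> * \<epsilon> * (1 - \<gamma>) ^ 5 * real B)"
  shows "expect (fedpg_round E T B \<eta> H \<theta>) (\<lambda>\<theta>'. J_star E - J E \<theta>')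
    \<le> (J_star E - J E \<theta>) - \<eta> * real H * \<mu> / 2 * ((J_star E - J E \<theta>)\<^sup>2 - (\<epsilon> / 6)\<^sup>2)"
proof -
  define y where "y = 1 - \<gamma>"
  define a where "a = \<eta> * real H"
  define M where "M = real (agents E)"
  define b where "b = real B"
  \<comment> \<open>The natural unit for gradient errors: by domination, a gap of
    \<open>\<epsilon>\<close> corresponds to a squared gradient of order
    \<open>\<mu> * \<epsilon> ^ 2\<close>, the square of \<open>z\<close>.\<close>
  define z where "z = sqrt \<mu> * \<epsilon>"
  define g where "g = N (Jgrad \<theta>)"
  define \<delta> where "\<delta> = J_star E - J E \<theta>"
  have y: "0 < y" using \<gamma>_less by (simp add: y_def)
  have M: "0 < M" using agents_pos by (simp add: M_def)
  have b: "0 < b" using B by (simp add: b_def)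
  have a: "0 \<le> a" using \<eta> by (simp add: a_def)
  have z: "0 < z" using \<mu> \<epsilon> by (simp add: z_def)
  have z2: "z\<^sup>2 = \<mu> * \<epsilon>\<^sup>2" using \<mu> by (simp add: z_def power_mult_distrib)
  have aH: "a \<le> y ^ 3 / 256" using H by (simp add: a_def y_def)
  have "\<eta> * real H * smoothness \<le> y ^ 3 / 256 * (16 / y ^ 3)"
    using aH y unfolding smoothness_def a_def y_def by (intro mult_right_mono) auto
  then have HL: "\<eta> * real H * smoothness \<le> 1 / 16" using y by simp
  have dr: "drift B \<eta> H = 8 * a * \<eta> / (y ^ 4 * b)"
    by (simp add: drift_def noise_def a_def y_def b_def power2_eq_square)
  \<comment> \<open>Powers of \<open>y\<close>: 4 from the second-order constant and 4 from the
    noise stand against 3 from the length of the round, which leaves the 5 required of the third cap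
    on \<open>\<eta>\<close>.\<close>
  have bias: "bias B \<eta> H \<le> z / 2000"
  proof -
    have "bias B \<eta> H = 960 * a * \<eta> / (y ^ 8 * b)"
      unfolding bias_def dr y_def[symmetric] by (simp add: power_add[symmetric] flip: mult.assoc)
    also have "\<dots> \<le> 960 * (y ^ 3 / 256) * (1 / 10000 * (z * y ^ 5 * b)) / (y ^ 8 * b)"
      using aH \<eta>2 \<eta> y b a unfolding z_def y_def[symmetric] b_def[symmetric]
      by (intro divide_right_mono mult_mono) auto
    also have "\<dots> = 3 / 8000 * z"
      using y b by (simp add: field_simps flip: power_add)
    also have "\<dots> \<le> z / 2000" using z by simp
    finally show ?thesis .
  qed
  \<comment> \<open>Here the 7 of the second cap is 3 from the smoothness plus 4 from the noise, and
    the factor \<open>M\<close> comes from averaging. One factor \<open>a\<close> remains outside,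
    so the loss is proportional to the progress of the round.\<close>
  have noise: "smoothness / 2 * (drift B \<eta> H / M) \<le> a * (64 / 10000 * z\<^sup>2)"
  proof -
    have "smoothness / 2 * (drift B \<eta> H / M) = a * (64 * \<eta> / (y ^ 7 * b * M))"
      unfolding dr smoothness_def y_def[symmetric] by (simp add: power_add[symmetric] flip: mult.assoc)
    also have "\<dots> \<le> a * (64 * (1 / 10000 * (y ^ 7 * \<mu> * b * M * \<epsilon>\<^sup>2)) / (y ^ 7 * b * M))"
      using \<eta>1 a y b M unfolding y_def[symmetric] b_def[symmetric] M_def[symmetric]
      by (intro mult_left_mono divide_right_mono) auto
    also have "\<dots> = a * (64 / 10000 * z\<^sup>2)"
      unfolding z2 using y b M by simp
    finally show ?thesis .
  qed
  have q: "(2 * (hetero + trunc_err T + bias B \<eta> H))\<^sup>2 \<le> (z / 200)\<^sup>2"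
    using err bias hetero_nonneg trunc_err_nonneg[of T] bias_nonneg[of B \<eta> H] unfolding z_def[symmetric]
    by (intro power_mono) auto
  have h: "hetero\<^sup>2 \<le> (z / 500)\<^sup>2"
    using err hetero_nonneg trunc_err_nonneg[of T] unfolding z_def[symmetric] by (intro power_mono) auto
  have dom: "\<mu> * \<delta>\<^sup>2 \<le> g\<^sup>2 + hetero\<^sup>2"
    unfolding \<delta>_def g_def by (rule gap_domination[OF opt pos \<mu>])
  \<comment> \<open>The floor \<open>\<epsilon> / 6\<close> provides a budget of
    \<open>z ^ 2 / 72\<close>; variance, systematic error and heterogeneity together use less than
    half of it.\<close>
  have "\<mu> / 2 * (\<delta>\<^sup>2 - (\<epsilon> / 6)\<^sup>2) + 64 / 10000 * z\<^sup>2
      \<le> g\<^sup>2 / 2 - 2 * (2 * (hetero + trunc_err T + bias B \<eta> H))\<^sup>2"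
  proof -
    have "\<mu> / 2 * (\<delta>\<^sup>2 - (\<epsilon> / 6)\<^sup>2) = (\<mu> * \<delta>\<^sup>2) / 2 - z\<^sup>2 / 72"
      by (simp add: z2 power_divide algebra_simps)
    moreover have "(z / 200)\<^sup>2 = z\<^sup>2 / 40000" "(z / 500)\<^sup>2 = z\<^sup>2 / 250000" by (simp_all add: power_divide)
    moreover have "0 \<le> z\<^sup>2" by simp
    ultimately show ?thesis using dom q h by linarith
  qed
  from mult_left_mono[OF this a]
  have key: "a * \<mu> / 2 * (\<delta>\<^sup>2 - (\<epsilon> / 6)\<^sup>2) + a * (64 / 10000 * z\<^sup>2)
      \<le> a * (g\<^sup>2 / 2 - 2 * (2 * (hetero + trunc_err T + bias B \<eta> H))\<^sup>2)"
    by (simp add: algebra_simps)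
  have "expect (fedpg_round E T B \<eta> H \<theta>) (\<lambda>\<theta>'. J_star E - J E \<theta>')
      = J_star E - expect (fedpg_round E T B \<eta> H \<theta>) (J E)"
    by (simp add: integrable_measure_pmf_finite[OF finite_round])
  also have "\<dots> \<le> \<delta> - a * \<mu> / 2 * (\<delta>\<^sup>2 - (\<epsilon> / 6)\<^sup>2)"
    using round_progress[OF B \<eta> HL T, of \<theta>] key noise
    unfolding a_def[symmetric] g_def[symmetric] M_def[symmetric] \<delta>_def by linarith
  finally show ?thesis unfolding a_def \<delta>_def .
qed

end

text \<open>The interval up to \<open>\<epsilon>\<close> is invariant. Above it,
  \<open>(\<epsilon> / 6) ^ 2\<close> is at most 1/36 of \<open>(x r) ^ 2\<close>, so the decrease
  is at least \<open>35 / 36 * k * (x r) ^ 2\<close> and the reciprocal of \<open>x r\<close> grows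
  at least linearly.\<close>

lemma quadratic_recursion:
  fixes x :: "nat \<Rightarrow> real"
  assumes x0: "\<And>r. 0 \<le> x r" and xD: "\<And>r. x r \<le> D"
    and rec: "\<And>r. x (Suc r) \<le> x r - k * ((x r)\<^sup>2 - (\<epsilon> / 6)\<^sup>2)"
    and \<epsilon>: "0 < \<epsilon>" "\<epsilon> \<le> D" and k: "0 \<le> k" "2 * k * D \<le> 1"
    and R: "\<epsilon> < x 0 \<Longrightarrow> 36 / (35 * \<epsilon>) \<le> k * real R"
  shows "x R \<le> \<epsilon>"
proof (rule ccontr)
  assume "\<not> x R \<le> \<epsilon>"
  \<comment> \<open>Below \<open>\<epsilon> / 6\<close> the recursion may increase, but
    \<open>2 * k * D \<le> 1\<close> prevents it from passing \<open>\<epsilon> / 6\<close> in one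
    step.\<close>
  have stable: "x (Suc r) \<le> \<epsilon>" if "x r \<le> \<epsilon>" for r
  proof (cases "\<epsilon> / 6 \<le> x r")
    case True
    then have "0 \<le> k * ((x r)\<^sup>2 - (\<epsilon> / 6)\<^sup>2)"
      using k \<epsilon> by (intro mult_nonneg_nonneg) (auto intro: power_mono)
    then show ?thesis using rec[of r] that by linarith
  next
    case False
    have "k * (\<epsilon> / 6 + x r) \<le> k * (2 * D)"
      using \<epsilon> xD[of r] k by (intro mult_left_mono) auto
    then have "k * (\<epsilon> / 6 + x r) \<le> 1" using k by simp
    from mult_right_mono[OF this, of "\<epsilon> / 6 - x r"] False
    have "k * (\<epsilon> / 6 + x r) * (\<epsilon> / 6 - x r) \<le> \<epsilon> / 6 - x r" by simp
    moreover have "k * ((x r)\<^sup>2 - (\<epsilon> / 6)\<^sup>2) = - (k * (\<epsilon> / 6 + x r) * (\<epsilon> / 6 - x r))"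
      by (simp add: power2_eq_square algebra_simps)
    ultimately show ?thesis using rec[of r] \<epsilon> by linarith
  qed
  have big: "\<epsilon> < x r" if "r \<le> R" for r
  proof (rule ccontr)
    assume "\<not> \<epsilon> < x r"
    then have "x (r + n) \<le> \<epsilon>" for n by (induction n) (auto intro: stable)
    from this[of "R - r"] that \<open>\<not> x R \<le> \<epsilon>\<close> show False by simp
  qed
  define c where "c = 35 / 36 * k"
  have c: "0 \<le> c" using k by (simp add: c_def)
  have "r \<le> R \<Longrightarrow> c * real r \<le> 1 / x r" for r
  proof (induction r)
    case (Suc r)
    have x: "0 < x r" "0 < x (Suc r)" "\<epsilon> < x r" using big[of r] big[of "Suc r"] Suc.prems \<epsilon> by auto
    have "\<epsilon>\<^sup>2 \<le> (x r)\<^sup>2" using x \<epsilon> by (intro power_mono) auto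
    then have "k * (35 / 36 * (x r)\<^sup>2) \<le> k * ((x r)\<^sup>2 - (\<epsilon> / 6)\<^sup>2)"
      using k by (intro mult_left_mono) (auto simp: power_divide)
    then have le: "x (Suc r) \<le> x r - c * (x r)\<^sup>2" using rec[of r] by (simp add: c_def)
    \<comment> \<open>The product is \<open>1 - (c * x r) ^ 2\<close>, so one step raises the
      reciprocal by at least \<open>c\<close>.\<close>
    have "(c + 1 / x r) * x (Suc r) \<le> (c + 1 / x r) * (x r - c * (x r)\<^sup>2)"
      using le c x by (intro mult_left_mono) auto
    also have "\<dots> = 1 - (c * x r)\<^sup>2"
      using x by (simp add: field_simps power2_eq_square)
    also have "\<dots> \<le> 1" by simp
    finally have "c + 1 / x r \<le> 1 / x (Suc r)" using x by (simp add: le_divide_eq)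
    with Suc show ?case by (simp add: algebra_simps)
  qed (use big[of 0] \<epsilon> in simp)
  from this[of R] have "c * real R \<le> 1 / x R" by simp
  also have "\<dots> < 1 / \<epsilon>" using big[of R] \<epsilon> by (simp add: divide_strict_left_mono)
  finally have "k * real R < 36 / (35 * \<epsilon>)" by (simp add: c_def field_simps)
  with R big[of 0] show False by simp
qed

context fed begin

section \<open>The expected gap over all rounds\<close>

lemma finite_fedpg_law: "finite (set_pmf (chain_law (return_pmf \<theta>0) (fedpg_round E T B \<eta> H) r))"
  by (induction r) (auto simp: finite_round)

lemma fedpg_rate:
  assumes opt: "\<And>c. c < agents E \<Longrightarrow> optimal_det E c (d c)" and pos: "\<And>s. s \<in> S \<Longrightarrow> 0 < pmf (init E) s"
    and \<mu>: "0 < \<mu>" "\<mu> < 1" and B: "1 \<le> B" and \<eta>: "0 < \<eta>" and \<epsilon>: "0 < \<epsilon>"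
    and T: "1 / (1 - \<gamma>) \<le> real T"
    and H: "(1 - \<gamma>) ^ 3 / 512 \<le> \<eta> * real H" "\<eta> * real H \<le> (1 - \<gamma>) ^ 3 / 256"
    and err: "hetero + trunc_err T \<le> sqrt \<mu> * \<epsilon> / 500"
    and \<eta>1: "\<eta> \<le> 1 / 10000 * ((1 - \<gamma>) ^ 7 * \<mu> * real B * real (agents E) * \<epsilon>\<^sup>2)"
    and \<eta>2: "\<eta> \<le> 1 / 10000 * (sqrt \<mu> * \<epsilon> * (1 - \<gamma>) ^ 5 * real B)"
    and AE: "AE \<omega> in fedpg E T B \<eta> H \<theta>0. \<mu> \<le> (INF r. mu_soft E d (\<omega> r))"
    and \<delta>0: "\<delta>0 = J_star E - J E \<theta>0" "0 < \<delta>0"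
    and R: "2000 * ((\<delta>0 - \<epsilon> / 6) / (\<delta>0 * \<mu> * \<epsilon>)) * (1 / (1 - \<gamma>) ^ 3) \<le> real R"
  shows "(\<integral>\<omega>. J_star E - J E (\<omega> R) \<partial>fedpg E T B \<eta> H \<theta>0) \<le> \<epsilon>"
proof -
  let ?q = "chain_law (return_pmf \<theta>0) (fedpg_round E T B \<eta> H)"
  let ?gap = "\<lambda>\<theta>. J_star E - J E \<theta>"
  define x where "x r = expect (?q r) ?gap" for r
  define y where "y = 1 - \<gamma>"
  define k where "k = \<eta> * real H * \<mu> / 2"
  have y: "0 < y" "y < 1" using \<gamma>_less \<gamma>_pos by (auto simp: y_def)
  note [simp] = integrable_measure_pmf_finite[OF finite_fedpg_law]
  \<comment> \<open>The infimum is below each of its terms because \<open>mu_soft\<close> is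
    nonnegative, hence bounded below. On a discrete marginal, almost surely means everywhere on the
    support.\<close>
  have soft: "\<mu> \<le> mu_soft E d \<theta>" if "\<theta> \<in> set_pmf (?q r)" for \<theta> r
  proof -
    have "AE \<omega> in fedpg E T B \<eta> H \<theta>0. \<mu> \<le> mu_soft E d (\<omega> r)"
      using AE
    proof eventually_elim
      case (elim \<omega>)
      have "(INF r. mu_soft E d (\<omega> r)) \<le> mu_soft E d (\<omega> r)"
        by (rule cINF_lower) (auto intro!: bdd_belowI2 mu_soft_nonneg)
      with elim show ?case by linarith
    qed
    then show ?thesis
      unfolding fedpg_def using AE_chain_coordinate[where P="\<lambda>\<theta>. \<mu> \<le> mu_soft E d \<theta>"] that by blast
  qed
  have k: "0 \<le> k" "y ^ 3 * \<mu> / 1024 \<le> k"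
    using \<mu> \<eta> mult_right_mono[OF H(1), of "\<mu> / 2"] by (auto simp: k_def y_def)
  have rec: "x (Suc r) \<le> x r - k * ((x r)\<^sup>2 - (\<epsilon> / 6)\<^sup>2)" for r
  proof -
    have "x (Suc r) = expect (?q r) (\<lambda>\<theta>. expect (fedpg_round E T B \<eta> H \<theta>) ?gap)"
      unfolding x_def chain_law.simps by (rule expectation_bind_pmf_finite[OF finite_fedpg_law finite_round])
    also have "\<dots> \<le> expect (?q r) (\<lambda>\<theta>. ?gap \<theta> - k * ((?gap \<theta>)\<^sup>2 - (\<epsilon> / 6)\<^sup>2))"
      unfolding k_def
      by (intro expectation_mono_pmf_finite finite_fedpg_law
          round_contraction[OF opt pos \<mu>(1) soft B \<eta> \<epsilon> T H(2) err \<eta>1 \<eta>2])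
    also have "\<dots> = x r - k * (expect (?q r) (\<lambda>\<theta>. (?gap \<theta>)\<^sup>2) - (\<epsilon> / 6)\<^sup>2)"
      by (simp add: x_def)
    \<comment> \<open>Jensen's inequality for the square, from the nonnegativity of the variance. It
      closes the recursion in the expected gap alone.\<close>
    also have "\<dots> \<le> x r - k * ((x r)\<^sup>2 - (\<epsilon> / 6)\<^sup>2)"
    proof -
      have "0 \<le> expect (?q r) (\<lambda>\<theta>. (?gap \<theta> - x r)\<^sup>2)" by simp
      also have "(\<lambda>\<theta>. (?gap \<theta> - x r)\<^sup>2) = (\<lambda>\<theta>. (?gap \<theta>)\<^sup>2 - 2 * x r * ?gap \<theta> + (x r)\<^sup>2)"
        by (rule ext) (simp add: power2_eq_square algebra_simps)
      also have "expect (?q r) (\<lambda>\<theta>. (?gap \<theta>)\<^sup>2 - 2 * x r * ?gap \<theta> + (x r)\<^sup>2)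
          = expect (?q r) (\<lambda>\<theta>. (?gap \<theta>)\<^sup>2) - 2 * x r * expect (?q r) ?gap + (x r)\<^sup>2"
        by simp
      finally have "(x r)\<^sup>2 \<le> expect (?q r) (\<lambda>\<theta>. (?gap \<theta>)\<^sup>2)"
        by (simp add: x_def[symmetric] power2_eq_square)
      then show ?thesis using k by (simp add: mult_left_mono)
    qed
    finally show ?thesis .
  qed
  have x0: "0 \<le> x r" for r
    unfolding x_def using gap_nonneg by (intro integral_nonneg_AE) auto
  have xD: "x r \<le> 1 / y" for r
  proof -
    have "x r \<le> expect (?q r) (\<lambda>_. 1 / y)"
      unfolding x_def y_def using gap_le by (intro expectation_mono_pmf_finite finite_fedpg_law)
    then show ?thesis by simp
  qed
  have "x R \<le> \<epsilon>"
  \<comment> \<open>A gap never exceeds \<open>1 / y\<close>, so larger targets are met at once;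
    otherwise \<open>D = 1 / y\<close> serves in the recursion.\<close>
  proof (cases "\<epsilon> \<le> 1 / y")
    case False
    then show ?thesis using xD[of R] by linarith
  next
    case True
    have "2 * k * (1 / y) = \<eta> * real H * \<mu> / y" by (simp add: k_def)
    also have "\<dots> \<le> (y ^ 3 / 256) * 1 / y"
      using H(2) \<mu> y unfolding y_def[symmetric] by (intro divide_right_mono mult_mono) auto
    also have "\<dots> = y\<^sup>2 / 256" using y by (simp add: power2_eq_square power3_eq_cube)
    also have "\<dots> \<le> 1" using power_le_one[of y 2] y by simp
    finally have kD: "2 * k * (1 / y) \<le> 1" .
    have "36 / (35 * \<epsilon>) \<le> k * real R" if "\<epsilon> < x 0"
    proof -
      have \<delta>: "\<epsilon> < \<delta>0" using that by (simp add: x_def \<delta>0)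
      \<comment> \<open>The start is deterministic, so \<open>\<epsilon> < x 0\<close> means
        \<open>\<epsilon> < \<delta>0\<close> and the ratio
        \<open>(\<delta>0 - \<epsilon> / 6) / \<delta>0\<close> is at least \<open>5 / 6\<close>.
        The 1024 is the 512 from rounding \<open>H\<close>, doubled by the factor
        \<open>1 / 2\<close> in \<open>k\<close>.\<close>
      have "36 / (35 * \<epsilon>) \<le> 2000 / 1024 * (5 / 6) / \<epsilon>"
        using \<epsilon> by (simp add: field_simps)
      also have "\<dots> \<le> 2000 / 1024 * ((\<delta>0 - \<epsilon> / 6) / \<delta>0) / \<epsilon>"
        using \<epsilon> \<delta> \<delta>0(2) by (intro divide_right_mono mult_left_mono) (auto simp: field_simps)
      also have "\<dots> = y ^ 3 * \<mu> / 1024 * (2000 * ((\<delta>0 - \<epsilon> / 6) / (\<delta>0 * \<mu> * \<epsilon>)) * (1 / y ^ 3))"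
        using y \<mu> \<epsilon> \<delta>0(2) by (simp add: field_simps)
      also have "\<dots> \<le> k * real R"
        using R k y \<mu> \<epsilon> \<delta> \<delta>0(2) unfolding y_def[symmetric]
        by (intro mult_mono) (auto intro!: divide_nonneg_pos mult_nonneg_nonneg)
      finally show ?thesis .
    qed
    then show ?thesis
      by (rule quadratic_recursion[of x "1 / y" k \<epsilon> R, OF x0 xD rec \<epsilon> True k(1) kD])
  qed
  then show ?thesis
    unfolding fedpg_def x_def using integral_chain_coordinate[where f="?gap"] by simp
qed

end

theorem corollary5p1:
  shows "\<exists>c0 C0 :: real. 0 < c0 \<and> 0 < C0 \<and>
    (\<forall>(E :: fed_env) (astar :: nat \<Rightarrow> nat \<Rightarrow> nat) (T :: nat) (B :: nat) (\<theta>0 :: param)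
        (\<mu> :: real) (\<epsilon> :: real) (\<eta> :: real) (\<gamma> :: real) (M :: nat) (\<delta>0 :: real).
      fed_mdp E \<and> \<gamma> = discount E \<and> M = agents E \<and> \<delta>0 = J_star E - J E \<theta>0 \<and>
      (\<forall>c<M. optimal_det E c (astar c)) \<and>
      0 < Min (pmf (init E) ` states E) \<and>
      4 / (1 - \<gamma>)\<^sup>2 \<le> real T \<and>
      1 \<le> B \<and> 1 / (1 - \<gamma>) \<le> real M * real B \<and>
      0 < \<mu> \<and> \<mu> < 1 \<and>
      C0 * (eps_P E / ((1 - \<gamma>) ^ 3 * sqrt \<mu>) + eps_r E / ((1 - \<gamma>)\<^sup>2 * sqrt \<mu>)
            + \<gamma> ^ T * real T / ((1 - \<gamma>) * sqrt \<mu>)) \<le> \<epsilon> \<and>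
      0 < \<epsilon> \<and>
      0 < \<eta> \<and>
      \<eta> \<le> c0 * Min {(1 - \<gamma>) ^ 3,
                     (1 - \<gamma>) ^ 7 * \<mu> * real B * real M * \<epsilon>\<^sup>2,
                     sqrt \<mu> * \<epsilon> * (1 - \<gamma>) ^ 5 * real B} \<and>
      0 < \<delta>0
      \<longrightarrow>
      (\<exists>H\<ge>1.
        (AE \<omega> in fedpg E T B \<eta> H \<theta>0. \<mu> \<le> (INF r. mu_soft E astar (\<omega> r)))
        \<longrightarrow>
        (\<forall>R :: nat.
          C0 * ((\<delta>0 - \<epsilon> / 6) / (\<delta>0 * \<mu> * \<epsilon>)) * (1 / (1 - \<gamma>) ^ 3) \<le> real R \<and>
          C0 * ((\<delta>0 - \<epsilon> / 6) / (\<delta>0 * \<mu> * \<epsilon>)) *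
            Max {real B / (1 - \<gamma>) ^ 3,
                 1 / ((1 - \<gamma>) ^ 7 * \<mu> * real M * \<epsilon>\<^sup>2),
                 1 / ((1 - \<gamma>) ^ 5 * sqrt \<mu> * \<epsilon>)} \<le> real R * real H * real B
          \<longrightarrow>
          (\<integral>\<omega>. J_star E - J E (\<omega> R) \<partial>fedpg E T B \<eta> H \<theta>0) \<le> \<epsilon>)))"
proof (rule exI[of _ "1 / 10000"], rule exI[of _ 2000], intro conjI allI impI, simp, simp, elim conjE)
  fix E :: fed_env and astar :: "nat \<Rightarrow> nat \<Rightarrow> nat" and T B :: nat and \<theta>0 :: param
    and \<mu> \<epsilon> \<eta> \<gamma> :: real and M :: nat and \<delta>0 :: real
  assume mdp: "fed_mdp E" and \<gamma>: "\<gamma> = discount E" and M: "M = agents E" and \<delta>0: "\<delta>0 = J_star E - J E \<theta>0"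
    and opt: "\<forall>c<M. optimal_det E c (astar c)" and init: "0 < Min (pmf (init E) ` states E)"
    and T: "4 / (1 - \<gamma>)\<^sup>2 \<le> real T" and B: "1 \<le> B" and \<mu>: "0 < \<mu>" "\<mu> < 1"
    and err: "2000 * (eps_P E / ((1 - \<gamma>) ^ 3 * sqrt \<mu>) + eps_r E / ((1 - \<gamma>)\<^sup>2 * sqrt \<mu>)
            + \<gamma> ^ T * real T / ((1 - \<gamma>) * sqrt \<mu>)) \<le> \<epsilon>"
    and \<epsilon>: "0 < \<epsilon>" and \<eta>: "0 < \<eta>"
    and \<eta>_le: "\<eta> \<le> 1 / 10000 * Min {(1 - \<gamma>) ^ 3,
                     (1 - \<gamma>) ^ 7 * \<mu> * real B * real M * \<epsilon>\<^sup>2,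
                     sqrt \<mu> * \<epsilon> * (1 - \<gamma>) ^ 5 * real B}"
    and \<delta>0_pos: "0 < \<delta>0"
  interpret fed E by standard (rule mdp)
  define y where "y = 1 - \<gamma>"
  have y: "0 < y" "y < 1" using \<gamma>_less \<gamma>_pos by (auto simp: y_def \<gamma>)
  have \<eta>3: "\<eta> \<le> 1 / 10000 * (1 - \<gamma>) ^ 3"
    and \<eta>1: "\<eta> \<le> 1 / 10000 * ((1 - \<gamma>) ^ 7 * \<mu> * real B * real M * \<epsilon>\<^sup>2)"
    and \<eta>2: "\<eta> \<le> 1 / 10000 * (sqrt \<mu> * \<epsilon> * (1 - \<gamma>) ^ 5 * real B)"
    by (rule order_trans[OF \<eta>_le], rule mult_left_mono, rule Min_le; simp)+
  have pos: "\<And>s. s \<in> S \<Longrightarrow> 0 < pmf (init E) s"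
    using init by (subst (asm) Min_gr_iff) auto
  have "1 / y \<le> 4 / y\<^sup>2"
    using y by (simp add: power2_eq_square field_simps)
  then have T': "1 / (1 - discount E) \<le> real T"
    using T unfolding y_def \<gamma> by linarith
  have s: "0 < sqrt \<mu>" using \<mu> by simp
  \<comment> \<open>Here 2000 splits as \<open>4 * 500\<close>: 4 is the largest coefficient in
    \<open>hetero\<close> and \<open>trunc_err\<close>, and \<open>1 / 500\<close> is the share
    granted to them in \<open>round_contraction\<close>.\<close>
  have err': "hetero + trunc_err T \<le> sqrt \<mu> * \<epsilon> / 500"
  proof -
    define Z where "Z = eps_P E / (y ^ 3 * sqrt \<mu>) + eps_r E / (y\<^sup>2 * sqrt \<mu>) + \<gamma> ^ T * real T / (y * sqrt \<mu>)"
    have "hetero + trunc_err T \<le> 4 * (eps_P E / y ^ 3 + eps_r E / y\<^sup>2 + \<gamma> ^ T * real T / y)"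
      using eps_nonneg(2) y unfolding hetero_def trunc_err_def \<gamma>[symmetric] y_def[symmetric]
      by (simp add: distrib_left divide_right_mono)
    also have "\<dots> = 4 * sqrt \<mu> * Z"
      using s y by (simp add: Z_def field_simps)
    also have "\<dots> \<le> 4 * sqrt \<mu> * (\<epsilon> / 2000)"
      using err s unfolding y_def[symmetric] Z_def[symmetric] by (intro mult_left_mono) auto
    finally show ?thesis by (simp add: mult.commute)
  qed
  \<comment> \<open>Only \<open>\<eta>\<close> and the discount enter, so \<open>H\<close> is fixed
    before the law of the iterates and before \<open>R\<close>. The first cap on
    \<open>\<eta>\<close> makes the quotient at least 1, and rounding such a number down loses at
    most a factor 2; hence the window from \<open>y ^ 3 / 512\<close> to \<open>y ^ 3 / 256\<close>
    for \<open>\<eta> * H\<close>.\<close>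
  define H where "H = nat \<lfloor>y ^ 3 / 256 / \<eta>\<rfloor>"
  have ratio: "1 \<le> y ^ 3 / 256 / \<eta>"
    using \<eta>3 \<eta> unfolding y_def[symmetric] by (simp add: field_simps)
  have H1: "1 \<le> H" using ratio by (simp add: H_def le_nat_iff le_floor_iff)
  have H_le: "real H \<le> y ^ 3 / 256 / \<eta>" using ratio by (simp add: H_def)
  have H_ge: "y ^ 3 / 256 / \<eta> \<le> 2 * real H"
    using ratio H1 unfolding H_def by linarith
  have HH: "(1 - discount E) ^ 3 / 512 \<le> \<eta> * real H" "\<eta> * real H \<le> (1 - discount E) ^ 3 / 256"
    using H_le H_ge \<eta> unfolding \<gamma>[symmetric] y_def[symmetric] by (simp_all add: field_simps)
  show "\<exists>H\<ge>1. (AE \<omega> in fedpg E T B \<eta> H \<theta>0. \<mu> \<le> (INF r. mu_soft E astar (\<omega> r))) \<longrightarrow>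
        (\<forall>R :: nat.
          2000 * ((\<delta>0 - \<epsilon> / 6) / (\<delta>0 * \<mu> * \<epsilon>)) * (1 / (1 - \<gamma>) ^ 3) \<le> real R \<and>
          2000 * ((\<delta>0 - \<epsilon> / 6) / (\<delta>0 * \<mu> * \<epsilon>)) *
            Max {real B / (1 - \<gamma>) ^ 3,
                 1 / ((1 - \<gamma>) ^ 7 * \<mu> * real M * \<epsilon>\<^sup>2),
                 1 / ((1 - \<gamma>) ^ 5 * sqrt \<mu> * \<epsilon>)} \<le> real R * real H * real B
          \<longrightarrow>
          (\<integral>\<omega>. J_star E - J E (\<omega> R) \<partial>fedpg E T B \<eta> H \<theta>0) \<le> \<epsilon>)"
    using opt by (intro exI[of _ H] conjI H1 impI allI, elim conjE)
      (rule fedpg_rate[OF _ pos \<mu> B \<eta> \<epsilon> T' HH err' \<eta>1[unfolded \<gamma> M] \<eta>2[unfolded \<gamma>] _ \<delta>0 \<delta>0_pos, where d=astar];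
        simp add: \<gamma> M)
qed

end
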